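(* Let $X,\partial X$ be Banach spaces and let $A:D(A)\subseteq X\to X$, $L:D(A)\to\partial X$ and $B:D(B)\subseteq X\to\partial X$ be linear operators with $D(A)\subseteq D(B)$ such that (G1) the restriction $A_0:=A|_{\ker(L)}$, $D(A_0):=\ker(L)$, is closed and densely defined in $X$ and has non-empty resolvent set; (G2) $L:D(A)\to\partial X$ is surjective; (G3) the operator $\binom AL:D(A)\subseteq X\to X\times\partial X$, $u\mapsto(Au,Lu)$, is closed. Assume that $B$ is relatively $A_0$-bounded, and that $B_{\lambda_0}:=B\mathcal D_{\lambda_0}:\partial X\to\partial X$ is bounded for some $\lambda_0\in\rho(A_0)$. Let $\tilde{\mathcal A}$ be the operator on $\mathcal X:=X\times\partial X$ given by $$\tilde{\mathcal A}\binom uv:=\binom{Au}{Bu},\qquad D(\tilde{\mathcal A}):=\left\{\binom uv\in D(A)\times\partial X: Lu=v\right\}.$$ Then $\tilde{\mathcal A}$ generates a strongly continuous (respectively, analytic) semigroup on $\mathcal X$ if and only if the operator $A_0-\mathcal D_{\lambda_0}B$, defined on $D(A_0)$, generates a strongly continuous (respectively, analytic) semigroup on $X$.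
   Context: Under (G1)-(G3), for every $\lambda\in\rho(A_0)$ the restriction $L|_{\ker(\lambda-A)}:\ker(\lambda-A)\to\partial X$ is bijective; its inverse $\mathcal D_\lambda:=(L|_{\ker(\lambda-A)})^{-1}:\partial X\to\ker(\lambda-A)\subseteq D(A)\subseteq X$ is called the Dirichlet operator and is bounded as an operator into $X$. "$B$ is relatively $A_0$-bounded" means that there are constants $a,b\ge0$ with $\|Bu\|\le a\|A_0u\|+b\|u\|$ for all $u\in D(A_0)$. *)

theory Defs
  imports "HOL-Analysis.Analysis"
begin

subsection \<open>Complex Banach spaces\<close>

text \<open>The library only has real normed spaces. Resolvent sets and analytic semigroups
  need complex scalars.\<close>

class complex_normed_vector = real_normed_vector +
  fixes scaleC :: "complex \<Rightarrow> 'a \<Rightarrow> 'a"  (infixr \<open>*\<^sub>C\<close> 75)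
  assumes scaleC_add_right: "c *\<^sub>C (x + y) = c *\<^sub>C x + c *\<^sub>C y"
    and scaleC_add_left: "(c + d) *\<^sub>C x = c *\<^sub>C x + d *\<^sub>C x"
    and scaleC_scaleC: "c *\<^sub>C (d *\<^sub>C x) = (c * d) *\<^sub>C x"
    and scaleC_of_real: "complex_of_real r *\<^sub>C x = r *\<^sub>R x"
    and norm_scaleC: "norm (c *\<^sub>C x) = cmod c * norm x"

class complex_banach = complex_normed_vector + banach

instantiation complex :: complex_normed_vector
begin

definition scaleC_complex :: "complex \<Rightarrow> complex \<Rightarrow> complex"
  where "scaleC_complex c x = c * x"

instance
  by standard (simp_all add: scaleC_complex_def algebra_simps norm_mult scaleR_conv_of_real)

end

instance complex :: complex_banach ..

instantiation prod :: (complex_normed_vector, complex_normed_vector) complex_normed_vector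
begin

definition scaleC_prod :: "complex \<Rightarrow> 'a \<times> 'b \<Rightarrow> 'a \<times> 'b"
  where "scaleC_prod c p = (c *\<^sub>C fst p, c *\<^sub>C snd p)"

instance
proof
  fix c d :: complex and x y :: "'a \<times> 'b" and r :: real
  show "norm (c *\<^sub>C x) = cmod c * norm x"
    by (simp add: scaleC_prod_def norm_prod_def norm_scaleC power_mult_distrib
        real_sqrt_mult flip: distrib_left)
qed (simp_all add: scaleC_prod_def scaleC_add_right scaleC_add_left scaleC_scaleC
      scaleC_of_real scaleR_prod_def)

end

instance prod :: (complex_banach, complex_banach) complex_banach ..

lemma bounded_linear_scaleC: "bounded_linear (\<lambda>x::'a::complex_normed_vector. c *\<^sub>C x)"
proof (rule bounded_linear_intro)
  show "c *\<^sub>C (r *\<^sub>R x) = r *\<^sub>R (c *\<^sub>C x)" for r and x :: 'a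
    by (simp add: scaleC_scaleC mult.commute flip: scaleC_of_real)
  show "norm (c *\<^sub>C x) \<le> norm x * cmod c" for x :: 'a
    by (simp add: norm_scaleC)
qed (simp add: scaleC_add_right)

instantiation blinfun :: (real_normed_vector, complex_normed_vector) complex_normed_vector
begin

lift_definition scaleC_blinfun :: "complex \<Rightarrow> 'a \<Rightarrow>\<^sub>L 'b \<Rightarrow> 'a \<Rightarrow>\<^sub>L 'b"
  is "\<lambda>c f x. c *\<^sub>C f x"
  by (rule bounded_linear_compose[OF bounded_linear_scaleC])

instance
proof
  fix c d :: complex and f g :: "'a \<Rightarrow>\<^sub>L 'b" and r :: real
  show "c *\<^sub>C (f + g) = c *\<^sub>C f + c *\<^sub>C g"
    by transfer (simp add: scaleC_add_right)
  show "(c + d) *\<^sub>C f = c *\<^sub>C f + d *\<^sub>C f"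
    by transfer (simp add: scaleC_add_left)
  show assoc: "c *\<^sub>C (d *\<^sub>C f) = (c * d) *\<^sub>C f" for c d and f :: "'a \<Rightarrow>\<^sub>L 'b"
    by transfer (simp add: scaleC_scaleC)
  show of_real: "complex_of_real r *\<^sub>C f = r *\<^sub>R f" for r and f :: "'a \<Rightarrow>\<^sub>L 'b"
    by transfer (simp add: scaleC_of_real)
  have le: "norm (d *\<^sub>C g) \<le> cmod d * norm g" for d and g :: "'a \<Rightarrow>\<^sub>L 'b"
  proof (rule norm_blinfun_bound)
    show "norm (blinfun_apply (d *\<^sub>C g) x) \<le> cmod d * norm g * norm x" for x
      using mult_left_mono[OF norm_blinfun[of g x] norm_ge_zero[of d]]
      by (simp add: scaleC_blinfun.rep_eq norm_scaleC mult.assoc)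
  qed simp
  show "norm (c *\<^sub>C f) = cmod c * norm f"
  proof (cases "c = 0")
    case True
    then show ?thesis using le[of c f] by simp
  next
    case False
    have "inverse c *\<^sub>C c *\<^sub>C f = complex_of_real 1 *\<^sub>C f"
      using False by (simp add: assoc)
    then have "inverse c *\<^sub>C c *\<^sub>C f = f"
      by (simp only: of_real scaleR_one)
    then have "norm f \<le> inverse (cmod c) * norm (c *\<^sub>C f)"
      using le[of "inverse c" "c *\<^sub>C f"] by (simp add: norm_inverse)
    then have "cmod c * norm f \<le> norm (c *\<^sub>C f)"
      using False by (simp add: field_simps)
    then show ?thesis using le[of c f] by simp
  qed
qed

end


subsection \<open>Unbounded linear operators\<close>

text \<open>An operator is given by its domain and a function, whose values
  outside the domain are irrelevant.\<close>

definition linear_operator ::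
    "'a::complex_normed_vector set \<Rightarrow> ('a \<Rightarrow> 'b::complex_normed_vector) \<Rightarrow> bool"
  where "linear_operator D A \<longleftrightarrow>
    0 \<in> D \<and>
    (\<forall>x\<in>D. \<forall>y\<in>D. x + y \<in> D \<and> A (x + y) = A x + A y) \<and>
    (\<forall>c. \<forall>x\<in>D. c *\<^sub>C x \<in> D \<and> A (c *\<^sub>C x) = c *\<^sub>C A x)"

definition closed_operator ::
    "'a::complex_normed_vector set \<Rightarrow> ('a \<Rightarrow> 'b::complex_normed_vector) \<Rightarrow> bool"
  where "closed_operator D A \<longleftrightarrow> closed ((\<lambda>u. (u, A u)) ` D)"

definition op_ker :: "'a set \<Rightarrow> ('a \<Rightarrow> 'b::zero) \<Rightarrow> 'a set"
  where "op_ker D A = {u \<in> D. A u = 0}"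

definition resolvent_set ::
    "'a::complex_normed_vector set \<Rightarrow> ('a \<Rightarrow> 'a) \<Rightarrow> complex set"
  where "resolvent_set D A =
    {\<mu>. bij_betw (\<lambda>u. \<mu> *\<^sub>C u - A u) D UNIV \<and>
        bounded_linear (the_inv_into D (\<lambda>u. \<mu> *\<^sub>C u - A u))}"

definition relatively_bounded ::
    "'a::complex_normed_vector set \<Rightarrow> ('a \<Rightarrow> 'b::complex_normed_vector) \<Rightarrow>
      ('a \<Rightarrow> 'c::complex_normed_vector) \<Rightarrow> bool"
  where "relatively_bounded D A B \<longleftrightarrow>
    (\<exists>a\<ge>0. \<exists>b\<ge>0. \<forall>u\<in>D. norm (B u) \<le> a * norm (A u) + b * norm u)"

definition dirichlet_operator ::
    "'a::complex_normed_vector set \<Rightarrow> ('a \<Rightarrow> 'a) \<Rightarrow> ('a \<Rightarrow> 'b) \<Rightarrow> complex \<Rightarrow> 'b \<Rightarrow> 'a"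
  where "dirichlet_operator D A L \<mu> = the_inv_into (op_ker D (\<lambda>u. \<mu> *\<^sub>C u - A u)) L"

lemma linear_operator_diff:
  fixes F :: "'a::complex_normed_vector \<Rightarrow> 'b::complex_normed_vector"
  assumes F: "linear_operator D F" and x: "x \<in> D" and y: "y \<in> D"
  shows "x - y \<in> D \<and> F (x - y) = F x - F y"
proof -
  have "complex_of_real (- 1) *\<^sub>C y \<in> D \<and>
      F (complex_of_real (- 1) *\<^sub>C y) = complex_of_real (- 1) *\<^sub>C F y"
    using F y unfolding linear_operator_def by blast
  then have "- y \<in> D \<and> F (- y) = - F y"
    unfolding scaleC_of_real by simp
  moreover from this have "x + - y \<in> D \<and> F (x + - y) = F x + F (- y)"
    using F x unfolding linear_operator_def by blast
  ultimately show ?thesis by simp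
qed

text \<open>The restriction inverted in the definition above is indeed a bijection.\<close>

lemma bij_betw_dirichlet:
  fixes A :: "'a::complex_normed_vector \<Rightarrow> 'a" and L :: "'a \<Rightarrow> 'b::complex_normed_vector"
  assumes A: "linear_operator D A" and L: "linear_operator D L" and surj: "L ` D = UNIV"
    and \<mu>: "\<mu> \<in> resolvent_set (op_ker D L) A"
  shows "bij_betw L (op_ker D (\<lambda>u. \<mu> *\<^sub>C u - A u)) UNIV"
proof -
  note minus = linear_operator_diff
  have scaleC_minus: "\<mu> *\<^sub>C (x - y) = \<mu> *\<^sub>C x - \<mu> *\<^sub>C y" for x y :: 'a
    using scaleC_add_right[of \<mu> "x - y" y] by simp
  have bij: "bij_betw (\<lambda>u. \<mu> *\<^sub>C u - A u) (op_ker D L) UNIV"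
    using \<mu> by (simp add: resolvent_set_def)
  have ker_iff: "u \<in> op_ker D (\<lambda>u. \<mu> *\<^sub>C u - A u) \<longleftrightarrow> u \<in> D \<and> \<mu> *\<^sub>C u = A u"
    "u \<in> op_ker D L \<longleftrightarrow> u \<in> D \<and> L u = 0" for u
    by (simp_all add: op_ker_def)
  show ?thesis
  proof (rule bij_betw_imageI)
    show "inj_on L (op_ker D (\<lambda>u. \<mu> *\<^sub>C u - A u))"
    proof (rule inj_onI)
      fix x y
      assume x: "x \<in> op_ker D (\<lambda>u. \<mu> *\<^sub>C u - A u)"
        and y: "y \<in> op_ker D (\<lambda>u. \<mu> *\<^sub>C u - A u)" and eq: "L x = L y"
      have xD: "x \<in> D" "\<mu> *\<^sub>C x = A x" and yD: "y \<in> D" "\<mu> *\<^sub>C y = A y"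
        using x y by (simp_all add: ker_iff)
      have "x - y \<in> op_ker D L" "y - y \<in> op_ker D L"
        unfolding ker_iff using eq minus[OF L xD(1) yD(1)] minus[OF L yD(1) yD(1)] by simp_all
      moreover have "\<mu> *\<^sub>C (x - y) - A (x - y) = \<mu> *\<^sub>C (y - y) - A (y - y)"
        unfolding scaleC_minus minus[OF A xD(1) yD(1), THEN conjunct2]
          minus[OF A yD(1) yD(1), THEN conjunct2] xD(2) yD(2) by simp
      ultimately have "x - y = y - y"
        using inj_onD[OF bij_betw_imp_inj_on[OF bij], of "x - y" "y - y"] by blast
      then show "x = y" by simp
    qed
    have "v \<in> L ` op_ker D (\<lambda>u. \<mu> *\<^sub>C u - A u)" for v
    proof -
      obtain w where w: "w \<in> D" "v = L w"
        using surj by blast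
      have "\<mu> *\<^sub>C w - A w \<in> (\<lambda>u. \<mu> *\<^sub>C u - A u) ` op_ker D L"
        unfolding bij_betw_imp_surj_on[OF bij] by (rule UNIV_I)
      then obtain u where u: "u \<in> op_ker D L" "\<mu> *\<^sub>C w - A w = \<mu> *\<^sub>C u - A u"
        by blast
      have uD: "u \<in> D" "L u = 0" using u(1) by (simp_all add: ker_iff)
      have "\<mu> *\<^sub>C (w - u) = A (w - u)"
        unfolding scaleC_minus minus[OF A w(1) uD(1), THEN conjunct2]
        using u(2) by (metis add_diff_cancel_left' diff_diff_eq2 diff_eq_eq)
      then have "w - u \<in> op_ker D (\<lambda>u. \<mu> *\<^sub>C u - A u)"
        unfolding ker_iff using minus[OF A w(1) uD(1)] by simp
      moreover have "L (w - u) = v"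
        using minus[OF L w(1) uD(1)] uD(2) w(2) by simp
      ultimately show ?thesis by blast
    qed
    then show "L ` op_ker D (\<lambda>u. \<mu> *\<^sub>C u - A u) = UNIV" by blast
  qed
qed


subsection \<open>Semigroups and their generators\<close>

definition complex_linear_blinfun :: "('a::complex_normed_vector \<Rightarrow>\<^sub>L 'a) \<Rightarrow> bool"
  where "complex_linear_blinfun T \<longleftrightarrow>
    (\<forall>c x. blinfun_apply T (c *\<^sub>C x) = c *\<^sub>C blinfun_apply T x)"

definition C0_semigroup :: "(real \<Rightarrow> 'a::complex_banach \<Rightarrow>\<^sub>L 'a) \<Rightarrow> bool"
  where "C0_semigroup T \<longleftrightarrow>
    (\<forall>t\<ge>0. complex_linear_blinfun (T t)) \<and>
    T 0 = id_blinfun \<and>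
    (\<forall>s\<ge>0. \<forall>t\<ge>0. T (s + t) = T s o\<^sub>L T t) \<and>
    (\<forall>x. continuous_on {0..} (\<lambda>t. blinfun_apply (T t) x))"

text \<open>The domain of a generator is all of the set where the difference quotient converges.\<close>

definition is_generator ::
    "(real \<Rightarrow> 'a::complex_banach \<Rightarrow>\<^sub>L 'a) \<Rightarrow> 'a set \<Rightarrow> ('a \<Rightarrow> 'a) \<Rightarrow> bool"
  where "is_generator T D A \<longleftrightarrow>
    D = {x. \<exists>y. ((\<lambda>h. (blinfun_apply (T h) x - x) /\<^sub>R h) \<longlongrightarrow> y) (at_right 0)} \<and>
    (\<forall>x\<in>D. ((\<lambda>h. (blinfun_apply (T h) x - x) /\<^sub>R h) \<longlongrightarrow> A x) (at_right 0))"

definition generates_C0_semigroup :: "'a::complex_banach set \<Rightarrow> ('a \<Rightarrow> 'a) \<Rightarrow> bool"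
  where "generates_C0_semigroup D A \<longleftrightarrow> (\<exists>T. C0_semigroup T \<and> is_generator T D A)"

definition sector :: "real \<Rightarrow> complex set"
  where "sector \<delta> = {z. z \<noteq> 0 \<and> \<bar>Arg z\<bar> < \<delta>}"

text \<open>On an open set, analyticity of a vector-valued map is complex differentiability at every
  point. It is used below for operator-valued maps, with respect to the operator norm.\<close>

definition vector_holomorphic_on ::
    "(complex \<Rightarrow> 'a::complex_normed_vector) \<Rightarrow> complex set \<Rightarrow> bool"
  where "vector_holomorphic_on f S \<longleftrightarrow>
    (\<forall>z\<in>S. \<exists>f'. ((\<lambda>w. inverse (w - z) *\<^sub>C (f w - f z)) \<longlongrightarrow> f') (at z))"

definition analytic_semigroup :: "real \<Rightarrow> (complex \<Rightarrow> 'a::complex_banach \<Rightarrow>\<^sub>L 'a) \<Rightarrow> bool"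
  where "analytic_semigroup \<delta> T \<longleftrightarrow>
    (\<forall>z\<in>sector \<delta>. complex_linear_blinfun (T z)) \<and>
    T 0 = id_blinfun \<and>
    (\<forall>z\<in>sector \<delta>. \<forall>w\<in>sector \<delta>. T (z + w) = T z o\<^sub>L T w) \<and>
    vector_holomorphic_on T (sector \<delta>) \<and>
    (\<forall>\<delta>'. 0 < \<delta>' \<and> \<delta>' < \<delta> \<longrightarrow>
      (\<forall>x. ((\<lambda>z. blinfun_apply (T z) x) \<longlongrightarrow> x) (at 0 within sector \<delta>')))"

definition generates_analytic_semigroup :: "'a::complex_banach set \<Rightarrow> ('a \<Rightarrow> 'a) \<Rightarrow> bool"
  where "generates_analytic_semigroup D A \<longleftrightarrow>
    (\<exists>\<delta> T. 0 < \<delta> \<and> \<delta> \<le> pi / 2 \<and> analytic_semigroup \<delta> T \<and>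
      is_generator (\<lambda>t. T (complex_of_real t)) D A)"

end

theory Submission
  imports Defs
begin

text \<open>Let \<open>D\<close> be the Dirichlet operator at \<open>\<mu>\<close> and \<open>G = A\<^sub>0 - D B\<close>. The shear
  \<open>(u, v) \<mapsto> (u - D v, v)\<close> maps the coupled domain onto \<open>D(A\<^sub>0) \<times> \<partial>X\<close> and turns the matrix
  operator into \<open>(u, v) \<mapsto> (G u, B u)\<close> plus a bounded operator. If \<open>B = K (\<omega> - G)\<close> on \<open>D(A\<^sub>0)\<close> with
  \<open>K\<close> bounded, the shear \<open>(u, v) \<mapsto> (u, v + K u)\<close> turns \<open>(u, v) \<mapsto> (G u, B u)\<close> into
  \<open>(u, v) \<mapsto> (G u, 0)\<close> plus a bounded operator, and the latter generates iff \<open>G\<close> does. So only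
  similarity and bounded perturbation are needed. For analytic semigroups both are reduced to the
  strongly continuous case: an operator \<open>A\<close> generates an analytic semigroup iff all rotations \<open>z A\<close>,
  \<open>z\<close> in the unit circle and in some sector, generate strongly continuous semigroups that are
  bounded on \<open>[0, 1]\<close> uniformly in \<open>z\<close>.\<close>

subsection \<open>Uniform boundedness and the closed graph theorem\<close>

text \<open>The lower left entry \<open>B\<close> is unbounded, so it cannot be dropped as a
  perturbation; it has to be absorbed by a similarity, and for that it must be a bounded operator
  after \<open>\<omega> - G\<close>. This asks for a resolvent of \<open>G\<close>, which is at hand
  only when \<open>G\<close> is known to generate. When the matrix is the known generator, its own
  resolvent supplies \<open>K\<close>: the identity
  \<open>(\<omega> - P) (u, B u / \<omega>) = (\<omega> u - G u, 0)\<close> lets \<open>B u\<close>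
  be read off a second component. Rotations fit this scheme because \<open>K\<close> and both shears
  do not depend on \<open>z\<close>: similarity commutes with the scalar, and the perturbation
  \<open>z C\<close> has the norm of \<open>C\<close>. A bound \<open>M\<close> on the unit interval
  therefore becomes a number computed from \<open>M\<close> and fixed operators, and the sector
  stays the same. The price is the passage from rays back to an analytic semigroup: each ray carries
  a semigroup of its own, and different rays are related only through their generators, which are
  multiples of one operator.\<close>

lemma Baire_closed_cover:
  fixes F :: "nat \<Rightarrow> 'a::banach set"
  assumes "\<And>n. closed (F n)" and "(\<Union>n. F n) = UNIV"
  obtains n x e where "0 < e" "ball x e \<subseteq> F n"
proof -
  have "\<exists>n. interior (F n) \<noteq> {}"
  proof (rule ccontr)
    assume "\<not> ?thesis"
    then have "(euclidean :: 'a topology) interior_of \<Union>(range F) = {}"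
      using assms(1) by (intro Baire_category_alt) (auto simp: completely_metrizable_space_euclidean)
    then show False
      using assms(2) by simp
  qed
  then show thesis
    using that by (metis ex_in_conv mem_interior)
qed

lemma norm_blinfun_le_of_ball:
  fixes T :: "'a::real_normed_vector \<Rightarrow>\<^sub>L 'b::real_normed_vector"
  assumes e: "0 < e" and c: "0 \<le> c" and T: "\<And>y. norm y < e \<Longrightarrow> norm (T y) \<le> c"
  shows "norm T \<le> 2 * c / e"
proof (rule norm_blinfun_bound)
  show "0 \<le> 2 * c / e" using e c by simp
  fix x
  show "norm (T x) \<le> 2 * c / e * norm x"
  proof (cases "x = 0")
    case False
    have "norm (T ((e / (2 * norm x)) *\<^sub>R x)) \<le> c"
      using e False by (intro T) simp
    then have "e / (2 * norm x) * norm (T x) \<le> c"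
      using e by (simp add: blinfun.scaleR_right)
    then show ?thesis using e False by (simp add: field_simps)
  qed simp
qed

text \<open>Baire makes some sublevel set \<open>E n\<close> contain a ball around \<open>x\<close>;
  writing \<open>y = (x + y) - x\<close> moves the ball to the origin at the cost of a factor
  2.\<close>

theorem uniform_boundedness:
  fixes F :: "('a::banach \<Rightarrow>\<^sub>L 'b::real_normed_vector) set"
  assumes "\<And>x. bounded ((\<lambda>T. blinfun_apply T x) ` F)"
  obtains M where "0 < M" "\<And>T. T \<in> F \<Longrightarrow> norm T \<le> M"
proof -
  define E where "E n = {x. \<forall>T\<in>F. norm (blinfun_apply T x) \<le> real n}" for n
  have "closed (E n)" for n
  proof -
    have "E n = (\<Inter>T\<in>F. {x. norm (blinfun_apply T x) \<le> real n})"
      by (auto simp: E_def)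
    then show ?thesis
      by (auto intro!: closed_INT closed_Collect_le continuous_intros)
  qed
  moreover have "(\<Union>n. E n) = UNIV"
  proof -
    have "\<exists>n. x \<in> E n" for x
    proof -
      obtain b where "\<forall>T\<in>F. norm (blinfun_apply T x) \<le> b"
        using assms[of x] by (auto simp: bounded_iff)
      moreover obtain n where "b \<le> real n" using real_arch_simple by blast
      ultimately show ?thesis unfolding E_def using order_trans by blast
    qed
    then show ?thesis by blast
  qed
  ultimately obtain n x e where e: "0 < e" "ball x e \<subseteq> E n"
    by (rule Baire_closed_cover)
  have "norm T \<le> 2 * (2 * real n) / e" if T: "T \<in> F" for T
  proof (rule norm_blinfun_le_of_ball[OF e(1)])
    fix y :: 'a assume "norm y < e"
    then have "x + y \<in> E n" "x \<in> E n"
      using e by (auto simp: dist_norm subset_iff)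
    then have "norm (T (x + y)) \<le> n" "norm (T x) \<le> n"
      using T by (auto simp: E_def)
    moreover have "T y = T (x + y) - T x" by (simp add: blinfun.add_right)
    ultimately show "norm (T y) \<le> 2 * real n"
      using norm_triangle_ineq4[of "T (x + y)" "T x"] by simp
  qed simp
  then show thesis
    using that[of "2 * (2 * real n) / e + 1"] e by (smt (verit) divide_nonneg_pos of_nat_0_le_iff)
qed

text \<open>Baire only shows that closures of sublevel sets contain a ball. Successive approximation
  in halving balls removes the closure: a vector becomes a series whose images are summable, and the
  graph hypothesis identifies the sum of the images.\<close>

theorem closed_graph:
  fixes f :: "'a::banach \<Rightarrow> 'b::banach"
  assumes f: "linear f"
    and graph: "\<And>X x y. X \<longlonglongrightarrow> x \<Longrightarrow> (\<lambda>n. f (X n)) \<longlonglongrightarrow> y \<Longrightarrow> f x = y"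
  shows "bounded_linear f"
proof -
  define E where "E n = closure {x. norm (f x) \<le> real n}" for n
  have "\<exists>n. x \<in> E n" for x
  proof -
    obtain n where "norm (f x) \<le> real n" using real_arch_simple by blast
    then have "x \<in> E n" unfolding E_def by (intro closure_subset[THEN subsetD]) simp
    then show ?thesis by blast
  qed
  then have "(\<Union>n. E n) = UNIV" by blast
  moreover have "closed (E n)" for n by (simp add: E_def)
  ultimately obtain n x e where e: "0 < e" "ball x e \<subseteq> E n"
    by (metis Baire_closed_cover)
  define c where "c = 2 * real n + 1"
  have c: "0 < c" by (simp add: c_def)
  have approx0: "\<exists>z. norm (f z) \<le> c \<and> norm (y - z) < d" if y: "norm y < e" and d: "0 < d" for y d
  proof -
    have "x + y \<in> E n" "x \<in> E n"
      using e y by (auto simp: dist_norm subset_iff)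
    then obtain u v where u: "norm (f u) \<le> n" "dist u (x + y) < d / 2"
      and v: "norm (f v) \<le> n" "dist v x < d / 2"
      using d unfolding E_def closure_approachable by (metis half_gt_zero mem_Collect_eq)
    have "norm (f (u - v)) \<le> c"
      using norm_triangle_ineq4[of "f u" "f v"] u v by (simp add: linear_diff[OF f] c_def)
    moreover have "norm (y - (u - v)) < d"
    proof -
      have "y - (u - v) = (v - x) - (u - (x + y))" by simp
      then show ?thesis
        using norm_triangle_ineq4[of "v - x" "u - (x + y)"] u v by (simp only: dist_norm)
    qed
    ultimately show ?thesis by blast
  qed
  have approx: "\<exists>z. norm (f z) \<le> c * (1/2)^k \<and> norm (y - z) < e * (1/2)^Suc k"
    if "norm y < e * (1/2)^k" for y k
  proof -
    have "norm ((2::real)^k *\<^sub>R y) < e"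
      using that by (simp add: field_simps)
    then obtain z where z: "norm (f z) \<le> c" "norm (2^k *\<^sub>R y - z) < e / 2"
      using approx0 e(1) by (metis half_gt_zero)
    have "2^k *\<^sub>R y - z = 2^k *\<^sub>R (y - (1/2)^k *\<^sub>R z)"
      by (simp add: scaleR_diff_right flip: power_mult_distrib)
    then have "2^k * norm (y - (1/2)^k *\<^sub>R z) < e / 2" using z(2) by simp
    then have "norm (y - (1/2)^k *\<^sub>R z) < e * (1/2)^Suc k" by (simp add: field_simps)
    moreover have "norm (f ((1/2)^k *\<^sub>R z)) \<le> c * (1/2)^k"
      using z(1) by (simp add: linear_scale[OF f] field_simps)
    ultimately show ?thesis by blast
  qed
  have bound: "norm (f y) \<le> 2 * c" if y: "norm y < e" for y
  proof -
    \<comment> \<open>\<open>g k\<close> approximates a vector of the \<open>k\<close>-th ball, and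
      \<open>r k\<close> is the remainder after \<open>k\<close> corrections. The corrections sum to
      \<open>y\<close> because \<open>r\<close> tends to 0.\<close>
    define g where "g k y = (SOME z. norm (f z) \<le> c * (1/2)^k \<and> norm (y - z) < e * (1/2)^Suc k)" for k y
    have g: "norm (f (g k y)) \<le> c * (1/2)^k \<and> norm (y - g k y) < e * (1/2)^Suc k"
      if "norm y < e * (1/2)^k" for k y
      unfolding g_def using approx[OF that] by (rule someI_ex)
    define r where "r = rec_nat y (\<lambda>k y. y - g k y)"
    have r0: "r 0 = y" and rS: "r (Suc k) = r k - g k (r k)" for k by (simp_all add: r_def)
    have r: "norm (r k) < e * (1/2)^k" for k
      by (induction k) (use y g r0 rS in auto)
    have "r \<longlonglongrightarrow> 0"
    proof (rule Lim_null_comparison)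
      show "\<forall>\<^sub>F k in sequentially. norm (r k) \<le> e * (1/2)^k" using r by (simp add: less_imp_le)
      show "(\<lambda>k. e * (1/2)^k) \<longlonglongrightarrow> 0"
        by (intro tendsto_mult_right_zero LIMSEQ_power_zero) simp
    qed
    moreover have sum_g: "(\<Sum>k<m. g k (r k)) = y - r m" for m
      by (induction m) (auto simp: r0 rS)
    ultimately have "(\<lambda>m. \<Sum>k<m. g k (r k)) \<longlonglongrightarrow> y"
      using tendsto_diff[OF tendsto_const[of y]] by fastforce
    moreover have geo: "(\<lambda>k. c * (1/2)^k) sums (2 * c)"
      using sums_mult[OF power_half_series, of "2 * c"] by simp
    have fle: "norm (f (g k (r k))) \<le> c * (1/2)^k" for k using g r by blast
    have "summable (\<lambda>k. norm (f (g k (r k))))"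
      by (rule summable_comparison_test[OF _ sums_summable[OF geo]]) (use fle in auto)
    then have sumf: "summable (\<lambda>k. f (g k (r k)))" by (rule summable_norm_cancel)
    then have "(\<lambda>m. f (\<Sum>k<m. g k (r k))) \<longlonglongrightarrow> (\<Sum>k. f (g k (r k)))"
      by (simp add: linear_sum[OF f] summable_LIMSEQ)
    ultimately have "f y = (\<Sum>k. f (g k (r k)))" by (rule graph)
    then show ?thesis
      using norm_suminf_le[OF fle sums_summable[OF geo]] sums_unique[OF geo] by simp
  qed
  have "norm (f y) \<le> norm y * (4 * c / e)" for y
  proof (cases "y = 0")
    case False
    have "norm (f ((e / (2 * norm y)) *\<^sub>R y)) \<le> 2 * c"
      using e False by (intro bound) simp
    then have "e / (2 * norm y) * norm (f y) \<le> 2 * c"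
      using e by (simp add: linear_scale[OF f])
    then show ?thesis using e False by (simp add: field_simps)
  qed (simp add: linear_0[OF f])
  then show ?thesis
    by (rule bounded_linear_intro[OF linear_add[OF f] linear_scale[OF f]])
qed

subsection \<open>Complex scalars and difference quotients\<close>

lemma bounded_bilinear_scaleC:
  "bounded_bilinear (scaleC :: complex \<Rightarrow> 'a::complex_normed_vector \<Rightarrow> 'a)"
proof
  fix r :: real and c :: complex and x :: 'a
  show "(r *\<^sub>R c) *\<^sub>C x = r *\<^sub>R c *\<^sub>C x"
    by (simp add: scaleR_conv_of_real scaleC_scaleC flip: scaleC_of_real)
  show "c *\<^sub>C r *\<^sub>R x = r *\<^sub>R c *\<^sub>C x"
    by (simp add: scaleC_scaleC mult.commute flip: scaleC_of_real)
  show "\<exists>K. \<forall>c x. norm (c *\<^sub>C x :: 'a) \<le> norm c * norm x * K"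
    by (rule exI[of _ 1]) (simp add: norm_scaleC)
qed (simp_all add: scaleC_add_left scaleC_add_right)

interpretation scaleC: bounded_bilinear "scaleC :: complex \<Rightarrow> 'a::complex_normed_vector \<Rightarrow> 'a"
  by (rule bounded_bilinear_scaleC)

declare scaleC.zero_left [simp] scaleC.zero_right [simp]
lemmas [continuous_intros] = scaleC.continuous_on scaleC.continuous
lemmas [tendsto_intros] = scaleC.tendsto

lemma scaleC_one [simp]: "1 *\<^sub>C (x :: 'a::complex_normed_vector) = x"
  using scaleC_of_real[of 1 x] by simp

lemma scaleC_scaleR_commute: "c *\<^sub>C r *\<^sub>R x = r *\<^sub>R c *\<^sub>C (x :: 'a::complex_normed_vector)"
  by (rule scaleC.scaleR_right)

lemma linear_operatorD:
  assumes "linear_operator D F"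
  shows "0 \<in> D" "x \<in> D \<Longrightarrow> y \<in> D \<Longrightarrow> x + y \<in> D" "x \<in> D \<Longrightarrow> y \<in> D \<Longrightarrow> x - y \<in> D"
    "x \<in> D \<Longrightarrow> c *\<^sub>C x \<in> D" "x \<in> D \<Longrightarrow> r *\<^sub>R x \<in> D"
    "x \<in> D \<Longrightarrow> y \<in> D \<Longrightarrow> F (x + y) = F x + F y" "x \<in> D \<Longrightarrow> y \<in> D \<Longrightarrow> F (x - y) = F x - F y"
    "x \<in> D \<Longrightarrow> F (c *\<^sub>C x) = c *\<^sub>C F x" "x \<in> D \<Longrightarrow> F (r *\<^sub>R x) = r *\<^sub>R F x" "F 0 = 0"
proof -
  note lin = assms[unfolded linear_operator_def]
  show "0 \<in> D" "x \<in> D \<Longrightarrow> y \<in> D \<Longrightarrow> x + y \<in> D" "x \<in> D \<Longrightarrow> c *\<^sub>C x \<in> D"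
    "x \<in> D \<Longrightarrow> y \<in> D \<Longrightarrow> F (x + y) = F x + F y" "x \<in> D \<Longrightarrow> F (c *\<^sub>C x) = c *\<^sub>C F x"
    using lin by blast+
  show "x \<in> D \<Longrightarrow> y \<in> D \<Longrightarrow> x - y \<in> D" "x \<in> D \<Longrightarrow> y \<in> D \<Longrightarrow> F (x - y) = F x - F y"
    using linear_operator_diff[OF assms] by blast+
  show "x \<in> D \<Longrightarrow> r *\<^sub>R x \<in> D" "x \<in> D \<Longrightarrow> F (r *\<^sub>R x) = r *\<^sub>R F x"
    using lin by (simp_all flip: scaleC_of_real)
  have "F (0 + 0) = F 0 + F 0" using lin by blast
  then show "F 0 = 0" by simp
qed

lemma quotient_swap:
  fixes x y :: "'a::real_vector" and s t :: real
  shows "(x - y) /\<^sub>R (s - t) = (y - x) /\<^sub>R (t - s)"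
proof -
  have "inverse (s - t) = - inverse (t - s)" by (metis inverse_minus_eq minus_diff_eq)
  then show ?thesis by (simp add: algebra_simps)
qed

lemma has_vector_derivative_iff_quotient:
  "(f has_vector_derivative f') (at x within S) \<longleftrightarrow>
    ((\<lambda>y. (f y - f x) /\<^sub>R (y - x)) \<longlongrightarrow> f') (at x within S)"
proof -
  have "(f has_vector_derivative f') (at x within S) \<longleftrightarrow>
      ((\<lambda>y. norm ((f y - f x) - (y - x) *\<^sub>R f') / norm (y - x)) \<longlongrightarrow> 0) (at x within S)"
    by (simp add: has_vector_derivative_def has_derivative_iff_norm bounded_linear_scaleR_left)
  also have "\<dots> \<longleftrightarrow> ((\<lambda>y. norm ((f y - f x) /\<^sub>R (y - x) - f')) \<longlongrightarrow> 0) (at x within S)"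
  proof (rule filterlim_cong[OF refl refl])
    have "norm ((f y - f x) - (y - x) *\<^sub>R f') / norm (y - x) = norm ((f y - f x) /\<^sub>R (y - x) - f')"
      if "y \<noteq> x" for y
    proof -
      have "(f y - f x) - (y - x) *\<^sub>R f' = (y - x) *\<^sub>R ((f y - f x) /\<^sub>R (y - x) - f')"
        using that by (simp add: scaleR_diff_right)
      then show ?thesis using that by simp
    qed
    then show "\<forall>\<^sub>F y in at x within S. norm ((f y - f x) - (y - x) *\<^sub>R f') / norm (y - x)
        = norm ((f y - f x) /\<^sub>R (y - x) - f')"
      by (auto simp: eventually_at_filter)
  qed
  also have "\<dots> \<longleftrightarrow> ((\<lambda>y. (f y - f x) /\<^sub>R (y - x)) \<longlongrightarrow> f') (at x within S)"
    by (simp add: tendsto_norm_zero_iff LIM_zero_iff)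
  finally show ?thesis .
qed

text \<open>The right derivative of an integral, in the shape of a generator quotient: averaging an
  orbit over a short interval recovers its initial value.\<close>

lemma integral_average_tendsto:
  fixes f :: "real \<Rightarrow> 'a::banach"
  assumes "0 < b" "continuous_on {a..a + b} f"
  shows "((\<lambda>h. integral {a..a + h} f /\<^sub>R h) \<longlongrightarrow> f a) (at_right 0)"
proof -
  have "((\<lambda>u. integral {a..u} f) has_vector_derivative f a) (at a within {a..a + b})"
    using assms by (intro integral_has_vector_derivative) auto
  then have "((\<lambda>u. integral {a..u} f /\<^sub>R (u - a)) \<longlongrightarrow> f a) (at a within {a..a + b})"
    by (simp add: has_vector_derivative_iff_quotient)
  moreover have "filterlim (\<lambda>h. a + h) (at a within {a..a + b}) (at_right 0)"
  proof -
    have "\<forall>\<^sub>F h in at_right 0. a + h \<in> {a..a + b} \<and> a + h \<noteq> a"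
      using eventually_at_right_less[of 0] eventually_at_right_real[OF assms(1)]
      by eventually_elim auto
    moreover have "((\<lambda>h. a + h) \<longlongrightarrow> a) (at_right 0)"
      by (auto intro!: tendsto_eq_intros)
    ultimately show ?thesis by (simp add: filterlim_at)
  qed
  ultimately have "((\<lambda>h. integral {a..a + h} f /\<^sub>R (a + h - a)) \<longlongrightarrow> f a) (at_right 0)"
    by (rule filterlim_compose)
  then show ?thesis by simp
qed

subsection \<open>Strongly continuous semigroups\<close>

locale C0_generator =
  fixes T :: "real \<Rightarrow> 'a::complex_banach \<Rightarrow>\<^sub>L 'a" and D :: "'a set" and A :: "'a \<Rightarrow> 'a"
  assumes C0: "C0_semigroup T" and gen: "is_generator T D A"
begin

lemma T_zero: "T 0 x = x"
  using C0 by (simp add: C0_semigroup_def)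

lemma T_add: "0 \<le> s \<Longrightarrow> 0 \<le> t \<Longrightarrow> T (s + t) x = T s (T t x)"
  using C0 by (simp add: C0_semigroup_def)

lemma T_commute: "0 \<le> s \<Longrightarrow> 0 \<le> t \<Longrightarrow> T s (T t x) = T t (T s x)"
  by (metis T_add add.commute)

lemma T_scaleC: "0 \<le> t \<Longrightarrow> T t (c *\<^sub>C x) = c *\<^sub>C T t x"
  using C0 by (simp add: C0_semigroup_def complex_linear_blinfun_def)

lemma T_continuous: "continuous_on {0..} (\<lambda>t. T t x)"
  using C0 by (simp add: C0_semigroup_def)

lemma T_bounded:
  obtains M where "0 < M" "\<forall>t\<in>{0..b}. norm (T t) \<le> M"
proof -
  have "bounded ((\<lambda>S. blinfun_apply S x) ` T ` {0..b})" for x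
    unfolding image_image
    by (intro compact_imp_bounded compact_continuous_image continuous_on_subset[OF T_continuous]) auto
  then show thesis
    by (rule uniform_boundedness) (use that in auto)
qed

text \<open>Strong continuity together with the bound on compact intervals gives joint continuity in
  time and vector. Nonnegative times are demanded because \<open>T\<close> is arbitrary at negative
  ones.\<close>

lemma T_tendsto:
  assumes f: "(f \<longlongrightarrow> t) F" and f0: "\<forall>\<^sub>F s in F. 0 \<le> f s" and t: "0 \<le> t" and g: "(g \<longlongrightarrow> y) F"
  shows "((\<lambda>s. T (f s) (g s)) \<longlongrightarrow> T t y) F"
proof -
  obtain M where M: "0 < M" "\<forall>s\<in>{0..t + 1}. norm (T s) \<le> M"
    using T_bounded by blast
  have "((\<lambda>s. T (f s) (g s - y)) \<longlongrightarrow> 0) F"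
  proof (rule Lim_null_comparison)
    have "\<forall>\<^sub>F s in F. f s < t + 1" using f by (rule order_tendstoD) simp
    with f0 show "\<forall>\<^sub>F s in F. norm (T (f s) (g s - y)) \<le> M * norm (g s - y)"
      by eventually_elim
        (use M(2) in \<open>auto intro!: order_trans[OF norm_blinfun] mult_right_mono\<close>)
    show "((\<lambda>s. M * norm (g s - y)) \<longlongrightarrow> 0) F"
      using g by (auto intro!: tendsto_eq_intros)
  qed
  moreover have "((\<lambda>s. T (f s) y) \<longlongrightarrow> T t y) F"
    using continuous_on_tendsto_compose[OF T_continuous f] t f0 by simp
  ultimately have "((\<lambda>s. T (f s) (g s - y) + T (f s) y) \<longlongrightarrow> 0 + T t y) F"
    by (rule tendsto_add)
  then show ?thesis by (simp add: blinfun.diff_right)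
qed

lemma T_continuous_on:
  assumes "continuous_on S f" "continuous_on S g" "\<And>s. s \<in> S \<Longrightarrow> 0 \<le> f s"
  shows "continuous_on S (\<lambda>s. T (f s) (g s))"
  using assms unfolding continuous_on_def
  by (auto intro!: T_tendsto simp: eventually_at_filter)

lemma generator_lim: "x \<in> D \<Longrightarrow> ((\<lambda>h. (T h x - x) /\<^sub>R h) \<longlongrightarrow> A x) (at_right 0)"
  using gen by (simp add: is_generator_def)

lemma generatorI:
  assumes "((\<lambda>h. (T h x - x) /\<^sub>R h) \<longlongrightarrow> y) (at_right 0)"
  shows "x \<in> D" "A x = y"
proof -
  show "x \<in> D" using gen assms unfolding is_generator_def by blast
  then show "A x = y"
    using tendsto_unique[OF trivial_limit_at_right_real generator_lim assms] by simp
qed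

lemma linear: "linear_operator D A"
proof -
  have "0 \<in> D" by (rule generatorI(1)[of _ 0]) simp
  moreover have "x + y \<in> D \<and> A (x + y) = A x + A y" if "x \<in> D" "y \<in> D" for x y
  proof -
    have "((\<lambda>h. (T h (x + y) - (x + y)) /\<^sub>R h) \<longlongrightarrow> A x + A y) (at_right 0)"
      using tendsto_add[OF generator_lim[OF that(1)] generator_lim[OF that(2)]]
      by (simp add: blinfun.add_right algebra_simps flip: scaleR_add_right)
    then show ?thesis using generatorI by blast
  qed
  moreover have "c *\<^sub>C x \<in> D \<and> A (c *\<^sub>C x) = c *\<^sub>C A x" if "x \<in> D" for c x
  proof -
    have "((\<lambda>h. c *\<^sub>C ((T h x - x) /\<^sub>R h)) \<longlongrightarrow> c *\<^sub>C A x) (at_right 0)"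
      using generator_lim[OF that] by (intro tendsto_intros)
    moreover have "\<forall>\<^sub>F h in at_right 0. c *\<^sub>C ((T h x - x) /\<^sub>R h) = (T h (c *\<^sub>C x) - c *\<^sub>C x) /\<^sub>R h"
      using eventually_at_right_less[of 0]
      by eventually_elim (simp add: T_scaleC scaleC_scaleR_commute scaleC.diff_right)
    ultimately have "((\<lambda>h. (T h (c *\<^sub>C x) - c *\<^sub>C x) /\<^sub>R h) \<longlongrightarrow> c *\<^sub>C A x) (at_right 0)"
      by (rule Lim_transform_eventually)
    then show ?thesis using generatorI by blast
  qed
  ultimately show ?thesis unfolding linear_operator_def by blast
qed

lemma T_generator:
  assumes "x \<in> D" "0 \<le> t"
  shows "T t x \<in> D" "A (T t x) = T t (A x)"
proof -
  have "((\<lambda>h. T t ((T h x - x) /\<^sub>R h)) \<longlongrightarrow> T t (A x)) (at_right 0)"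
    by (intro blinfun.tendsto tendsto_const generator_lim assms)
  moreover have "\<forall>\<^sub>F h in at_right 0. T t ((T h x - x) /\<^sub>R h) = (T h (T t x) - T t x) /\<^sub>R h"
    using eventually_at_right_less[of 0]
    by eventually_elim (simp add: blinfun.scaleR_right blinfun.diff_right T_commute assms)
  ultimately have "((\<lambda>h. (T h (T t x) - T t x) /\<^sub>R h) \<longlongrightarrow> T t (A x)) (at_right 0)"
    by (rule Lim_transform_eventually)
  then show "T t x \<in> D" "A (T t x) = T t (A x)" by (rule generatorI)+
qed

text \<open>The generator is defined by quotients from the right. Pulling out
  \<open>T (min s t)\<close> leaves a quotient with step \<open>\<bar>s - t\<bar>\<close>, so both
  sides are treated at once through joint continuity.\<close>

lemma orbit_derivative:
  assumes x: "x \<in> D" and t: "0 \<le> t"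
  shows "((\<lambda>t. T t x) has_vector_derivative T t (A x)) (at t within {0..})"
  unfolding has_vector_derivative_iff_quotient
proof (rule Lim_transform_eventually)
  define F where "F = at t within {0..}"
  have F: "\<forall>\<^sub>F s in F. 0 \<le> s" "\<forall>\<^sub>F s in F. s \<noteq> t" "((\<lambda>s. s) \<longlongrightarrow> t) F"
    unfolding F_def by (auto simp: eventually_at_filter)
  have abs: "filterlim (\<lambda>s. \<bar>s - t\<bar>) (at_right 0) F"
    unfolding filterlim_at using F(2,3) tendsto_rabs[OF tendsto_diff[OF F(3) tendsto_const[of t]]]
    by (auto elim: eventually_mono)
  have "((\<lambda>s. min s t) \<longlongrightarrow> t) F"
    using tendsto_min[OF F(3) tendsto_const[of t]] by simp
  moreover have "\<forall>\<^sub>F s in F. 0 \<le> min s t"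
    using F(1) by eventually_elim (use t in simp)
  ultimately show "((\<lambda>s. T (min s t) ((T \<bar>s - t\<bar> x - x) /\<^sub>R \<bar>s - t\<bar>)) \<longlongrightarrow> T t (A x)) F"
    using t filterlim_compose[OF generator_lim[OF x] abs] by (rule T_tendsto)
  show "\<forall>\<^sub>F s in F. T (min s t) ((T \<bar>s - t\<bar> x - x) /\<^sub>R \<bar>s - t\<bar>) = (T s x - T t x) /\<^sub>R (s - t)"
    using F(1,2)
  proof eventually_elim
    case (elim s)
    have eq: "T (min s t) (T \<bar>s - t\<bar> x) = T (max s t) x"
      using T_add[of "min s t" "\<bar>s - t\<bar>" x] elim t by (cases "s \<le> t") simp_all
    show ?case
    proof (cases "s < t")
      case True
      have "(T t x - T s x) /\<^sub>R (t - s) = (T s x - T t x) /\<^sub>R (s - t)"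
        by (rule quotient_swap)
      with True eq show ?thesis
        by (simp add: blinfun.scaleR_right blinfun.diff_right)
    qed (use eq elim in \<open>simp add: blinfun.scaleR_right blinfun.diff_right\<close>)
  qed
qed

lemma orbit_integral:
  assumes "x \<in> D" "0 \<le> t"
  shows "integral {0..t} (\<lambda>s. T s (A x)) = T t x - x"
proof (rule integral_unique)
  have "((\<lambda>s. T s (A x)) has_integral T t x - T 0 x) {0..t}"
  proof (rule fundamental_theorem_of_calculus[OF assms(2)])
    fix s assume "s \<in> {0..t}"
    then show "((\<lambda>t. T t x) has_vector_derivative T s (A x)) (at s within {0..t})"
      using has_vector_derivative_within_subset[OF orbit_derivative[OF assms(1)]] by auto
  qed
  then show "((\<lambda>s. T s (A x)) has_integral T t x - x) {0..t}" by (simp add: T_zero)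
qed

lemma integral_orbit:
  assumes t: "0 \<le> t"
  shows "integral {0..t} (\<lambda>s. T s x) \<in> D" "A (integral {0..t} (\<lambda>s. T s x)) = T t x - x"
proof -
  define F where "F u = integral {0..u} (\<lambda>s. T s x)" for u
  have int: "(\<lambda>s. T s x) integrable_on {a..b}" if "0 \<le> a" for a b
    using that by (intro integrable_continuous_real continuous_on_subset[OF T_continuous]) auto
  \<comment> \<open>\<open>T h\<close> shifts the integration interval from \<open>{0..t}\<close> to
    \<open>{h..t + h}\<close>. Comparing both inside \<open>{0..t + h}\<close> leaves the two end
    pieces, whose averages converge to \<open>T t x\<close> and \<open>x\<close>.\<close>
  have T_F: "T h (F t) = F t + integral {t..t + h} (\<lambda>s. T s x) - F h" if "0 \<le> h" for h
  proof -
    have "T h (F t) = integral {0..t} (\<lambda>s. T h (T s x))"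
      unfolding F_def by (rule integral_linear[OF int blinfun.bounded_linear_right, symmetric,
          unfolded o_def]) simp
    also have "\<dots> = integral {0..t} (\<lambda>s. T (s + h) x)"
      using that by (intro integral_cong) (simp add: T_add[symmetric] add.commute)
    also have "\<dots> = integral {h..t + h} (\<lambda>s. T s x)"
      using integral_unique[OF has_integral_shift_real_ivl[OF integrable_integral[OF int[of h "t + h"]], of h]] that
      by simp
    finally have "F h + T h (F t) = F (t + h)"
      unfolding F_def using Henstock_Kurzweil_Integration.integral_combine[where a = 0 and c = h and b = "t + h" and f = "\<lambda>s. T s x"] that t int by simp
    moreover have "F t + integral {t..t + h} (\<lambda>s. T s x) = F (t + h)"
      unfolding F_def using Henstock_Kurzweil_Integration.integral_combine[where a = 0 and c = t and b = "t + h" and f = "\<lambda>s. T s x"] that t int by simp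
    ultimately show ?thesis by (simp add: algebra_simps)
  qed
  have "((\<lambda>h. integral {t..t + h} (\<lambda>s. T s x) /\<^sub>R h - integral {0..0 + h} (\<lambda>s. T s x) /\<^sub>R h)
      \<longlongrightarrow> T t x - T 0 x) (at_right 0)"
    using t by (intro tendsto_diff integral_average_tendsto[of 1] continuous_on_subset[OF T_continuous]) auto
  moreover have "\<forall>\<^sub>F h in at_right 0. integral {t..t + h} (\<lambda>s. T s x) /\<^sub>R h - integral {0..0 + h} (\<lambda>s. T s x) /\<^sub>R h
      = (T h (F t) - F t) /\<^sub>R h"
    using eventually_at_right_less[of 0]
    by eventually_elim (simp add: T_F F_def[symmetric] scaleR_diff_right)
  ultimately have "((\<lambda>h. (T h (F t) - F t) /\<^sub>R h) \<longlongrightarrow> T t x - x) (at_right 0)"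
    unfolding T_zero by (rule Lim_transform_eventually)
  then show "integral {0..t} (\<lambda>s. T s x) \<in> D" "A (integral {0..t} (\<lambda>s. T s x)) = T t x - x"
    unfolding F_def[symmetric] by (rule generatorI)+
qed

lemma dense: "closure D = UNIV"
proof -
  have "x \<in> closure D" for x
  proof (rule Lim_in_closed_set[OF closed_closure _ trivial_limit_at_right_real])
    show "((\<lambda>h. integral {0..0 + h} (\<lambda>s. T s x) /\<^sub>R h) \<longlongrightarrow> x) (at_right 0)"
      using integral_average_tendsto[of 1 0 "\<lambda>s. T s x"] continuous_on_subset[OF T_continuous]
      by (simp add: T_zero)
    show "\<forall>\<^sub>F h in at_right 0. integral {0..0 + h} (\<lambda>s. T s x) /\<^sub>R h \<in> closure D"
      using eventually_at_right_less[of 0]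
    proof eventually_elim
      case (elim h)
      then have "integral {0..0 + h} (\<lambda>s. T s x) /\<^sub>R h \<in> D"
        using linear_operatorD(5)[OF linear integral_orbit(1)[of h x]] by simp
      then show ?case using closure_subset by blast
    qed
  qed
  then show ?thesis by blast
qed

text \<open>The relation \<open>T h x - x = integral {0..h} (\<lambda>s. T s y)\<close> survives
  limits of \<open>X\<close> and \<open>A X\<close>; dividing it by \<open>h\<close> afterwards
  gives back the generator.\<close>

lemma closed_graph_sequentially:
  assumes X: "\<And>n. X n \<in> D" "X \<longlonglongrightarrow> x" and AX: "(\<lambda>n. A (X n)) \<longlonglongrightarrow> y"
  shows "x \<in> D" "A x = y"
proof -
  have eq: "T h x - x = integral {0..h} (\<lambda>s. T s y)" if h: "0 \<le> h" for h
  proof (rule LIMSEQ_unique)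
    show "(\<lambda>n. T h (X n) - X n) \<longlonglongrightarrow> T h x - x"
      by (intro tendsto_intros X)
    obtain M where M: "0 < M" "\<forall>s\<in>{0..h}. norm (T s) \<le> M"
      using T_bounded by blast
    have "(\<lambda>n. T h (X n) - X n - integral {0..h} (\<lambda>s. T s y)) \<longlonglongrightarrow> 0"
    proof (rule Lim_null_comparison)
      have int: "(\<lambda>s. T s z) integrable_on {0..h}" for z
        by (intro integrable_continuous_real continuous_on_subset[OF T_continuous]) auto
      have "norm (T h (X n) - X n - integral {0..h} (\<lambda>s. T s y)) \<le> M * norm (A (X n) - y) * (h - 0)" for n
      proof -
        have "T h (X n) - X n - integral {0..h} (\<lambda>s. T s y) = integral {0..h} (\<lambda>s. T s (A (X n) - y))"
          using h X(1)[of n] by (simp add: orbit_integral[symmetric] blinfun.diff_right int integral_diff)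
        also have "norm \<dots> \<le> M * norm (A (X n) - y) * (h - 0)"
          using h M by (intro integral_bound continuous_on_subset[OF T_continuous])
            (auto intro!: order_trans[OF norm_blinfun] mult_right_mono)
        finally show ?thesis .
      qed
      then show "\<forall>\<^sub>F n in sequentially. norm (T h (X n) - X n - integral {0..h} (\<lambda>s. T s y))
          \<le> M * norm (A (X n) - y) * (h - 0)" by simp
      show "(\<lambda>n. M * norm (A (X n) - y) * (h - 0)) \<longlonglongrightarrow> 0"
        using AX by (auto intro!: tendsto_eq_intros)
    qed
    then show "(\<lambda>n. T h (X n) - X n) \<longlonglongrightarrow> integral {0..h} (\<lambda>s. T s y)"
      by (rule LIM_zero_cancel)
  qed
  have "((\<lambda>h. integral {0..0 + h} (\<lambda>s. T s y) /\<^sub>R h) \<longlongrightarrow> T 0 y) (at_right 0)"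
    by (intro integral_average_tendsto[of 1] continuous_on_subset[OF T_continuous]) auto
  moreover have "\<forall>\<^sub>F h in at_right 0. integral {0..0 + h} (\<lambda>s. T s y) /\<^sub>R h = (T h x - x) /\<^sub>R h"
    using eventually_at_right_less[of 0] by eventually_elim (simp add: eq)
  ultimately have "((\<lambda>h. (T h x - x) /\<^sub>R h) \<longlongrightarrow> y) (at_right 0)"
    unfolding T_zero by (rule Lim_transform_eventually)
  then show "x \<in> D" "A x = y" by (rule generatorI)+
qed

text \<open>The quotient splits into \<open>T (r u)\<close> applied to the quotient of
  \<open>y\<close>, and the quotient of \<open>T (r u) (y s)\<close>. The first part needs joint
  strong continuity only, so membership in the domain is asked at the single point
  \<open>s\<close>.\<close>

lemma product_derivative:
  assumes y: "(y has_vector_derivative y') (at s within S)" and ys: "y s \<in> D"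
    and r: "(r has_vector_derivative r') (at s within S)" and r0: "\<And>u. u \<in> S \<Longrightarrow> 0 \<le> r u" and s: "s \<in> S"
  shows "((\<lambda>u. T (r u) (y u)) has_vector_derivative T (r s) y' + r' *\<^sub>R T (r s) (A (y s))) (at s within S)"
proof -
  have "((\<lambda>u. T (r u) ((y u - y s) /\<^sub>R (u - s))) \<longlongrightarrow> T (r s) y') (at s within S)"
  proof (rule T_tendsto)
    show "(r \<longlongrightarrow> r s) (at s within S)"
      using has_vector_derivative_continuous[OF r] by (simp add: continuous_within)
    show "\<forall>\<^sub>F u in at s within S. 0 \<le> r u"
      using r0 by (auto simp: eventually_at_filter)
  qed (use y r0 s in \<open>auto simp: has_vector_derivative_iff_quotient\<close>)
  moreover have "((\<lambda>u. T (r u) (y s)) has_vector_derivative r' *\<^sub>R T (r s) (A (y s))) (at s within S)"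
  proof -
    have "((\<lambda>t. T t (y s)) has_vector_derivative T (r s) (A (y s))) (at (r s) within r ` S)"
      by (rule has_vector_derivative_within_subset[OF orbit_derivative]) (use ys r0 s in auto)
    from vector_diff_chain_within[OF r this] show ?thesis by (simp add: o_def)
  qed
  then have "((\<lambda>u. (T (r u) (y s) - T (r s) (y s)) /\<^sub>R (u - s)) \<longlongrightarrow> r' *\<^sub>R T (r s) (A (y s))) (at s within S)"
    by (simp add: has_vector_derivative_iff_quotient)
  ultimately have "((\<lambda>u. T (r u) ((y u - y s) /\<^sub>R (u - s)) + (T (r u) (y s) - T (r s) (y s)) /\<^sub>R (u - s))
      \<longlongrightarrow> T (r s) y' + r' *\<^sub>R T (r s) (A (y s))) (at s within S)"
    by (rule tendsto_add)
  then show ?thesis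
    unfolding has_vector_derivative_iff_quotient
    by (simp add: blinfun.scaleR_right blinfun.diff_right flip: scaleR_add_right)
qed

lemma rescale:
  fixes \<omega> :: real
  shows "C0_generator (\<lambda>t. exp (- \<omega> * t) *\<^sub>R T t) D (\<lambda>x. A x - \<omega> *\<^sub>R x)"
proof
  have "continuous_on {0..} (\<lambda>t. blinfun_apply (exp (- \<omega> * t) *\<^sub>R T t) x)" for x
    by (auto simp: blinfun.scaleR_left intro!: continuous_intros T_continuous)
  then show "C0_semigroup (\<lambda>t. exp (- \<omega> * t) *\<^sub>R T t)"
    using C0 unfolding C0_semigroup_def complex_linear_blinfun_def
    by (auto simp: blinfun.scaleR_left scaleC_scaleR_commute blinfun.scaleR_right
        distrib_left exp_add mult.commute exp_diff exp_minus divide_inverse intro!: blinfun_eqI)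
  have fact: "((\<lambda>h. (exp (- \<omega> * h) - 1) / h) \<longlongrightarrow> - \<omega>) (at_right 0)"
  proof -
    have "((\<lambda>h. exp (- \<omega> * h)) has_field_derivative - \<omega>) (at 0 within {0<..})"
      by (auto intro!: derivative_eq_intros)
    then show ?thesis by (simp add: has_field_derivative_iff)
  qed
  \<comment> \<open>An equivalence is needed since \<open>D\<close> must be exactly the set where
    the new quotient converges; the converse multiplies back by
    \<open>exp (\<omega> * h)\<close>.\<close>
  have eq: "((\<lambda>h. (blinfun_apply (exp (- \<omega> * h) *\<^sub>R T h) x - x) /\<^sub>R h) \<longlongrightarrow> y - \<omega> *\<^sub>R x) (at_right 0) \<longleftrightarrow>
    ((\<lambda>h. (T h x - x) /\<^sub>R h) \<longlongrightarrow> y) (at_right 0)" for x y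
  proof -
    have id: "(exp (- \<omega> * h) *\<^sub>R T h x - x) /\<^sub>R h
      = exp (- \<omega> * h) *\<^sub>R ((T h x - x) /\<^sub>R h) + ((exp (- \<omega> * h) - 1) / h) *\<^sub>R x" for h
      by (simp add: algebra_simps divide_inverse)
    have e: "((\<lambda>h. exp (- \<omega> * h)) \<longlongrightarrow> 1) (at_right 0)" "((\<lambda>h. exp (\<omega> * h)) \<longlongrightarrow> 1) (at_right 0)"
      by (auto intro!: tendsto_eq_intros)
    show ?thesis
    proof
      assume *: "((\<lambda>h. (T h x - x) /\<^sub>R h) \<longlongrightarrow> y) (at_right 0)"
      have "((\<lambda>h. exp (- \<omega> * h) *\<^sub>R ((T h x - x) /\<^sub>R h) + ((exp (- \<omega> * h) - 1) / h) *\<^sub>R x)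
        \<longlongrightarrow> 1 *\<^sub>R y + (- \<omega>) *\<^sub>R x) (at_right 0)"
        by (intro tendsto_intros e fact *)
      then show "((\<lambda>h. (blinfun_apply (exp (- \<omega> * h) *\<^sub>R T h) x - x) /\<^sub>R h) \<longlongrightarrow> y - \<omega> *\<^sub>R x) (at_right 0)"
        by (simp only: blinfun.scaleR_left id scaleR_one scaleR_minus_left add_uminus_conv_diff)
    next
      assume *: "((\<lambda>h. (blinfun_apply (exp (- \<omega> * h) *\<^sub>R T h) x - x) /\<^sub>R h) \<longlongrightarrow> y - \<omega> *\<^sub>R x) (at_right 0)"
      have lim: "((\<lambda>h. exp (\<omega> * h) *\<^sub>R ((exp (- \<omega> * h) *\<^sub>R T h x - x) /\<^sub>R h - ((exp (- \<omega> * h) - 1) / h) *\<^sub>R x))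
        \<longlongrightarrow> 1 *\<^sub>R (y - \<omega> *\<^sub>R x - (- \<omega>) *\<^sub>R x)) (at_right 0)"
        using * by (intro tendsto_intros e fact) (simp add: blinfun.scaleR_left)
      have cancel: "exp (\<omega> * h) *\<^sub>R ((exp (- \<omega> * h) *\<^sub>R T h x - x) /\<^sub>R h - ((exp (- \<omega> * h) - 1) / h) *\<^sub>R x)
        = (T h x - x) /\<^sub>R h" for h
      proof -
        have "exp (\<omega> * h) *\<^sub>R ((exp (- \<omega> * h) *\<^sub>R T h x - x) /\<^sub>R h - ((exp (- \<omega> * h) - 1) / h) *\<^sub>R x)
          = (exp (\<omega> * h) * exp (- \<omega> * h)) *\<^sub>R ((T h x - x) /\<^sub>R h)"
          unfolding id by (simp only: add_diff_cancel_right' scaleR_scaleR mult.assoc)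
        then show ?thesis by (simp flip: exp_add)
      qed
      show "((\<lambda>h. (T h x - x) /\<^sub>R h) \<longlongrightarrow> y) (at_right 0)" using lim
        by (simp only: scaleR_one scaleR_minus_left diff_minus_eq_add diff_add_cancel cancel)
    qed
  qed
  have "(\<exists>y. ((\<lambda>h. (blinfun_apply (exp (- \<omega> * h) *\<^sub>R T h) x - x) /\<^sub>R h) \<longlongrightarrow> y) (at_right 0)) \<longleftrightarrow> x \<in> D" for x
  proof
    assume "\<exists>y. ((\<lambda>h. (blinfun_apply (exp (- \<omega> * h) *\<^sub>R T h) x - x) /\<^sub>R h) \<longlongrightarrow> y) (at_right 0)"
    then obtain y where "((\<lambda>h. (blinfun_apply (exp (- \<omega> * h) *\<^sub>R T h) x - x) /\<^sub>R h) \<longlongrightarrow> y) (at_right 0)" ..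
    with eq[of x "y + \<omega> *\<^sub>R x"] show "x \<in> D" by (auto intro: generatorI)
  next
    assume "x \<in> D" then show "\<exists>y. ((\<lambda>h. (blinfun_apply (exp (- \<omega> * h) *\<^sub>R T h) x - x) /\<^sub>R h) \<longlongrightarrow> y) (at_right 0)"
      using eq[of x "A x"] generator_lim by blast
  qed
  then show "is_generator (\<lambda>t. exp (- \<omega> * t) *\<^sub>R T t) D (\<lambda>x. A x - \<omega> *\<^sub>R x)"
    using eq generator_lim unfolding is_generator_def by auto
qed

text \<open>With \<open>S\<close> the semigroup rescaled by \<open>exp (- \<omega>)\<close> and \<open>V x\<close> the integral of its orbit over
  \<open>[0, 1]\<close>, one has \<open>(\<omega> - A) V = V (\<omega> - A) = 1 - S 1\<close>; for large \<open>\<omega>\<close> the right-hand side is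
  invertible, and no integral over the half-line is needed.\<close>

lemma resolvent:
  obtains \<omega> :: real and R :: "'a \<Rightarrow>\<^sub>L 'a" where "0 < \<omega>" "complex_linear_blinfun R"
    "\<And>f. R f \<in> D" "\<And>f. \<omega> *\<^sub>R R f - A (R f) = f" "\<And>u. u \<in> D \<Longrightarrow> R (\<omega> *\<^sub>R u - A u) = u"
proof -
  \<comment> \<open>Chosen so that \<open>exp (- \<omega>) * (2 * norm (T 1) + 2) = 1\<close>, which
    makes \<open>S 1\<close> a contraction with constant 1/2. The summand 2 pushes the argument of
    \<open>ln\<close> above 1.\<close>
  define \<omega> where "\<omega> = ln (2 * norm (T 1) + 2)"
  have \<omega>: "0 < \<omega>" unfolding \<omega>_def 
  proof (rule ln_gt_zero)
    have "0 \<le> norm (T 1)" by simp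
    then show "1 < 2 * norm (T 1) + 2" by linarith
  qed
  define S where "S t = exp (- \<omega> * t) *\<^sub>R T t" for t
  interpret S: C0_generator S D "\<lambda>x. A x - \<omega> *\<^sub>R x" using rescale unfolding S_def .
  have Q: "norm (S 1 x) \<le> (1/2) * norm x" for x
  proof -
    have "exp (- \<omega>) * (2 * norm (T 1) + 2) = 1"
    proof -
      have "exp \<omega> = 2 * norm (T 1) + 2"
        unfolding \<omega>_def by (rule exp_ln) (simp add: add_nonneg_pos)
      then show ?thesis by (metis exp_minus_inverse mult.commute)
    qed
    then have "2 * (exp (- \<omega>) * norm (T 1)) + 2 * exp (- \<omega>) = 1"
      by (simp add: algebra_simps)
    then have "exp (- \<omega>) * norm (T 1) \<le> 1 / 2"
      using exp_ge_zero[of "- \<omega>"] by linarith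
    then have "norm (S 1) \<le> 1 / 2" by (simp add: S_def)
    then show ?thesis by (meson mult_right_mono norm_blinfun norm_ge_zero order_trans)
  qed
  obtain M where M: "0 < M" "\<forall>t\<in>{0..1}. norm (S t) \<le> M"
    using S.T_bounded by blast
  have ex: "\<exists>u\<in>D. \<omega> *\<^sub>R u - A u = f \<and> norm u \<le> norm f * (2 * M)" for f
  proof -
    \<comment> \<open>Solves \<open>x - S 1 x = f\<close>; the integral of the orbit of this
      \<open>x\<close> is then a preimage of \<open>f\<close> under
      \<open>\<omega> - A\<close>.\<close>
    have "\<exists>!x. f + S 1 x = x"
      using Q by (intro banach_fix_type[of "1/2"]) (auto simp: dist_norm simp flip: blinfun.diff_right)
    then obtain x where x: "f + S 1 x = x" by blast
    define u where "u = integral {0..1} (\<lambda>s. S s x)"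
    have "u \<in> D" "A u - \<omega> *\<^sub>R u = S 1 x - x"
      unfolding u_def by (rule S.integral_orbit; simp)+
    moreover have "norm u \<le> M * norm x * (1 - 0)"
      unfolding u_def using M by (intro integral_bound continuous_on_subset[OF S.T_continuous])
        (auto intro!: order_trans[OF norm_blinfun] mult_right_mono)
    moreover have "norm x \<le> 2 * norm f"
      using Q[of x] norm_triangle_ineq[of f "S 1 x"] x by simp
    moreover have "M * norm x \<le> M * (2 * norm f)"
      using calculation M by (intro mult_left_mono) auto
    moreover have "\<omega> *\<^sub>R u - A u = f"
      using \<open>A u - \<omega> *\<^sub>R u = S 1 x - x\<close> x by (metis add_diff_cancel_right' minus_diff_eq)
    ultimately show ?thesis by (intro bexI[of _ u]) (auto simp: algebra_simps)
  qed
  \<comment> \<open>A kernel vector of \<open>\<omega> - A\<close> is fixed by \<open>S 1\<close>,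
    and the contraction fixes only 0.\<close>
  have inj: "u = 0" if u: "u \<in> D" "\<omega> *\<^sub>R u - A u = 0" for u
  proof -
    have "S 1 u - u = 0" using S.orbit_integral[OF u(1), of 1] u(2) by simp
    then have "norm u \<le> (1/2) * norm u" using Q[of u] by simp
    then show ?thesis by simp
  qed
  obtain r where r: "\<And>f. r f \<in> D" "\<And>f. \<omega> *\<^sub>R r f - A (r f) = f" "\<And>f. norm (r f) \<le> norm f * (2 * M)"
    using ex by metis
  note lin = linear_operatorD[OF linear]
  have unique: "r (\<omega> *\<^sub>R u - A u) = u" if u: "u \<in> D" for u
  proof -
    define v where "v = r (\<omega> *\<^sub>R u - A u)"
    have v: "v \<in> D" "\<omega> *\<^sub>R v - A v = \<omega> *\<^sub>R u - A u" unfolding v_def by (rule r)+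
    have "\<omega> *\<^sub>R (v - u) - A (v - u) = (\<omega> *\<^sub>R v - A v) - (\<omega> *\<^sub>R u - A u)"
      unfolding lin(7)[OF v(1) u] by (simp add: scaleR_diff_right)
    also have "\<dots> = 0" unfolding v(2) by simp
    finally have "v - u = 0" by (rule inj[OF lin(3)[OF v(1) u]])
    then show ?thesis by (simp add: v_def)
  qed
  have r_add: "r (f + g) = r f + r g" for f g
  proof -
    have "\<omega> *\<^sub>R (r f + r g) - A (r f + r g) = (\<omega> *\<^sub>R r f - A (r f)) + (\<omega> *\<^sub>R r g - A (r g))"
      unfolding lin(6)[OF r(1) r(1)] by (simp add: scaleR_add_right)
    then show ?thesis using unique[OF lin(2)[OF r(1) r(1)], of f g] by (simp only: r(2))
  qed
  have r_scaleC: "r (c *\<^sub>C f) = c *\<^sub>C r f" for c f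
  proof -
    have "\<omega> *\<^sub>R (c *\<^sub>C r f) - A (c *\<^sub>C r f) = c *\<^sub>C (\<omega> *\<^sub>R r f - A (r f))"
      unfolding lin(8)[OF r(1)] by (simp add: scaleC.diff_right scaleC_scaleR_commute)
    then show ?thesis using unique[OF lin(4)[OF r(1)], of c f] by (simp only: r(2))
  qed
  have r_lin: "bounded_linear r"
    by (rule bounded_linear_intro[OF r_add _ r(3)]) (simp add: r_scaleC flip: scaleC_of_real)
  show thesis
    by (rule that[OF \<omega>, of "Blinfun r"])
      (use r unique r_scaleC in \<open>auto simp: bounded_linear_Blinfun_apply[OF r_lin] complex_linear_blinfun_def\<close>)
qed

end

subsection \<open>Bounded perturbations\<close>

text \<open>The perturbed orbits are the solutions of the Volterra equation
  \<open>u t = T t x + integral {0..t} (\<lambda>s. T (t - s) (C (u s)))\<close>. The integral is scaled to \<open>[0, 1]\<close>,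
  so that it depends on the parameter \<open>t\<close> through the integrand only.\<close>

locale bounded_perturbation = C0_generator T D A
  for T :: "real \<Rightarrow> 'a::complex_banach \<Rightarrow>\<^sub>L 'a" and D A +
  fixes C :: "'a \<Rightarrow>\<^sub>L 'a"
  assumes C_linear: "complex_linear_blinfun C"
begin

text \<open>Separated from the factor \<open>t\<close> because, for the perturbed orbit of
  \<open>x\<close>, this mean tends to \<open>C x\<close> at time 0: it is the change of the
  generator.\<close>

definition volterra_mean :: "(real \<Rightarrow> 'a) \<Rightarrow> real \<Rightarrow> 'a"
  where "volterra_mean g t = integral {0..1} (\<lambda>\<sigma>. T (t * (1 - \<sigma>)) (C (g (t * \<sigma>))))"

definition volterra :: "(real \<Rightarrow> 'a) \<Rightarrow> real \<Rightarrow> 'a"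
  where "volterra g t = t *\<^sub>R volterra_mean g t"

lemma volterra_integrand_continuous:
  assumes "continuous_on {0..} g" "0 \<le> t"
  shows "continuous_on {0..1} (\<lambda>\<sigma>. T (t * (1 - \<sigma>)) (C (g (t * \<sigma>))))"
  using assms by (intro T_continuous_on continuous_intros continuous_on_compose2[OF assms(1)]) auto

lemma volterra_integrand_integrable:
  assumes "continuous_on {0..} g" "0 \<le> t"
  shows "(\<lambda>\<sigma>. T (t * (1 - \<sigma>)) (C (g (t * \<sigma>)))) integrable_on {0..1}"
  by (intro integrable_continuous_real volterra_integrand_continuous assms)

lemma volterra_mean_continuous:
  assumes g: "continuous_on {0..} g"
  shows "continuous_on {0..} (volterra_mean g)"
proof -
  have "continuous_on ({0..} \<times> cbox 0 1) (\<lambda>(t, \<sigma>). T (t * (1 - \<sigma>)) (C (g (t * \<sigma>))))"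
    unfolding split_beta
    by (intro T_continuous_on continuous_intros continuous_on_compose2[OF g]) auto
  from integral_continuous_on_param[OF this] show ?thesis
    by (simp add: volterra_mean_def[abs_def])
qed

lemma volterra_continuous:
  "continuous_on {0..} g \<Longrightarrow> continuous_on {0..} (volterra g)"
  unfolding volterra_def[abs_def] by (intro continuous_intros volterra_mean_continuous)

lemma volterra_eq_integral:
  assumes g: "continuous_on {0..} g" and t: "0 \<le> t"
  shows "volterra g t = integral {0..t} (\<lambda>s. T (t - s) (C (g s)))"
proof (cases "t = 0")
  case False
  let ?f = "\<lambda>s. blinfun_apply (T (t - s)) (C (g s))"
  have "continuous_on {0..t} ?f"
    by (intro T_continuous_on continuous_intros continuous_on_subset[OF g]) auto
  then have "(?f has_integral integral {0..t} ?f) (cbox 0 t)"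
    by (simp add: integrable_continuous_real integrable_integral)
  from has_integral_affinity'[OF this, of t 0] False t
  have "((\<lambda>x. T (t * (1 - x)) (C (g (t * x)))) has_integral integral {0..t} ?f /\<^sub>R t) {0..1}"
    by (simp add: right_diff_distrib)
  then have "volterra_mean g t = integral {0..t} ?f /\<^sub>R t"
    unfolding volterra_mean_def by (rule integral_unique)
  then show ?thesis using False by (simp add: volterra_def)
qed (simp add: volterra_def)

lemma volterra_add:
  assumes "continuous_on {0..} f" "continuous_on {0..} g" "0 \<le> t"
  shows "volterra (\<lambda>s. f s + g s) t = volterra f t + volterra g t"
  unfolding volterra_def volterra_mean_def
  by (simp add: blinfun.add_right integral_add volterra_integrand_integrable assms scaleR_add_right)

lemma volterra_diff:
  assumes "continuous_on {0..} f" "continuous_on {0..} g" "0 \<le> t"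
  shows "volterra (\<lambda>s. f s - g s) t = volterra f t - volterra g t"
  unfolding volterra_def volterra_mean_def
  by (simp add: blinfun.diff_right integral_diff volterra_integrand_integrable assms scaleR_diff_right)

lemma volterra_scaleC:
  assumes "continuous_on {0..} g" "0 \<le> t"
  shows "volterra (\<lambda>s. c *\<^sub>C g s) t = c *\<^sub>C volterra g t"
proof -
  have "volterra_mean (\<lambda>s. c *\<^sub>C g s) t
      = integral {0..1} (\<lambda>\<sigma>. c *\<^sub>C T (t * (1 - \<sigma>)) (C (g (t * \<sigma>))))"
    unfolding volterra_mean_def using assms C_linear
    by (intro integral_cong) (simp add: T_scaleC complex_linear_blinfun_def)
  also have "\<dots> = c *\<^sub>C volterra_mean g t"
    unfolding volterra_mean_def
    by (rule integral_linear[OF volterra_integrand_integrable[OF assms] bounded_linear_scaleC,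
        unfolded o_def])
  finally show ?thesis by (simp add: volterra_def scaleC_scaleR_commute)
qed

lemma volterra_cong:
  assumes "\<And>s. 0 \<le> s \<Longrightarrow> f s = g s" "0 \<le> t"
  shows "volterra f t = volterra g t"
  unfolding volterra_def volterra_mean_def using assms by (auto intro!: integral_cong)

text \<open>One Volterra step turns a term of the exponential series into the next one: integrating
  \<open>\<sigma> ^ n\<close> over the unit interval supplies \<open>1 / Suc n\<close>, and the
  outer factor \<open>t\<close> supplies the missing power.\<close>

lemma volterra_norm_le:
  assumes g: "continuous_on {0..} g" and M: "\<forall>s\<in>{0..b}. norm (T s) \<le> M"
    and bound: "\<And>s. s \<in> {0..b} \<Longrightarrow> norm (g s) \<le> K * ((M * norm C * s) ^ n / fact n)"
    and t: "t \<in> {0..b}"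
  shows "norm (volterra g t) \<le> K * ((M * norm C * t) ^ Suc n / fact (Suc n))"
proof -
  have M0: "0 \<le> M" using M t norm_ge_zero[of "T t"] by (meson order_trans)
  have K: "0 \<le> K * ((M * norm C * s) ^ n / fact n)" if "s \<in> {0..b}" for s
    using bound[OF that] norm_ge_zero order_trans by blast
  define c where "c = M * norm C * (K * ((M * norm C * t) ^ n / fact n))"
  have "norm (volterra_mean g t) \<le> integral {0..1} (\<lambda>\<sigma>. c * \<sigma> ^ n)"
    unfolding volterra_mean_def
  proof (rule integral_norm_bound_integral)
    fix \<sigma> :: real assume \<sigma>: "\<sigma> \<in> {0..1}"
    have t1: "t * (1 - \<sigma>) \<in> {0..b}" and t2: "t * \<sigma> \<in> {0..b}"
      using t \<sigma> mult_left_le[of "1 - \<sigma>" t] mult_left_le[of \<sigma> t] by auto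
    have "norm (T (t * (1 - \<sigma>)) (C (g (t * \<sigma>)))) \<le> M * norm (C (g (t * \<sigma>)))"
      using M t1 by (auto intro!: order_trans[OF norm_blinfun] mult_right_mono)
    also have "\<dots> \<le> M * (norm C * (K * ((M * norm C * (t * \<sigma>)) ^ n / fact n)))"
      using M0 by (intro mult_left_mono order_trans[OF norm_blinfun] bound t2) auto
    also have "\<dots> = c * \<sigma> ^ n" by (simp add: c_def power_mult_distrib)
    finally show "norm (T (t * (1 - \<sigma>)) (C (g (t * \<sigma>)))) \<le> c * \<sigma> ^ n" .
  next
    show "(\<lambda>\<sigma>. T (t * (1 - \<sigma>)) (C (g (t * \<sigma>)))) integrable_on {0..1}"
      using t by (intro volterra_integrand_integrable g) auto
  qed (intro integrable_continuous_real continuous_intros)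
  also have "integral {0..1} (\<lambda>\<sigma>::real. c * \<sigma> ^ n) = c / Suc n"
  proof (rule integral_unique)
    have "((\<lambda>\<sigma>. c / Suc n * \<sigma> ^ Suc n) has_vector_derivative c * \<sigma> ^ n) (at \<sigma> within {0..1})"
      for \<sigma> :: real
      using DERIV_cmult[OF DERIV_pow[of "Suc n" \<sigma> "{0..1}"], of "c / Suc n"]
      by (simp del: of_nat_Suc flip: has_real_derivative_iff_has_vector_derivative)
    then have "((\<lambda>\<sigma>::real. c * \<sigma> ^ n) has_integral (c / Suc n * 1 ^ Suc n - c / Suc n * 0 ^ Suc n)) {0..1}"
      by (intro fundamental_theorem_of_calculus) auto
    then show "((\<lambda>\<sigma>::real. c * \<sigma> ^ n) has_integral c / Suc n) {0..1}" by simp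
  qed
  finally have "t * norm (volterra_mean g t) \<le> t * (c / Suc n)"
    using t by (intro mult_left_mono) auto
  also have "t * (c / Suc n) = K * ((M * norm C * t) ^ Suc n / fact (Suc n))"
    by (simp add: c_def fact_Suc mult_ac)
  finally show ?thesis using t by (simp add: volterra_def)
qed

lemma volterra_iterate_continuous:
  "continuous_on {0..} f \<Longrightarrow> continuous_on {0..} ((volterra ^^ n) f)"
  by (induction n) (auto intro: volterra_continuous)

lemma volterra_iterate_norm_le:
  assumes f: "continuous_on {0..} f" and M: "\<forall>s\<in>{0..b}. norm (T s) \<le> M"
    and K: "\<And>s. s \<in> {0..b} \<Longrightarrow> norm (f s) \<le> K" and t: "t \<in> {0..b}"
  shows "norm ((volterra ^^ n) f t) \<le> K * ((M * norm C * t) ^ n / fact n)"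
  using t
proof (induction n arbitrary: t)
  case 0
  then show ?case using K by simp
next
  case (Suc n)
  show ?case
    using volterra_norm_le[OF volterra_iterate_continuous[OF f] M Suc.IH Suc.prems] by simp
qed

text \<open>A fixed point equals all its Volterra iterates, and these are bounded by the terms of a
  convergent exponential series.\<close>

lemma volterra_unique_zero:
  assumes w: "continuous_on {0..} w" and eq: "\<And>t. 0 \<le> t \<Longrightarrow> w t = volterra w t" and t: "0 \<le> t"
  shows "w t = 0"
proof -
  have iter: "(volterra ^^ n) w s = w s" if "0 \<le> s" for n s
    using that
  proof (induction n arbitrary: s)
    case (Suc n)
    then have "(volterra ^^ Suc n) w s = volterra w s" by (auto intro: volterra_cong)
    then show ?case using eq Suc.prems by simp
  qed simp
  obtain M where M: "\<forall>s\<in>{0..t}. norm (T s) \<le> M" using T_bounded by blast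
  have "compact (w ` {0..t})"
    by (intro compact_continuous_image continuous_on_subset[OF w]) auto
  then obtain K where K: "\<And>s. s \<in> {0..t} \<Longrightarrow> norm (w s) \<le> K"
    by (metis bounded_iff compact_imp_bounded imageI)
  have "norm (w t) \<le> K * ((M * norm C * t) ^ n / fact n)" for n
    using volterra_iterate_norm_le[OF w M K, of t n] iter t by simp
  moreover have "(\<lambda>n. K * ((M * norm C * t) ^ n / fact n)) \<longlonglongrightarrow> K * 0"
    using summable_LIMSEQ_zero[OF sums_summable[OF exp_converges[of "M * norm C * t"]]]
    by (intro tendsto_mult tendsto_const) (simp add: divide_inverse mult.commute)
  ultimately have "norm (w t) \<le> K * 0"
    by (intro LIMSEQ_le_const) auto
  then show ?thesis by simp
qed

text \<open>The Dyson-Phillips series, that is, the Neumann series of the Volterra equation.\<close>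

definition perturbed_orbit :: "'a \<Rightarrow> real \<Rightarrow> 'a"
  where "perturbed_orbit x t = (\<Sum>n. (volterra ^^ n) (\<lambda>t. T t x) t)"

lemma perturbed_orbit:
  shows perturbed_orbit_continuous: "continuous_on {0..} (perturbed_orbit x)"
    and perturbed_orbit_eq: "0 \<le> t \<Longrightarrow> perturbed_orbit x t = T t x + volterra (perturbed_orbit x) t"
    and perturbed_orbit_norm_le: "\<forall>s\<in>{0..b}. norm (T s) \<le> M \<Longrightarrow> t \<in> {0..b} \<Longrightarrow>
      norm (perturbed_orbit x t) \<le> M * exp (M * norm C * t) * norm x"
proof -
  define w where "w n = (volterra ^^ n) (\<lambda>t. T t x)" for n
  have w: "continuous_on {0..} (w n)" for n
    unfolding w_def by (rule volterra_iterate_continuous[OF T_continuous])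
  have orbit: "perturbed_orbit x t = (\<Sum>n. w n t)" for t
    by (simp add: perturbed_orbit_def w_def)
  have w_le: "norm (w n t) \<le> M * norm x * ((M * norm C * t) ^ n / fact n)"
    if "\<forall>s\<in>{0..b}. norm (T s) \<le> M" "t \<in> {0..b}" for b M t n
    unfolding w_def using that
    by (intro volterra_iterate_norm_le[OF T_continuous])
      (auto intro!: order_trans[OF norm_blinfun] mult_right_mono)
  have exp_sums: "(\<lambda>n. K * (a ^ n / fact n)) sums (K * exp a)" for K a :: real
    using sums_mult[OF exp_converges[of a], of K] by (simp add: divide_inverse mult.commute)
  show "norm (perturbed_orbit x t) \<le> M * exp (M * norm C * t) * norm x"
    if "\<forall>s\<in>{0..b}. norm (T s) \<le> M" "t \<in> {0..b}" for b M t
  proof -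
    note e = exp_sums[of "M * norm x" "M * norm C * t"]
    have "norm (\<Sum>n. w n t) \<le> (\<Sum>n. M * norm x * ((M * norm C * t) ^ n / fact n))"
      by (rule norm_suminf_le[OF w_le[OF that] sums_summable[OF e]])
    then show ?thesis using sums_unique[OF e] by (simp add: orbit mult.commute mult.left_commute)
  qed
  \<comment> \<open>The majorant is uniform on each bounded interval; continuity on the half-line is
    then a local matter.\<close>
  have uniform: "uniform_limit {0..b} (\<lambda>n t. \<Sum>i<n. w i t) (perturbed_orbit x) sequentially" for b
  proof -
    obtain M where M: "0 < M" "\<forall>s\<in>{0..b}. norm (T s) \<le> M" using T_bounded by blast
    have "uniform_limit {0..b} (\<lambda>n t. \<Sum>i<n. w i t) (\<lambda>t. \<Sum>i. w i t) sequentially"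
    proof (rule Weierstrass_m_test)
      fix n t assume t: "t \<in> {0..b}"
      have "M * norm x * ((M * norm C * t) ^ n / fact n) \<le> M * norm x * ((M * norm C * b) ^ n / fact n)"
        using t M(1) by (intro mult_left_mono divide_right_mono power_mono) auto
      then show "norm (w n t) \<le> M * norm x * ((M * norm C * b) ^ n / fact n)"
        using w_le[OF M(2) t, of n] by linarith
    qed (use exp_sums sums_summable in blast)
    then show ?thesis by (simp add: orbit[abs_def])
  qed
  have cont_b: "continuous_on {0..b} (perturbed_orbit x)" for b
    by (rule uniform_limit_theorem[OF _ uniform])
      (auto intro!: always_eventually continuous_intros continuous_on_subset[OF w])
  show cont: "continuous_on {0..} (perturbed_orbit x)"
    unfolding continuous_on_eq_continuous_within
  proof
    fix t :: real assume t: "t \<in> {0..}"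
    have "continuous (at t within {0..t + 1}) (perturbed_orbit x)"
      using cont_b[of "t + 1"] t by (auto simp: continuous_on_eq_continuous_within)
    moreover have "at t within {0..t + 1} = at t within {0..}"
      by (rule at_within_nhd[of t "{..<t + 1}"]) auto
    ultimately show "continuous (at t within {0..}) (perturbed_orbit x)" by simp
  qed
  show "perturbed_orbit x t = T t x + volterra (perturbed_orbit x) t" if t: "0 \<le> t" for t
  proof (rule LIMSEQ_unique)
    define s where "s N t = (\<Sum>i<N. w i t)" for N t
    have s_cont: "continuous_on {0..} (s N)" for N
      unfolding s_def[abs_def] by (intro continuous_intros w)
    have s_Suc: "s (Suc N) t = T t x + volterra (s N) t" for N
    proof (induction N)
      case 0
      have "volterra (s 0) t = 0" by (simp add: s_def[abs_def] volterra_def volterra_mean_def)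
      moreover have "s (Suc 0) t = T t x" by (simp add: s_def w_def)
      ultimately show ?case by simp
    next
      case (Suc N)
      have "volterra (s (Suc N)) t = volterra (s N) t + volterra (w N) t"
        using volterra_add[OF s_cont w t, of N N] by (simp add: s_def[abs_def])
      moreover have "s (Suc (Suc N)) t = s (Suc N) t + volterra (w N) t"
        by (simp add: s_def w_def)
      ultimately show ?case using Suc by simp
    qed
    have lim: "(\<lambda>N. s N t) \<longlonglongrightarrow> perturbed_orbit x t"
      using tendsto_uniform_limitI[OF uniform[of t], of t] t by (simp add: s_def)
    then show "(\<lambda>N. s (Suc N) t) \<longlonglongrightarrow> perturbed_orbit x t" by (rule LIMSEQ_Suc)
    obtain M where M: "0 < M" "\<forall>s\<in>{0..t}. norm (T s) \<le> M" using T_bounded by blast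
    have "(\<lambda>N. volterra (s N) t) \<longlonglongrightarrow> volterra (perturbed_orbit x) t"
    proof (rule tendstoI)
      fix e :: real assume e: "0 < e"
      \<comment> \<open>A Volterra step multiplies a uniform error by at most
        \<open>M * norm C * t\<close>; the added 1 avoids division by zero and makes the final
        inequality strict.\<close>
      define k where "k = e / (M * norm C * t + 1)"
      have c: "0 \<le> M * norm C * t" using M t by simp
      have k: "0 < k" unfolding k_def using e c by (intro divide_pos_pos) auto
      have "\<forall>\<^sub>F N in sequentially. \<forall>r\<in>{0..t}. dist (s N r) (perturbed_orbit x r) < k"
        using uniform_limitD[OF uniform k] by (simp add: s_def)
      then show "\<forall>\<^sub>F N in sequentially. dist (volterra (s N) t) (volterra (perturbed_orbit x) t) < e"
      proof eventually_elim
        case (elim N)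
        have "norm (volterra (\<lambda>r. s N r - perturbed_orbit x r) t) \<le> k * ((M * norm C * t) ^ Suc 0 / fact (Suc 0))"
          using elim t by (intro volterra_norm_le[OF _ M(2)] continuous_intros s_cont cont)
            (auto simp: dist_norm less_imp_le)
        also have "\<dots> < k * (M * norm C * t + 1)" using k by simp
        also have "\<dots> = e" using c by (simp add: k_def)
        finally show ?case by (simp add: dist_norm volterra_diff s_cont cont t)
      qed
    qed
    then show "(\<lambda>N. s (Suc N) t) \<longlonglongrightarrow> T t x + volterra (perturbed_orbit x) t"
      unfolding s_Suc by (intro tendsto_intros)
  qed
qed

text \<open>Linearity in \<open>x\<close> and the semigroup law are drawn from this: it is enough
  that the candidate solves the same equation.\<close>

lemma perturbed_orbit_unique:
  assumes w: "continuous_on {0..} w" and eq: "\<And>t. 0 \<le> t \<Longrightarrow> w t = T t x + volterra w t"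
    and t: "0 \<le> t"
  shows "w t = perturbed_orbit x t"
proof -
  have "w t - perturbed_orbit x t = 0"
  proof (rule volterra_unique_zero[OF _ _ t])
    show "continuous_on {0..} (\<lambda>t. w t - perturbed_orbit x t)"
      by (intro continuous_intros w perturbed_orbit_continuous)
    show "w t - perturbed_orbit x t = volterra (\<lambda>t. w t - perturbed_orbit x t) t" if "0 \<le> t" for t
      using eq[OF that] perturbed_orbit_eq[OF that, of x]
      by (simp add: volterra_diff w perturbed_orbit_continuous that)
  qed
  then show ?thesis by simp
qed

lemma perturbed_orbit_add:
  assumes "0 \<le> t"
  shows "perturbed_orbit (x + y) t = perturbed_orbit x t + perturbed_orbit y t"
  by (rule perturbed_orbit_unique[OF _ _ assms, symmetric])
    (auto intro!: continuous_intros perturbed_orbit_continuous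
      simp: volterra_add perturbed_orbit_continuous blinfun.add_right perturbed_orbit_eq[of _ x]
        perturbed_orbit_eq[of _ y])

lemma perturbed_orbit_scaleC:
  assumes "0 \<le> t"
  shows "perturbed_orbit (c *\<^sub>C x) t = c *\<^sub>C perturbed_orbit x t"
proof (rule perturbed_orbit_unique[OF _ _ assms, symmetric])
  show "c *\<^sub>C perturbed_orbit x t = T t (c *\<^sub>C x) + volterra (\<lambda>t. c *\<^sub>C perturbed_orbit x t) t"
    if "0 \<le> t" for t
    using perturbed_orbit_eq[OF that, of x]
    by (simp add: volterra_scaleC perturbed_orbit_continuous T_scaleC that flip: scaleC_add_right)
qed (intro continuous_intros perturbed_orbit_continuous)

text \<open>The translated orbit solves the equation with initial value
  \<open>perturbed_orbit x s\<close>: cut the integral over \<open>{0..t + s}\<close> at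
  \<open>s\<close> and pull \<open>T t\<close> out of the first piece.\<close>

lemma perturbed_orbit_shift:
  assumes s: "0 \<le> s" and t: "0 \<le> t"
  shows "perturbed_orbit x (t + s) = perturbed_orbit (perturbed_orbit x s) t"
proof (rule perturbed_orbit_unique[OF _ _ t])
  let ?u = "perturbed_orbit x"
  show cont: "continuous_on {0..} (\<lambda>t. ?u (t + s))"
    using s by (auto intro!: continuous_on_compose2[OF perturbed_orbit_continuous] continuous_intros)
  show "?u (t + s) = T t (?u s) + volterra (\<lambda>t. ?u (t + s)) t" if t: "0 \<le> t" for t
  proof -
    let ?f = "\<lambda>r. blinfun_apply (T (t + s - r)) (C (?u r))"
    have int: "?f integrable_on {a..t + s}" if "0 \<le> a" for a
      using that by (intro integrable_continuous_real T_continuous_on continuous_intros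
          continuous_on_subset[OF perturbed_orbit_continuous]) auto
    have "integral {0..s} ?f = T t (volterra ?u s)"
    proof -
      have "(\<lambda>r. T (s - r) (C (?u r))) integrable_on {0..s}"
        using s by (intro integrable_continuous_real T_continuous_on continuous_intros
          continuous_on_subset[OF perturbed_orbit_continuous]) auto
      then have "T t (volterra ?u s) = integral {0..s} (\<lambda>r. T t (T (s - r) (C (?u r))))"
        unfolding volterra_eq_integral[OF perturbed_orbit_continuous s]
        by (rule integral_linear[OF _ blinfun.bounded_linear_right, symmetric, unfolded o_def])
      also have "\<dots> = integral {0..s} ?f"
        using t by (intro integral_cong) (auto simp: T_add[symmetric] add_diff_eq)
      finally show ?thesis ..
    qed
    moreover have "integral {s..t + s} ?f = volterra (\<lambda>t. ?u (t + s)) t"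
      using integral_unique[OF has_integral_shift_real_ivl[OF integrable_integral[OF int[OF s]], of s]]
      by (simp add: volterra_eq_integral[OF cont t])
    moreover have "integral {0..s} ?f + integral {s..t + s} ?f = integral {0..t + s} ?f"
      using s t int[of 0] by (intro Henstock_Kurzweil_Integration.integral_combine) auto
    moreover have "?u (t + s) = T (t + s) x + integral {0..t + s} ?f"
      using perturbed_orbit_eq[of "t + s" x] volterra_eq_integral[OF perturbed_orbit_continuous, of "t + s" x] s t
      by simp
    moreover have "T t (?u s) = T (t + s) x + T t (volterra ?u s)"
      using perturbed_orbit_eq[OF s, of x] by (simp add: blinfun.add_right T_add s t)
    ultimately show ?thesis by (simp add: add.assoc)
  qed
qed

text \<open>The bound depends on the semigroup through \<open>M\<close> and on the perturbation
  through its norm; this makes it uniform over rotations.\<close>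

theorem perturbed_semigroup:
  assumes M: "\<forall>s\<in>{0..1}. norm (T s) \<le> M"
  shows "\<exists>U. C0_semigroup U \<and> is_generator U D (\<lambda>x. A x + C x) \<and>
    (\<forall>t\<in>{0..1}. norm (U t) \<le> M * exp (M * norm C))"
proof -
  define U where "U t = Blinfun (\<lambda>x. perturbed_orbit x t)" for t
  have U: "U t x = perturbed_orbit x t" if t: "0 \<le> t" for t x
  proof -
    obtain M where M: "\<forall>s\<in>{0..t}. norm (T s) \<le> M" using T_bounded by blast
    have "bounded_linear (\<lambda>x. perturbed_orbit x t)"
    proof (rule bounded_linear_intro[OF perturbed_orbit_add[OF t]])
      show "perturbed_orbit (r *\<^sub>R x) t = r *\<^sub>R perturbed_orbit x t" for r x
        using perturbed_orbit_scaleC[OF t, of "complex_of_real r" x] by (simp add: scaleC_of_real)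
      show "norm (perturbed_orbit x t) \<le> norm x * (M * exp (M * norm C * t))" for x
        using perturbed_orbit_norm_le[OF M, of t x] t by (simp add: mult.commute)
    qed
    then show ?thesis by (simp add: U_def bounded_linear_Blinfun_apply)
  qed
  have zero: "perturbed_orbit x 0 = x" for x
    using perturbed_orbit_eq[of 0 x] by (simp add: T_zero volterra_def)
  have "C0_semigroup U"
    unfolding C0_semigroup_def complex_linear_blinfun_def
  proof (intro conjI allI impI)
    show "U 0 = id_blinfun" by (rule blinfun_eqI) (simp add: U zero)
    show "U (s + t) = U s o\<^sub>L U t" if "0 \<le> s" "0 \<le> t" for s t
      by (rule blinfun_eqI) (simp add: U that perturbed_orbit_shift)
    show "continuous_on {0..} (\<lambda>t. U t x)" for x
      using perturbed_orbit_continuous[of x] by (rule continuous_on_eq) (simp add: U)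
  qed (simp add: U perturbed_orbit_scaleC)
  moreover have "is_generator U D (\<lambda>x. A x + C x)"
  proof -
    have mean: "((\<lambda>h. volterra_mean (perturbed_orbit x) h) \<longlongrightarrow> C x) (at_right 0)" for x
    proof -
      have "(volterra_mean (perturbed_orbit x) \<longlongrightarrow> volterra_mean (perturbed_orbit x) 0) (at 0 within {0..})"
        using volterra_mean_continuous[OF perturbed_orbit_continuous] by (auto simp: continuous_on_def)
      then have "(volterra_mean (perturbed_orbit x) \<longlongrightarrow> volterra_mean (perturbed_orbit x) 0) (at_right 0)"
        by (rule tendsto_within_subset) auto
      then show ?thesis by (simp add: volterra_mean_def[of _ 0] T_zero zero)
    qed
    \<comment> \<open>The two quotients differ by the Volterra mean, which converges to
      \<open>C x\<close>; so they converge for the same \<open>x\<close> and the domain does not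
      change.\<close>
    have eq: "((\<lambda>h. (U h x - x) /\<^sub>R h) \<longlongrightarrow> y + C x) (at_right 0) \<longleftrightarrow>
      ((\<lambda>h. (T h x - x) /\<^sub>R h) \<longlongrightarrow> y) (at_right 0)" for x y
    proof -
      have "\<forall>\<^sub>F h in at_right 0. (U h x - x) /\<^sub>R h = (T h x - x) /\<^sub>R h + volterra_mean (perturbed_orbit x) h"
        using eventually_at_right_less[of 0]
      proof eventually_elim
        case (elim h)
        then have "U h x - x = (T h x - x) + h *\<^sub>R volterra_mean (perturbed_orbit x) h"
          using perturbed_orbit_eq[of h x] by (simp add: U volterra_def)
        then show ?case using elim by (simp only: scaleR_add_right) simp
      qed
      then have "((\<lambda>h. (U h x - x) /\<^sub>R h) \<longlongrightarrow> y + C x) (at_right 0) \<longleftrightarrow>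
        ((\<lambda>h. (T h x - x) /\<^sub>R h + volterra_mean (perturbed_orbit x) h) \<longlongrightarrow> y + C x) (at_right 0)"
        by (rule filterlim_cong[OF refl refl])
      also have "\<dots> \<longleftrightarrow> ((\<lambda>h. (T h x - x) /\<^sub>R h) \<longlongrightarrow> y) (at_right 0)"
        using tendsto_diff[OF _ mean[of x]] tendsto_add[OF _ mean[of x]] by fastforce
      finally show ?thesis .
    qed
    have "x \<in> D" if "((\<lambda>h. (U h x - x) /\<^sub>R h) \<longlongrightarrow> y) (at_right 0)" for x y
      using that eq[of x "y - C x"] by (auto intro: generatorI)
    moreover have "((\<lambda>h. (U h x - x) /\<^sub>R h) \<longlongrightarrow> A x + C x) (at_right 0)" if "x \<in> D" for x
      using eq generator_lim[OF that] by blast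
    ultimately show ?thesis unfolding is_generator_def by blast
  qed
  moreover have "norm (U t) \<le> M * exp (M * norm C)" if t: "t \<in> {0..1}" for t
  proof (rule norm_blinfun_bound)
    have M0: "0 \<le> M" using M t norm_ge_zero[of "T t"] by (meson order_trans)
    then show "0 \<le> M * exp (M * norm C)" by simp
    fix x :: 'a
    have "M * norm C * t \<le> M * norm C" using M0 t by (intro mult_left_le) auto
    then have "M * exp (M * norm C * t) * norm x \<le> M * exp (M * norm C) * norm x"
      using M0 by (intro mult_right_mono mult_left_mono) auto
    then show "norm (U t x) \<le> M * exp (M * norm C) * norm x"
      using perturbed_orbit_norm_le[OF M t, of x] t by (simp add: U)
  qed
  ultimately show ?thesis by blast
qed

end

subsection \<open>Sectors and Cauchy's estimate\<close>

text \<open>\<open>cos\<close> decreases on \<open>[0, pi]\<close>, so the angle condition becomes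
  an inequality between continuous functions; openness and additivity are read off from it.\<close>

lemma sector_eq:
  assumes "0 < \<delta>" "\<delta> \<le> pi"
  shows "sector \<delta> = {z. cos \<delta> * cmod z < Re z}"
proof -
  have "\<bar>Arg z\<bar> < \<delta> \<longleftrightarrow> cos \<delta> * cmod z < Re z" if z: "z \<noteq> 0" for z
  proof -
    have "\<bar>Arg z\<bar> \<le> pi" using Arg_bounded[of z] by auto
    then have "\<bar>Arg z\<bar> < \<delta> \<longleftrightarrow> cos \<delta> < cos \<bar>Arg z\<bar>"
      using cos_mono_less_eq[of \<delta> "\<bar>Arg z\<bar>"] assms by simp
    also have "cos \<bar>Arg z\<bar> = Re z / cmod z"
      using cos_Arg[OF z] by (simp add: abs_if)
    finally show ?thesis using z by (simp add: pos_less_divide_eq)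
  qed
  then have "z \<in> sector \<delta> \<longleftrightarrow> cos \<delta> * cmod z < Re z" for z
    by (cases "z = 0") (simp_all add: sector_def)
  then show ?thesis by blast
qed

lemma open_sector:
  assumes "0 < \<delta>" "\<delta> \<le> pi"
  shows "open (sector \<delta>)"
  unfolding sector_eq[OF assms] by (intro open_Collect_less continuous_intros)

lemma sector_add:
  assumes \<delta>: "0 < \<delta>" "\<delta> \<le> pi / 2" and zw: "z \<in> sector \<delta>" "w \<in> sector \<delta>"
  shows "z + w \<in> sector \<delta>"
proof -
  \<comment> \<open>Angles up to \<open>pi / 2\<close> have nonnegative cosine, so the triangle
    inequality may be multiplied by it.\<close>
  have c: "0 \<le> cos \<delta>" using \<delta> by (intro cos_ge_zero) auto
  have S: "sector \<delta> = {z. cos \<delta> * cmod z < Re z}" using \<delta> by (intro sector_eq) auto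
  have "cos \<delta> * cmod (z + w) \<le> cos \<delta> * cmod z + cos \<delta> * cmod w"
    using mult_left_mono[OF norm_triangle_ineq c] by (simp add: distrib_left)
  also have "\<dots> < Re z + Re w" using zw by (auto simp: S)
  finally show ?thesis by (simp add: S)
qed

lemma sector_scale:
  assumes "z \<in> sector \<delta>" "0 < r"
  shows "complex_of_real r * z \<in> sector \<delta>"
  using assms by (simp add: sector_def)

lemma sector_mono: "\<delta> \<le> \<delta>' \<Longrightarrow> sector \<delta> \<subseteq> sector \<delta>'"
  by (auto simp: sector_def)

lemma one_in_sector: "0 < \<delta> \<Longrightarrow> 1 \<in> sector \<delta>"
  by (simp add: sector_def)

lemma sgn_in_sector: "z \<in> sector \<delta> \<Longrightarrow> sgn z \<in> sector \<delta>"
  using sector_scale[of z \<delta> "inverse (cmod z)"]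
  by (auto simp: sector_def sgn_div_norm scaleR_conv_of_real)

lemma complex_derivative_chain:
  fixes f :: "complex \<Rightarrow> 'a::complex_normed_vector"
  assumes f: "(f has_derivative (\<lambda>h. h *\<^sub>C f')) (at (p s))"
    and p: "(p has_vector_derivative p') (at s within S)"
  shows "((\<lambda>s. f (p s)) has_vector_derivative p' *\<^sub>C f') (at s within S)"
proof -
  have "((\<lambda>s. f (p s)) has_derivative (\<lambda>h. (h *\<^sub>R p') *\<^sub>C f')) (at s within S)"
    using has_derivative_compose[OF p[unfolded has_vector_derivative_def] f] .
  then show ?thesis by (simp add: has_vector_derivative_def scaleC.scaleR_left)
qed

text \<open>The mean \<open>m \<rho>\<close> of \<open>f'\<close> over the circle of radius \<open>\<rho>\<close> satisfies \<open>m \<rho> = g \<rho> / \<rho>\<close> and \<open>m = g'\<close>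
  with \<open>g \<rho>\<close> the integral of \<open>cis (- \<theta>) *\<^sub>C f (z + \<rho> cis \<theta>)\<close>, so \<open>g \<rho> / \<rho>\<close> is constant.\<close>

lemma Cauchy_estimate:
  fixes f :: "complex \<Rightarrow> 'a::complex_banach"
  assumes r: "0 < r"
    and deriv: "\<And>w. w \<in> cball z r \<Longrightarrow> (f has_derivative (\<lambda>h. h *\<^sub>C f' w)) (at w)"
    and cont: "continuous_on (cball z r) f'"
    and bound: "\<And>w. w \<in> cball z r \<Longrightarrow> norm (f w) \<le> b"
  shows "norm (f' z) \<le> b / r"
proof -
  define p where "p \<rho> \<theta> = z + complex_of_real \<rho> * cis \<theta>" for \<rho> \<theta>
  have p: "p \<rho> \<theta> \<in> cball z r" if "\<rho> \<in> {0..r}" for \<rho> \<theta>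
    using that by (simp add: p_def dist_norm norm_mult)
  define g where "g \<rho> = integral (cbox 0 (2 * pi)) (\<lambda>\<theta>. cis (- \<theta>) *\<^sub>C f (p \<rho> \<theta>))" for \<rho>
  define m where "m \<rho> = integral (cbox 0 (2 * pi)) (\<lambda>\<theta>. f' (p \<rho> \<theta>))" for \<rho>
  have cont_f: "continuous_on (cball z r) f"
    by (intro continuous_at_imp_continuous_on ballI has_derivative_continuous[OF deriv])
  have f_p: "continuous_on {0..2 * pi} (\<lambda>\<theta>. f (p \<rho> \<theta>))"
    and f'_p: "continuous_on {0..2 * pi} (\<lambda>\<theta>. f' (p \<rho> \<theta>))" if "\<rho> \<in> {0..r}" for \<rho>
    using p[OF that] by (auto simp: p_def[abs_def]
        intro!: continuous_on_compose2[OF cont_f] continuous_on_compose2[OF cont] continuous_intros)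
  have cont_param: "continuous_on ({0..r} \<times> cbox 0 (2 * pi)) (\<lambda>(\<rho>, \<theta>). f' (p \<rho> \<theta>))"
    using p unfolding split_beta
    by (intro continuous_on_compose2[OF cont]) (auto simp: p_def[abs_def] intro!: continuous_intros)
  have m_cont: "continuous_on {0..r} m"
    unfolding m_def[abs_def] by (rule integral_continuous_on_param[OF cont_param])
  have g': "(g has_vector_derivative m \<rho>) (at \<rho> within {0..r})" if \<rho>: "\<rho> \<in> {0..r}" for \<rho>
    unfolding g_def[abs_def] m_def
  proof (rule leibniz_rule_vector_derivative[OF _ _ cont_param \<rho>])
    fix \<rho> \<theta> :: real assume \<rho>: "\<rho> \<in> {0..r}"
    have "((\<lambda>\<rho>. p \<rho> \<theta>) has_vector_derivative cis \<theta>) (at \<rho> within {0..r})"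
      unfolding p_def by (auto intro!: derivative_eq_intros)
    from complex_derivative_chain[OF deriv[OF p[OF \<rho>]] this]
    have "((\<lambda>\<rho>. cis (- \<theta>) *\<^sub>C f (p \<rho> \<theta>)) has_vector_derivative cis (- \<theta>) *\<^sub>C cis \<theta> *\<^sub>C f' (p \<rho> \<theta>))
        (at \<rho> within {0..r})"
      by (rule bounded_linear.has_vector_derivative[OF bounded_linear_scaleC])
    then show "((\<lambda>\<rho>. cis (- \<theta>) *\<^sub>C f (p \<rho> \<theta>)) has_vector_derivative f' (p \<rho> \<theta>)) (at \<rho> within {0..r})"
      by (simp add: scaleC_scaleC cis_mult)
  next
    fix \<rho> :: real assume "\<rho> \<in> {0..r}"
    then show "(\<lambda>\<theta>. cis (- \<theta>) *\<^sub>C f (p \<rho> \<theta>)) integrable_on cbox 0 (2 * pi)"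
      unfolding interval_cbox by (intro integrable_continuous continuous_intros f_p[unfolded box_real[symmetric]])
  qed simp
  have g_eq: "g \<rho> = \<rho> *\<^sub>R m \<rho>" if \<rho>: "\<rho> \<in> {0..r}" for \<rho>
  proof -
    let ?G = "\<lambda>\<theta>. cis (- \<theta>) *\<^sub>C f (p \<rho> \<theta>)"
    \<comment> \<open>The integrand is the angular derivative of \<open>?G\<close>. As
      \<open>?G\<close> takes the same value at both ends of the full circle, integration gives
      \<open>\<i> \<rho> m \<rho> = \<i> g \<rho>\<close>.\<close>
    have "((\<lambda>\<theta>. (\<i> * \<rho>) *\<^sub>C f' (p \<rho> \<theta>) - \<i> *\<^sub>C ?G \<theta>) has_integral ?G (2 * pi) - ?G 0) {0..2 * pi}"
    proof (rule fundamental_theorem_of_calculus)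
      fix \<theta> :: real
      have "((\<lambda>\<theta>. p \<rho> \<theta>) has_vector_derivative \<i> * \<rho> * cis \<theta>) (at \<theta> within {0..2 * pi})"
        unfolding p_def has_vector_derivative_def
        by (auto intro!: derivative_eq_intros simp: scaleR_conv_of_real)
      from complex_derivative_chain[OF deriv[OF p[OF \<rho>]] this]
      have "((\<lambda>\<theta>. f (p \<rho> \<theta>)) has_vector_derivative (\<i> * \<rho> * cis \<theta>) *\<^sub>C f' (p \<rho> \<theta>)) (at \<theta> within {0..2 * pi})" .
      moreover have "((\<lambda>\<theta>. cis (- \<theta>)) has_vector_derivative - \<i> * cis (- \<theta>)) (at \<theta> within {0..2 * pi})"
        unfolding has_vector_derivative_def
        by (auto intro!: derivative_eq_intros simp: scaleR_conv_of_real)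
      ultimately have "(?G has_vector_derivative
          cis (- \<theta>) *\<^sub>C (\<i> * \<rho> * cis \<theta>) *\<^sub>C f' (p \<rho> \<theta>) + (- \<i> * cis (- \<theta>)) *\<^sub>C f (p \<rho> \<theta>)) (at \<theta> within {0..2 * pi})"
        by (rule scaleC.has_vector_derivative[rotated])
      moreover have "cis (- \<theta>) * (\<i> * \<rho> * cis \<theta>) = \<i> * \<rho>"
        using cis_mult[of "- \<theta>" \<theta>] by (simp add: mult_ac)
      ultimately show "(?G has_vector_derivative (\<i> * \<rho>) *\<^sub>C f' (p \<rho> \<theta>) - \<i> *\<^sub>C ?G \<theta>) (at \<theta> within {0..2 * pi})"
        by (simp add: scaleC_scaleC scaleC.minus_left)
    qed simp
    moreover have "?G (2 * pi) - ?G 0 = 0" by (simp add: p_def cis.ctr complex_eq_iff)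
    ultimately have zero: "((\<lambda>\<theta>. (\<i> * \<rho>) *\<^sub>C f' (p \<rho> \<theta>) - \<i> *\<^sub>C ?G \<theta>) has_integral 0) {0..2 * pi}" by simp
    have "((\<lambda>\<theta>. f' (p \<rho> \<theta>)) has_integral m \<rho>) {0..2 * pi}"
      unfolding m_def box_real using f'_p[OF \<rho>] by (intro integrable_integral integrable_continuous_real)
    moreover have "(?G has_integral g \<rho>) {0..2 * pi}"
      unfolding g_def box_real using f_p[OF \<rho>]
      by (intro integrable_integral integrable_continuous_real continuous_intros)
    ultimately have "((\<lambda>\<theta>. (\<i> * \<rho>) *\<^sub>C f' (p \<rho> \<theta>) - \<i> *\<^sub>C ?G \<theta>) has_integral (\<i> * \<rho>) *\<^sub>C m \<rho> - \<i> *\<^sub>C g \<rho>) {0..2 * pi}"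
      by (intro has_integral_diff has_integral_linear[OF _ bounded_linear_scaleC, unfolded o_def])
    with zero have "(\<i> * \<rho>) *\<^sub>C m \<rho> - \<i> *\<^sub>C g \<rho> = 0" by (rule has_integral_unique[rotated])
    then have "\<i> *\<^sub>C (complex_of_real \<rho> *\<^sub>C m \<rho> - g \<rho>) = 0"
      by (simp add: scaleC.diff_right scaleC_scaleC)
    then have "norm (complex_of_real \<rho> *\<^sub>C m \<rho> - g \<rho>) = 0"
      by (metis norm_eq_zero norm_scaleC norm_ii mult_1)
    then show ?thesis by (simp add: scaleC_of_real)
  qed
  have m_const: "m \<rho> = m r" if \<rho>: "\<rho> \<in> {0<..r}" for \<rho>
  proof -
    have m_eq: "m u = inverse u *\<^sub>R g u" if "u \<in> {0<..r}" for u
      using g_eq[of u] that by simp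
    have "((\<lambda>u. inverse u *\<^sub>R g u) has_vector_derivative 0) (at u within {0<..r})" if u: "u \<in> {0<..r}" for u
    proof -
      have "(inverse has_real_derivative - inverse (u ^ 2)) (at u within {0<..r})"
        using DERIV_inverse[of u "{0<..r}"] u by (simp add: numeral_2_eq_2 power_inverse)
      then have "((\<lambda>u. inverse u *\<^sub>R g u) has_vector_derivative
          inverse u *\<^sub>R m u + (- inverse (u ^ 2)) *\<^sub>R g u) (at u within {0<..r})"
        using u by (intro has_vector_derivative_scaleR has_vector_derivative_within_subset[OF g']) auto
      moreover have "inverse u *\<^sub>R m u + (- inverse (u ^ 2)) *\<^sub>R g u = 0"
        using g_eq[of u] u by (simp add: power2_eq_square)
      ultimately show ?thesis by simp
    qed
    then obtain c where "\<And>u. u \<in> {0<..r} \<Longrightarrow> inverse u *\<^sub>R g u = c"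
      by (rule has_vector_derivative_zero_constant[rotated]) auto
    then show ?thesis using m_eq \<rho> r by simp
  qed
  \<comment> \<open>The quotient \<open>g \<rho> / \<rho>\<close> says nothing at the centre.
    Continuity of \<open>m\<close> carries the constant to radius 0, where \<open>m 0\<close> is
    \<open>2 * pi\<close> times \<open>f' z\<close>.\<close>
  have "m 0 = m r"
  proof (rule tendsto_unique[OF trivial_limit_at_right_real])
    have "(m \<longlongrightarrow> m 0) (at 0 within {0..r})"
      using m_cont r by (simp add: continuous_on_def)
    then show "(m \<longlongrightarrow> m 0) (at_right 0)"
      using r by (simp add: at_within_Icc_at_right)
    show "(m \<longlongrightarrow> m r) (at_right 0)"
    proof (rule tendsto_eventually)
      show "\<forall>\<^sub>F u in at_right 0. m u = m r"
        using eventually_at_right_real[OF r] by eventually_elim (auto intro: m_const)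
    qed
  qed
  moreover have "norm (m 0) = 2 * pi * norm (f' z)" by (simp add: m_def p_def)
  moreover have "norm (g r) \<le> b * (2 * pi - 0)"
    unfolding g_def box_real using r p[of r]
    by (intro integral_bound continuous_intros f_p) (auto simp: norm_scaleC intro!: bound)
  moreover have "r * norm (m r) = norm (g r)" using g_eq[of r] r by simp
  ultimately have "r * (2 * pi * norm (f' z)) \<le> b * (2 * pi)" by (metis diff_zero)
  then have "2 * pi * (r * norm (f' z)) \<le> 2 * pi * b" by (simp add: mult_ac)
  then have "r * norm (f' z) \<le> b" by (simp only: mult_le_cancel_left_pos[OF pi_gt_zero] mult.assoc) simp
  then show ?thesis using r by (simp add: pos_le_divide_eq mult.commute)
qed

subsection \<open>Semigroups with a bound on the unit interval\<close>

text \<open>The unit interval suffices: by the semigroup law a bound there controls every bounded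
  time interval, and no growth rate has to be fixed.\<close>

definition generates_le :: "real \<Rightarrow> 'a::complex_banach set \<Rightarrow> ('a \<Rightarrow> 'a) \<Rightarrow> bool"
  where "generates_le M D A \<longleftrightarrow>
    (\<exists>T. C0_semigroup T \<and> is_generator T D A \<and> (\<forall>t\<in>{0..1}. norm (T t) \<le> M))"

lemma generates_C0_semigroup_iff: "generates_C0_semigroup D A \<longleftrightarrow> (\<exists>M. generates_le M D A)"
proof
  assume "generates_C0_semigroup D A"
  then obtain T where T: "C0_semigroup T" "is_generator T D A" by (auto simp: generates_C0_semigroup_def)
  then interpret C0_generator T D A by unfold_locales
  obtain M where "\<forall>t\<in>{0..1}. norm (T t) \<le> M" using T_bounded by blast
  then show "\<exists>M. generates_le M D A" using T by (auto simp: generates_le_def)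
qed (auto simp: generates_le_def generates_C0_semigroup_def)

lemma is_generator_cong:
  assumes "\<And>t. 0 < t \<Longrightarrow> T t = T' t" "\<And>x. x \<in> D \<Longrightarrow> A x = A' x"
  shows "is_generator T D A \<longleftrightarrow> is_generator T' D A'"
proof -
  have "((\<lambda>h. (T h x - x) /\<^sub>R h) \<longlongrightarrow> y) (at_right 0) \<longleftrightarrow>
      ((\<lambda>h. (T' h x - x) /\<^sub>R h) \<longlongrightarrow> y) (at_right 0)" for x y
    using eventually_at_right_less[of 0]
    by (intro filterlim_cong refl) (auto elim!: eventually_mono simp: assms(1))
  then show ?thesis by (simp add: is_generator_def assms(2))
qed

lemma generates_le_cong:
  "(\<And>x. x \<in> D \<Longrightarrow> A x = A' x) \<Longrightarrow> generates_le M D A \<longleftrightarrow> generates_le M D A'"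
  unfolding generates_le_def using is_generator_cong[of _ _ D A A'] by blast

lemma filterlim_times_at_right_0:
  fixes c :: real
  assumes "0 < c"
  shows "filterlim (\<lambda>h. c * h) (at_right 0) (at_right 0)"
  unfolding filterlim_at
proof
  show "\<forall>\<^sub>F h in at_right 0. c * h \<in> {0<..} \<and> c * h \<noteq> 0"
    using eventually_at_right_less[of 0] by eventually_elim (use assms in simp)
  show "((\<lambda>h. c * h) \<longlongrightarrow> 0) (at_right 0)" by (auto intro!: tendsto_eq_intros)
qed

lemma C0_generator_time_scale:
  assumes "C0_generator T D A" and c: "0 < c"
  shows "C0_generator (\<lambda>t. T (c * t)) D (\<lambda>x. c *\<^sub>R A x)"
proof
  interpret C0_generator T D A by fact
  have "continuous_on {0..} (\<lambda>t. T (c * t) x)" for x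
    using c by (intro T_continuous_on continuous_intros) auto
  then show "C0_semigroup (\<lambda>t. T (c * t))"
    using C0 c by (auto simp: C0_semigroup_def distrib_left)
  have lim: "((\<lambda>h. (T (c * h) x - x) /\<^sub>R h) \<longlongrightarrow> c *\<^sub>R y) (at_right 0)"
    if "((\<lambda>h. (T h x - x) /\<^sub>R h) \<longlongrightarrow> y) (at_right 0)" for x y
    using tendsto_scaleR[OF tendsto_const[of c] filterlim_compose[OF that filterlim_times_at_right_0[OF c]]] c
    by (simp flip: mult.assoc)
  have "x \<in> D" if "((\<lambda>h. (T (c * h) x - x) /\<^sub>R h) \<longlongrightarrow> y) (at_right 0)" for x y
  proof -
    have "filterlim (\<lambda>h. inverse c * h) (at_right 0) (at_right 0)"
      using c by (intro filterlim_times_at_right_0) simp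
    from tendsto_scaleR[OF tendsto_const[of "inverse c"] filterlim_compose[OF that this]] c
    show ?thesis by (intro generatorI(1)[of x "inverse c *\<^sub>R y"]) (simp flip: mult.assoc)
  qed
  then show "is_generator (\<lambda>t. T (c * t)) D (\<lambda>x. c *\<^sub>R A x)"
    unfolding is_generator_def using lim[OF generator_lim] by blast
qed

subsection \<open>Analytic semigroups in terms of the rays of a sector\<close>

lemma complex_derivative_iff_quotient:
  fixes f :: "complex \<Rightarrow> 'a::complex_normed_vector"
  shows "((\<lambda>w. inverse (w - z) *\<^sub>C (f w - f z)) \<longlongrightarrow> f') (at z) \<longleftrightarrow>
    (f has_derivative (\<lambda>h. h *\<^sub>C f')) (at z)"
proof -
  have "((\<lambda>w. inverse (w - z) *\<^sub>C (f w - f z)) \<longlongrightarrow> f') (at z) \<longleftrightarrow>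
      ((\<lambda>w. norm (inverse (w - z) *\<^sub>C (f w - f z) - f')) \<longlongrightarrow> 0) (at z)"
    by (simp add: tendsto_norm_zero_iff LIM_zero_iff)
  also have "\<dots> \<longleftrightarrow> ((\<lambda>w. norm ((f w - f z) - (w - z) *\<^sub>C f') / norm (w - z)) \<longlongrightarrow> 0) (at z)"
  proof (rule filterlim_cong[OF refl refl])
    have "norm (inverse (w - z) *\<^sub>C (f w - f z) - f') = norm ((f w - f z) - (w - z) *\<^sub>C f') / norm (w - z)"
      if "w \<noteq> z" for w
    proof -
      have "(f w - f z) - (w - z) *\<^sub>C f' = (w - z) *\<^sub>C (inverse (w - z) *\<^sub>C (f w - f z) - f')"
        using that by (simp add: scaleC.diff_right scaleC_scaleC)
      then show ?thesis using that by (simp add: norm_scaleC)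
    qed
    then show "\<forall>\<^sub>F w in at z. norm (inverse (w - z) *\<^sub>C (f w - f z) - f')
        = norm ((f w - f z) - (w - z) *\<^sub>C f') / norm (w - z)"
      by (auto simp: eventually_at_filter)
  qed
  also have "\<dots> \<longleftrightarrow> (f has_derivative (\<lambda>h. h *\<^sub>C f')) (at z)"
    by (simp add: has_derivative_iff_norm scaleC.bounded_linear_left)
  finally show ?thesis .
qed

text \<open>The complex derivative of \<open>T\<close> is the same in every direction, so all rays
  share one generator up to the direction as a factor. The angle is halved because strong continuity
  at 0 is granted on smaller sectors and the uniform bound comes from a compact set.\<close>

lemma analytic_semigroup_rays:
  fixes T :: "complex \<Rightarrow> 'a::complex_banach \<Rightarrow>\<^sub>L 'a"
  assumes \<delta>: "0 < \<delta>" "\<delta> \<le> pi / 2" and T: "analytic_semigroup \<delta> T"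
    and gen: "is_generator (\<lambda>t. T (complex_of_real t)) D A"
  shows "\<exists>M. \<forall>z\<in>sector (\<delta> / 2). cmod z = 1 \<longrightarrow> generates_le M D (\<lambda>x. z *\<^sub>C A x)"
proof -
  let ?S = "sector \<delta>" and ?S1 = "sector (3 * \<delta> / 4)" and ?S2 = "sector (\<delta> / 2)"
  have sub: "?S1 \<subseteq> ?S" "?S2 \<subseteq> ?S1" using \<delta> by (intro sector_mono; simp)+
  have T_0: "T 0 = id_blinfun" and T_add: "\<And>z w. z \<in> ?S \<Longrightarrow> w \<in> ?S \<Longrightarrow> T (z + w) = T z o\<^sub>L T w"
    and T_linear: "\<And>z. z \<in> ?S \<Longrightarrow> complex_linear_blinfun (T z)"
    using T by (auto simp: analytic_semigroup_def)
  have lim0: "((\<lambda>z. T z x) \<longlongrightarrow> x) (at 0 within ?S1)" for x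
    using T \<delta> unfolding analytic_semigroup_def by auto
  have "\<exists>E. \<forall>w\<in>?S. (T has_derivative (\<lambda>h. h *\<^sub>C E w)) (at w)"
    using T unfolding analytic_semigroup_def vector_holomorphic_on_def complex_derivative_iff_quotient
    by (intro bchoice) blast
  then obtain E where E: "\<And>w. w \<in> ?S \<Longrightarrow> (T has_derivative (\<lambda>h. h *\<^sub>C E w)) (at w)" by blast
  have ray_deriv: "((\<lambda>s. T (w + complex_of_real s * b) x) has_vector_derivative
      b *\<^sub>C E (w + complex_of_real t * b) x) (at t within X)"
    if "w + complex_of_real t * b \<in> ?S" for w b x t X
  proof -
    have "((\<lambda>s. w + complex_of_real s * b) has_vector_derivative b) (at t within X)"
      by (auto intro!: derivative_eq_intros)
    from bounded_linear.has_vector_derivative[OF blinfun.bounded_linear_left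
        complex_derivative_chain[of T, OF E[OF that] this]]
    show ?thesis by (simp add: scaleC_blinfun.rep_eq)
  qed
  \<comment> \<open>If \<open>y\<close> is the generator of the ray \<open>a\<close> applied to
    \<open>x\<close>, the semigroup law turns the derivative at \<open>w\<close> in the direction
    \<open>a\<close> into \<open>T w y\<close>. This determines \<open>E w x\<close>, hence the
    derivative in every other direction too.\<close>
  have E_eq: "a *\<^sub>C E w x = T w y"
    if a: "a \<in> ?S" and w: "w \<in> ?S" and lim: "((\<lambda>h. (T (of_real h * a) x - x) /\<^sub>R h) \<longlongrightarrow> y) (at_right 0)"
    for a w x y
  proof (rule tendsto_unique[OF trivial_limit_at_right_real])
    show "((\<lambda>h. T w ((T (of_real h * a) x - x) /\<^sub>R h)) \<longlongrightarrow> T w y) (at_right 0)"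
      by (intro blinfun.tendsto tendsto_const lim)
    have "((\<lambda>h. (T (w + of_real h * a) x - T w x) /\<^sub>R h) \<longlongrightarrow> a *\<^sub>C E w x) (at_right 0)"
      using ray_deriv[of w 0 a x "{0<..}"] w by (simp add: has_vector_derivative_iff_quotient)
    moreover have "\<forall>\<^sub>F h in at_right 0. (T (w + of_real h * a) x - T w x) /\<^sub>R h
        = T w ((T (of_real h * a) x - x) /\<^sub>R h)"
      using eventually_at_right_less[of 0]
      by eventually_elim (simp add: T_add w sector_scale[OF a] blinfun.scaleR_right blinfun.diff_right)
    ultimately show "((\<lambda>h. T w ((T (of_real h * a) x - x) /\<^sub>R h)) \<longlongrightarrow> a *\<^sub>C E w x) (at_right 0)"
      by (rule Lim_transform_eventually)
  qed
  have cont: "continuous_on {0..} (\<lambda>t. T (complex_of_real t * b) x)" if b: "b \<in> ?S2" for b x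
    unfolding continuous_on_def
  proof
    fix t :: real assume t: "t \<in> {0..}"
    show "((\<lambda>t. T (complex_of_real t * b) x) \<longlongrightarrow> T (complex_of_real t * b) x) (at t within {0..})"
    proof (cases "t = 0")
      case True
      have b0: "b \<noteq> 0" using b by (simp add: sector_def)
      have "filterlim (\<lambda>s. complex_of_real s * b) (at 0 within ?S1) (at t within {0..})"
        unfolding filterlim_at
      proof
        have "complex_of_real s * b \<in> ?S1 \<and> complex_of_real s * b \<noteq> 0" if "0 \<le> s" "s \<noteq> 0" for s
          using that b b0 sub sector_scale[of b "\<delta> / 2" s] by auto
        then show "\<forall>\<^sub>F s in at t within {0..}. complex_of_real s * b \<in> ?S1 \<and> complex_of_real s * b \<noteq> 0"
          using True by (auto simp: eventually_at_filter)
        show "((\<lambda>s. complex_of_real s * b) \<longlongrightarrow> 0) (at t within {0..})"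
          using True by (auto intro!: tendsto_eq_intros)
      qed
      from filterlim_compose[OF lim0 this] True show ?thesis by (simp add: T_0)
    next
      case False
      then have "0 + of_real t * b \<in> ?S" using sector_scale[OF b, of t] t sub by auto
      from has_vector_derivative_continuous[OF ray_deriv[OF this]]
      show ?thesis by (simp add: continuous_within)
    qed
  qed
  have C0: "C0_semigroup (\<lambda>t. T (complex_of_real t * b))" if b: "b \<in> ?S2" for b
    unfolding C0_semigroup_def
  proof (intro conjI allI impI)
    have in_S: "complex_of_real t * b \<in> ?S" if "0 < t" for t
      using sector_scale[OF b that] sub by auto
    show "complex_linear_blinfun (T (complex_of_real t * b))" if "0 \<le> t" for t
      using T_linear[OF in_S, of t] that by (cases "t = 0") (auto simp: T_0 complex_linear_blinfun_def)
    show "T (complex_of_real (s + t) * b) = T (complex_of_real s * b) o\<^sub>L T (complex_of_real t * b)"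
      if "0 \<le> s" "0 \<le> t" for s t
      using T_add[OF in_S[of s] in_S[of t]] that
      by (cases "s = 0"; cases "t = 0") (auto simp: T_0 distrib_right intro!: blinfun_eqI)
  qed (use cont b T_0 in auto)
  \<comment> \<open>Along the ray \<open>b\<close> the orbit of \<open>x\<close> has derivative
    \<open>?f s\<close> for \<open>s > 0\<close>; integrating from 0 and averaging gives the right
    derivative at 0. Applied to \<open>1\<close> and \<open>b\<close> in both orders, this
    identifies the generator's values and its domain.\<close>
  have switch: "((\<lambda>h. (T (of_real h * b) x - x) /\<^sub>R h) \<longlongrightarrow> (b / a) *\<^sub>C y) (at_right 0)"
    if a: "a \<in> ?S2" and b: "b \<in> ?S2"
      and lim: "((\<lambda>h. (T (of_real h * a) x - x) /\<^sub>R h) \<longlongrightarrow> y) (at_right 0)" for a b x y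
  proof -
    let ?f = "\<lambda>s. (b / a) *\<^sub>C T (complex_of_real s * b) y"
    have a0: "a \<noteq> 0" using a by (simp add: sector_def)
    have cont_f: "continuous_on {0..} ?f" by (intro continuous_intros cont b)
    have "integral {0..h} ?f = T (of_real h * b) x - x" if h: "0 < h" for h
    proof (rule integral_unique)
      have "(?f has_integral T (of_real h * b) x - T (of_real 0 * b) x) {0..h}"
      proof (rule fundamental_theorem_of_calculus_interior)
        show "continuous_on {0..h} (\<lambda>t. T (complex_of_real t * b) x)"
          by (rule continuous_on_subset[OF cont[OF b]]) auto
        fix s assume "s \<in> {0<..<h}"
        then have s: "of_real s * b \<in> ?S" using sector_scale[OF b, of s] sub by auto
        have "a *\<^sub>C E (of_real s * b) x = T (of_real s * b) y"
          using a sub by (intro E_eq s lim) auto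
        then have "b *\<^sub>C E (of_real s * b) x = ?f s"
          using a0 by (metis nonzero_eq_divide_eq scaleC_scaleC)
        then show "((\<lambda>t. T (complex_of_real t * b) x) has_vector_derivative ?f s) (at s)"
          using ray_deriv[of 0 s b x UNIV] s by simp
      qed (use h in simp)
      then show "(?f has_integral T (of_real h * b) x - x) {0..h}" by (simp add: T_0)
    qed
    then have ev: "\<forall>\<^sub>F h in at_right 0. integral {0..0 + h} ?f /\<^sub>R h = (T (of_real h * b) x - x) /\<^sub>R h"
      using eventually_at_right_less[of 0] by (auto elim: eventually_mono)
    have "((\<lambda>h. integral {0..0 + h} ?f /\<^sub>R h) \<longlongrightarrow> ?f 0) (at_right 0)"
      by (rule integral_average_tendsto[of 1]) (auto intro: continuous_on_subset[OF cont_f])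
    from Lim_transform_eventually[OF this ev] show ?thesis by (simp add: T_0)
  qed
  have gen_b: "is_generator (\<lambda>t. T (complex_of_real t * b)) D (\<lambda>x. b *\<^sub>C A x)" if b: "b \<in> ?S2" for b
  proof -
    have one: "1 \<in> ?S2" using \<delta> by (intro one_in_sector) simp
    have lim1: "((\<lambda>h. (T (of_real h * b) x - x) /\<^sub>R h) \<longlongrightarrow> b *\<^sub>C A x) (at_right 0)" if "x \<in> D" for x
      using switch[OF one b, of x "A x"] gen that by (simp add: is_generator_def)
    moreover have "x \<in> D" if "((\<lambda>h. (T (of_real h * b) x - x) /\<^sub>R h) \<longlongrightarrow> y) (at_right 0)" for x y
      using switch[OF b one that] gen by (auto simp: is_generator_def)
    ultimately show ?thesis unfolding is_generator_def by blast
  qed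
  \<comment> \<open>The closed sector of angle \<open>\<delta> / 2\<close> cut at radius 1, with its
    vertex: compact, and apart from 0 contained in \<open>?S1\<close>, where the limit at 0 is
    known. Strong continuity on \<open>K\<close> makes uniform boundedness applicable.\<close>
  define K where "K = {w. cos (\<delta> / 2) * cmod w \<le> Re w} \<inter> cball 0 1"
  have "compact K" unfolding K_def
    by (intro closed_Int_compact closed_Collect_le compact_cball continuous_intros)
  have K_sub: "K - {0} \<subseteq> ?S1"
  proof
    fix w assume w: "w \<in> K - {0}"
    have "cos (3 * \<delta> / 4) < cos (\<delta> / 2)" using \<delta> by (intro cos_monotone_0_pi) auto
    then have "cos (3 * \<delta> / 4) * cmod w < cos (\<delta> / 2) * cmod w" using w by simp
    also have "\<dots> \<le> Re w" using w by (simp add: K_def)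
    finally show "w \<in> ?S1" using \<delta> by (subst sector_eq) auto
  qed
  have "continuous_on K (\<lambda>w. T w x)" for x
    unfolding continuous_on_def
  proof
    fix w assume w: "w \<in> K"
    show "((\<lambda>w. T w x) \<longlongrightarrow> T w x) (at w within K)"
    proof (cases "w = 0")
      case True
      have "((\<lambda>w. T w x) \<longlongrightarrow> x) (at 0 within K - {0})"
        by (rule tendsto_within_subset[OF lim0 K_sub])
      then show ?thesis using True by (simp add: T_0 at_within_def)
    next
      case False
      then have "w \<in> ?S" using K_sub sub w by blast
      from has_derivative_continuous[OF E[OF this]]
      have "((\<lambda>w. T w) \<longlongrightarrow> T w) (at w within K)"
        by (simp add: continuous_at_imp_continuous_at_within continuous_within[symmetric])
      then show ?thesis by (intro blinfun.tendsto tendsto_const)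
    qed
  qed
  then have "bounded ((\<lambda>B. blinfun_apply B x) ` T ` K)" for x
    unfolding image_image by (intro compact_imp_bounded compact_continuous_image \<open>compact K\<close>)
  then obtain M where M: "\<forall>B\<in>T ` K. norm B \<le> M" by (rule uniform_boundedness) blast
  have "norm (T (of_real t * z)) \<le> M" if z: "z \<in> ?S2" "cmod z = 1" and t: "t \<in> {0..1}" for z t
  proof -
    have "cos (\<delta> / 2) < Re z" using z \<delta> by (subst (asm) sector_eq) auto
    then have "of_real t * z \<in> K"
      using t z by (auto simp: K_def norm_mult mult.commute[of _ t] intro!: mult_left_mono)
    then show ?thesis using M by blast
  qed
  then show ?thesis
    unfolding generates_le_def using C0 gen_b by (intro exI[of _ M]) blast
qed

section \<open>From semigroups on rays to an analytic semigroup\<close>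

lemma blinfun_eq_on_dense:
  fixes S T :: "'a::real_normed_vector \<Rightarrow>\<^sub>L 'b::real_normed_vector"
  assumes "closure D = UNIV" "\<And>x. x \<in> D \<Longrightarrow> S x = T x"
  shows "S = T"
proof (rule blinfun_eqI)
  fix x
  have "D \<subseteq> {x. S x = T x}" using assms(2) by blast
  moreover have "closed {x. S x = T x}" by (intro closed_Collect_eq continuous_intros)
  ultimately have "closure D \<subseteq> {x. S x = T x}" by (rule closure_minimal)
  then show "S x = T x" using assms(1) by blast
qed

lemma unit_interval_mean_value:
  fixes \<phi> :: "real \<Rightarrow> 'a::real_normed_vector"
  assumes \<phi>: "\<And>s. s \<in> {0..1} \<Longrightarrow> (\<phi> has_vector_derivative \<phi>' s) (at s within {0..1})"
    and b: "\<And>s. s \<in> {0..1} \<Longrightarrow> norm (\<phi>' s - v) \<le> b"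
  shows "norm (\<phi> 1 - \<phi> 0 - v) \<le> b"
proof -
  have "((\<lambda>s. \<phi> s - s *\<^sub>R v) has_derivative (\<lambda>h. h *\<^sub>R (\<phi>' s - v))) (at s within {0..1})"
    if "s \<in> {0..1}" for s
    using \<phi>[OF that] unfolding has_vector_derivative_def
    by (auto intro!: derivative_eq_intros simp: scaleR_diff_right)
  moreover have "onorm (\<lambda>h::real. h *\<^sub>R (\<phi>' s - v)) \<le> b" if "s \<in> {0..1}" for s
  proof (rule onorm_le)
    show "norm (h *\<^sub>R (\<phi>' s - v)) \<le> b * norm h" for h :: real
      using mult_left_mono[OF b[OF that] abs_ge_zero[of h]] by (simp add: mult.commute)
  qed
  ultimately have "norm ((\<phi> 1 - 1 *\<^sub>R v) - (\<phi> 0 - 0 *\<^sub>R v)) \<le> b * norm (1 - 0 :: real)"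
    by (intro differentiable_bound[of "{0..1}"]) auto
  then show ?thesis by (simp add: algebra_simps)
qed

text \<open>For the converse, the estimate behind everything is obtained by differentiating
  \<open>s \<mapsto> U ((1 - s) z) (U (s w) x)\<close>, which runs from \<open>U z x\<close> to \<open>U w x\<close>: the derivative is
  \<open>U ((1 - s) z) (U (s w) ((w - z) A x))\<close>, because all rays have the same generator up to a factor.\<close>

locale sectorial_family =
  fixes U :: "complex \<Rightarrow> 'a::complex_banach \<Rightarrow>\<^sub>L 'a" and D :: "'a set" and A :: "'a \<Rightarrow> 'a"
    and \<delta> M :: real
  assumes \<delta>: "0 < \<delta>" "\<delta> \<le> pi / 2"
    and ray: "w \<in> sector \<delta> \<Longrightarrow> C0_generator (\<lambda>t. U (complex_of_real t * w)) D (\<lambda>x. w *\<^sub>C A x)"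
    and bound: "w \<in> sector \<delta> \<Longrightarrow> cmod w \<le> 1 \<Longrightarrow> norm (U w) \<le> M"
begin

abbreviation "S \<equiv> sector \<delta>"

lemma S_scale: "w \<in> S \<Longrightarrow> 0 < r \<Longrightarrow> complex_of_real r * w \<in> S"
  by (rule sector_scale)

lemma S_scale0: "w \<in> insert 0 S \<Longrightarrow> 0 \<le> r \<Longrightarrow> complex_of_real r * w \<in> insert 0 S"
  using S_scale[of w r] by (cases "r = 0") auto

lemma S_add: "w \<in> S \<Longrightarrow> z \<in> S \<Longrightarrow> w + z \<in> S"
  using sector_add[OF \<delta>] by blast

lemma S_open: "open S"
  using \<delta> by (intro open_sector) auto

lemma one: "1 \<in> S"
  by (rule one_in_sector[OF \<delta>(1)])

lemma U_zero: "U 0 x = x"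
  using C0_generator.T_zero[OF ray[OF one], of x] by simp

lemma gen1: "C0_generator (\<lambda>t. U (complex_of_real t)) D A"
  using ray[OF one] by simp

lemma linear: "linear_operator D A"
  by (rule C0_generator.linear[OF gen1])

lemma dense: "closure D = UNIV"
  by (rule C0_generator.dense[OF gen1])

lemmas lin = linear_operatorD[OF linear]

lemma ray_add:
  assumes "w \<in> insert 0 S" "0 \<le> s" "0 \<le> t"
  shows "U (complex_of_real (s + t) * w) x = U (complex_of_real s * w) (U (complex_of_real t * w) x)"
proof (cases "w = 0")
  case False
  then show ?thesis using assms C0_generator.T_add[OF ray, of w s t x] by simp
qed (simp add: U_zero)

text \<open>\<open>U (n w)\<close> is the \<open>n\<close>-th power of \<open>U w\<close>, so the
  bound on the unit disc spreads to radius \<open>R\<close> by writing \<open>w\<close> as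
  \<open>n\<close> times \<open>w / n\<close>. Taking \<open>c\<close> at least 1 also covers the
  identity at 0.\<close>

lemma U_bounded:
  obtains N where "1 \<le> N" "\<forall>w\<in>insert 0 S. cmod w \<le> R \<longrightarrow> norm (U w) \<le> N"
proof -
  define c where "c = max 1 M"
  have c: "1 \<le> c" "M \<le> c" by (simp_all add: c_def)
  have pow: "norm (U (of_nat n * w)) \<le> c ^ n" if w: "w \<in> S" "cmod w \<le> 1" for n w
  proof (induction n)
    case 0
    have "U 0 = id_blinfun" by (rule blinfun_eqI) (simp add: U_zero)
    then show ?case by (simp add: norm_blinfun_id_le)
  next
    case (Suc n)
    have "U (of_nat (Suc n) * w) = U w o\<^sub>L U (of_nat n * w)"
      by (rule blinfun_eqI) (use ray_add[of w 1 "real n"] w in \<open>simp add: algebra_simps\<close>)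
    then have "norm (U (of_nat (Suc n) * w)) \<le> norm (U w) * norm (U (of_nat n * w))"
      by (simp add: norm_blinfun_compose)
    also have "\<dots> \<le> c * c ^ n"
      using bound[OF w] c Suc by (intro mult_mono) auto
    finally show ?case by simp
  qed
  obtain n :: nat where n: "max R 1 \<le> real n" using real_arch_simple by blast
  have "norm (U w) \<le> c ^ n" if w: "w \<in> insert 0 S" "cmod w \<le> R" for w
  proof (cases "w = 0")
    case True
    have "U 0 = id_blinfun" by (rule blinfun_eqI) (simp add: U_zero)
    then show ?thesis using True norm_blinfun_id_le[where 'a = 'a] one_le_power[OF c(1), of n] by simp
  next
    case False
    have "complex_of_real (inverse n) * w \<in> S" using False w n by (intro S_scale) auto
    moreover have "cmod (complex_of_real (inverse n) * w) \<le> 1"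
      using w n by (auto simp: norm_mult norm_inverse norm_divide divide_simps)
    moreover have "of_nat n * (complex_of_real (inverse n) * w) = w" using n by simp
    ultimately show ?thesis using pow[of "complex_of_real (inverse n) * w" n] by metis
  qed
  then show thesis using that[of "c ^ n"] one_le_power[OF c(1), of n] by blast
qed

lemma U_generator:
  assumes "x \<in> D" "w \<in> insert 0 S"
  shows "U w x \<in> D" "A (U w x) = U w (A x)"
proof -
  have "U w x \<in> D \<and> A (U w x) = U w (A x)"
  proof (cases "w = 0")
    case False
    then have w: "w \<in> S" using assms by blast
    interpret C0_generator "\<lambda>t. U (complex_of_real t * w)" D "\<lambda>x. w *\<^sub>C A x" by (rule ray[OF w])
    have "w *\<^sub>C A (U w x) = w *\<^sub>C U w (A x)"
      using T_generator(2)[OF assms(1), of 1] T_scaleC[of 1 w "A x"] by simp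
    then have "inverse w *\<^sub>C w *\<^sub>C A (U w x) = inverse w *\<^sub>C w *\<^sub>C U w (A x)" by simp
    then show ?thesis using T_generator(1)[OF assms(1), of 1] False by (simp add: scaleC_scaleC)
  qed (simp add: U_zero assms)
  then show "U w x \<in> D" "A (U w x) = U w (A x)" by blast+
qed

lemma U_scaleC: "w \<in> insert 0 S \<Longrightarrow> U w (c *\<^sub>C x) = c *\<^sub>C U w x"
  using C0_generator.T_scaleC[OF ray, of w 1 c x] by (cases "w = 0") (auto simp: U_zero)

lemma ray_derivative:
  assumes x: "x \<in> D" and w: "w \<in> insert 0 S" and t: "0 \<le> t"
  shows "((\<lambda>t. U (complex_of_real t * w) x) has_vector_derivative w *\<^sub>C U (complex_of_real t * w) (A x))
    (at t within {0..})"
proof (cases "w = 0")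
  case False
  then have w': "w \<in> S" using w by blast
  interpret C0_generator "\<lambda>t. U (complex_of_real t * w)" D "\<lambda>x. w *\<^sub>C A x" by (rule ray[OF w'])
  show ?thesis using orbit_derivative[OF x t] T_scaleC[OF t] by simp
qed simp

text \<open>The vector \<open>v\<close> is left free for two uses: \<open>v = 0\<close> gives
  Lipschitz estimates on the domain, and the first-order term
  \<open>(w - z) *\<^sub>C U z (A x)\<close> gives complex derivatives.\<close>

lemma interpolate:
  assumes x: "x \<in> D" and z: "z \<in> insert 0 S" and w: "w \<in> insert 0 S"
    and b: "\<And>s. s \<in> {0..1} \<Longrightarrow>
      norm (U (complex_of_real (1 - s) * z) (U (complex_of_real s * w) ((w - z) *\<^sub>C A x)) - v) \<le> b"
  shows "norm (U w x - U z x - v) \<le> b"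
proof -
  define \<phi> where "\<phi> s = U (complex_of_real (1 - s) * z) (U (complex_of_real s * w) x)" for s
  have y: "((\<lambda>t. U (complex_of_real t * w) x) has_vector_derivative w *\<^sub>C U (complex_of_real s * w) (A x))
      (at s within {0..1})" if "s \<in> {0..1}" for s
    using that by (intro has_vector_derivative_within_subset[OF ray_derivative[OF x w]]) auto
  have "(\<phi> has_vector_derivative
      U (complex_of_real (1 - s) * z) (U (complex_of_real s * w) ((w - z) *\<^sub>C A x))) (at s within {0..1})"
    if s: "s \<in> {0..1}" for s
  \<comment> \<open>The origin lies on no ray of the sector; there the outer factor is the identity
    throughout.\<close>
  proof (cases "z = 0")
    case True
    have "complex_of_real s * w \<in> insert 0 S" using S_scale0[OF w, of s] s by auto
    from U_scaleC[OF this] show ?thesis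
      using y[OF s] True by (simp add: \<phi>_def[abs_def] U_zero)
  next
    case False
    then have z': "z \<in> S" using z by blast
    interpret C0_generator "\<lambda>t. U (complex_of_real t * z)" D "\<lambda>x. z *\<^sub>C A x" by (rule ray[OF z'])
    have sw: "complex_of_real s * w \<in> insert 0 S" "complex_of_real (1 - s) * z \<in> insert 0 S"
      using S_scale0[OF w, of s] S_scale0[OF z, of "1 - s"] s by auto
    have "((\<lambda>s. 1 - s) has_vector_derivative - 1) (at s within {0..1::real})"
      by (auto intro!: derivative_eq_intros)
    from product_derivative[OF y[OF s] U_generator(1)[OF x sw(1)] this _ s]
    have "(\<phi> has_vector_derivative
        U (complex_of_real (1 - s) * z) (w *\<^sub>C U (complex_of_real s * w) (A x)) +
        - 1 *\<^sub>R U (complex_of_real (1 - s) * z) (z *\<^sub>C A (U (complex_of_real s * w) x))) (at s within {0..1})"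
      by (simp add: \<phi>_def[abs_def])
    then show ?thesis
      by (simp add: U_generator(2)[OF x sw(1)] U_scaleC[OF sw(1)] U_scaleC[OF sw(2)] scaleC.diff_left
          blinfun.diff_right del: of_real_diff)
  qed
  from unit_interval_mean_value[OF this b] show ?thesis by (simp add: \<phi>_def U_zero)
qed

lemma U_lipschitz:
  assumes x: "x \<in> D" and z: "z \<in> insert 0 S" and w: "w \<in> insert 0 S"
    and N: "\<forall>w\<in>insert 0 S. cmod w \<le> R \<longrightarrow> norm (U w) \<le> N" "1 \<le> N" and R: "cmod z \<le> R" "cmod w \<le> R"
  shows "norm (U w x - U z x) \<le> N * (N * (cmod (w - z) * norm (A x)))"
proof -
  have "norm (U w x - U z x - 0) \<le> N * (N * (cmod (w - z) * norm (A x)))"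
  proof (rule interpolate[OF x z w])
    fix s :: real assume s: "s \<in> {0..1}"
    have "cmod (complex_of_real (1 - s) * z) \<le> R" "cmod (complex_of_real s * w) \<le> R"
      using s R mult_left_le_one_le[of "cmod z" "1 - s"] mult_left_le_one_le[of "cmod w" s]
      by (auto simp: norm_mult simp del: of_real_diff intro: order_trans)
    then have "norm (U (complex_of_real (1 - s) * z)) \<le> N" "norm (U (complex_of_real s * w)) \<le> N"
      using N S_scale0[OF z, of "1 - s"] S_scale0[OF w, of s] s by auto
    then have "norm (U (complex_of_real (1 - s) * z) y) \<le> N * norm y" "norm (U (complex_of_real s * w) y) \<le> N * norm y"
      for y by (meson mult_right_mono norm_blinfun norm_ge_zero order_trans)+
    then show "norm (U (complex_of_real (1 - s) * z) (U (complex_of_real s * w) ((w - z) *\<^sub>C A x)) - 0)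
        \<le> N * (N * (cmod (w - z) * norm (A x)))"
      using N(2) by (smt (verit, best) diff_zero mult_left_mono norm_scaleC)
  qed
  then show ?thesis by simp
qed

lemma U_uniformly_continuous:
  assumes e: "0 < e"
  obtains d where "0 < d"
    "\<forall>z\<in>insert 0 S. \<forall>w\<in>insert 0 S. cmod z \<le> R \<longrightarrow> cmod w \<le> R \<longrightarrow> cmod (w - z) < d \<longrightarrow>
      norm (U w y - U z y) < e"
proof -
  obtain N where N: "1 \<le> N" "\<forall>w\<in>insert 0 S. cmod w \<le> R \<longrightarrow> norm (U w) \<le> N" by (rule U_bounded)
  have "y \<in> closure D" by (simp add: dense)
  moreover have "0 < e / (4 * N)" using e N by simp
  ultimately obtain x where x: "x \<in> D" "dist x y < e / (4 * N)"
    unfolding closure_approachable by blast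
  \<comment> \<open>\<open>N * (N * norm (A x))\<close> is the Lipschitz constant of the orbit of
    \<open>x\<close>, and the 1 keeps \<open>k\<close> positive. Half of \<open>e\<close> goes to
    \<open>x\<close>, a quarter to each error made by replacing \<open>y\<close> with
    \<open>x\<close>.\<close>
  define k where "k = N * (N * (norm (A x) + 1))"
  have pos: "0 < k" unfolding k_def using N by (simp add: add_nonneg_pos)
  define d where "d = e / (2 * k)"
  have d: "0 < d" unfolding d_def using e pos by simp
  have "norm (U w y - U z y) < e"
    if z: "z \<in> insert 0 S" "cmod z \<le> R" and w: "w \<in> insert 0 S" "cmod w \<le> R" and wz: "cmod (w - z) < d" for z w
  proof -
    have near: "norm (U u (y - x)) < e / 4" if "u \<in> insert 0 S" "cmod u \<le> R" for u
    proof -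
      have "norm (U u (y - x)) \<le> N * norm (y - x)"
        using N that by (meson mult_right_mono norm_blinfun norm_ge_zero order_trans)
      also have "\<dots> < N * (e / (4 * N))"
        using x N by (intro mult_strict_left_mono) (auto simp: dist_norm norm_minus_commute)
      also have "\<dots> = e / 4" using N by simp
      finally show ?thesis .
    qed
    have "norm (U w x - U z x) \<le> cmod (w - z) * (N * (N * norm (A x)))"
      using U_lipschitz[OF x(1) z(1) w(1) N(2,1) z(2) w(2)] by (simp add: mult_ac)
    also have "\<dots> \<le> d * k"
      unfolding k_def using wz N d by (intro mult_mono) auto
    also have "\<dots> = e / 2" unfolding d_def using pos by simp
    finally have "norm (U w x - U z x) \<le> e / 2" .
    moreover have "U w y - U z y = (U w x - U z x) + (U w (y - x) - U z (y - x))"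
      by (simp add: blinfun.diff_right)
    moreover have "norm (U w (y - x) - U z (y - x)) < e / 4 + e / 4"
      using near[OF w] near[OF z] norm_triangle_ineq4[of "U w (y - x)" "U z (y - x)"] by linarith
    ultimately show ?thesis
      using norm_triangle_ineq[of "U w x - U z x" "U w (y - x) - U z (y - x)"] by simp
  qed
  then show thesis using that[OF d] by blast
qed

lemma U_tendsto:
  assumes f: "(f \<longlongrightarrow> z) F" and fS: "\<forall>\<^sub>F s in F. f s \<in> insert 0 S" and z: "z \<in> insert 0 S"
    and g: "(g \<longlongrightarrow> y) F"
  shows "((\<lambda>s. U (f s) (g s)) \<longlongrightarrow> U z y) F"
proof -
  define R where "R = cmod z + 1"
  obtain N where N: "1 \<le> N" "\<forall>w\<in>insert 0 S. cmod w \<le> R \<longrightarrow> norm (U w) \<le> N" by (rule U_bounded)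
  have fR: "\<forall>\<^sub>F s in F. cmod (f s) < R"
    using order_tendstoD(2)[OF tendsto_norm[OF f], of R] by (simp add: R_def)
  have "((\<lambda>s. U (f s) (g s - y)) \<longlongrightarrow> 0) F"
  proof (rule Lim_null_comparison)
    show "\<forall>\<^sub>F s in F. norm (U (f s) (g s - y)) \<le> N * norm (g s - y)"
      using fS fR
    proof eventually_elim
      case (elim s)
      then have "norm (U (f s)) \<le> N" using N by auto
      then show ?case by (meson mult_right_mono norm_blinfun norm_ge_zero order_trans)
    qed
    show "((\<lambda>s. N * norm (g s - y)) \<longlongrightarrow> 0) F" using g by (auto intro!: tendsto_eq_intros)
  qed
  moreover have "((\<lambda>s. U (f s) y) \<longlongrightarrow> U z y) F"
  proof (rule tendstoI)
    fix e :: real assume "0 < e"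
    then obtain d where d: "0 < d" "\<forall>z\<in>insert 0 S. \<forall>w\<in>insert 0 S. cmod z \<le> R \<longrightarrow> cmod w \<le> R \<longrightarrow>
        cmod (w - z) < d \<longrightarrow> norm (U w y - U z y) < e"
      by (rule U_uniformly_continuous)
    have "\<forall>\<^sub>F s in F. dist (f s) z < d" using f d(1) by (rule tendstoD)
    with fS fR show "\<forall>\<^sub>F s in F. dist (U (f s) y) (U z y) < e"
    proof eventually_elim
      case (elim s)
      then show ?case using d(2)[rule_format, OF z elim(1)] by (simp add: dist_norm R_def)
    qed
  qed
  ultimately have "((\<lambda>s. U (f s) (g s - y) + U (f s) y) \<longlongrightarrow> 0 + U z y) F" by (rule tendsto_add)
  then show ?thesis by (simp add: blinfun.diff_right)
qed

text \<open>Factoring \<open>U z\<close> along its ray into \<open>U ((1 - s) z)\<close> and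
  \<open>U (s z)\<close> cancels the first-order term and leaves the difference of \<open>U\<close>
  at \<open>s w\<close> and \<open>s z\<close>, applied to \<open>A x\<close>. Continuity makes this
  small; a Lipschitz bound makes the whole error quadratic.\<close>

lemma interpolate_linearised:
  assumes x: "x \<in> D" and z: "z \<in> insert 0 S" and w: "w \<in> insert 0 S"
    and N: "\<forall>w\<in>insert 0 S. cmod w \<le> R \<longrightarrow> norm (U w) \<le> N" "1 \<le> N" and R: "cmod z \<le> R"
    and e: "\<And>s. s \<in> {0..1} \<Longrightarrow>
      norm (U (complex_of_real s * w) (A x) - U (complex_of_real s * z) (A x)) \<le> e"
  shows "norm (U w x - U z x - (w - z) *\<^sub>C U z (A x)) \<le> cmod (w - z) * (N * e)"
proof (rule interpolate[OF x z w])
  fix s :: real assume s: "s \<in> {0..1}"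
  let ?sw = "complex_of_real s * w" and ?sz = "complex_of_real s * z"
    and ?tz = "complex_of_real (1 - s) * z"
  have S: "?sw \<in> insert 0 S" "?tz \<in> insert 0 S"
    using S_scale0[OF w, of s] S_scale0[OF z, of "1 - s"] s by auto
  have "cmod ?tz \<le> R"
    using s R mult_left_le_one_le[of "cmod z" "1 - s"] by (auto simp: norm_mult simp del: of_real_diff)
  then have "norm (U ?tz) \<le> N" using N S by blast
  then have "norm (U ?tz (U ?sw (A x) - U ?sz (A x))) \<le> N * e"
    using e[OF s] N(2) by (intro order_trans[OF norm_blinfun] mult_mono) auto
  then have "norm ((w - z) *\<^sub>C U ?tz (U ?sw (A x) - U ?sz (A x))) \<le> cmod (w - z) * (N * e)"
    by (simp add: norm_scaleC mult_left_mono)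
  moreover have "U z (A x) = U ?tz (U ?sz (A x))"
    using ray_add[OF z, of "1 - s" s "A x"] s by simp
  ultimately show "norm (U ?tz (U ?sw ((w - z) *\<^sub>C A x)) - (w - z) *\<^sub>C U z (A x)) \<le> cmod (w - z) * (N * e)"
    by (simp add: U_scaleC[OF S(1)] U_scaleC[OF S(2)] blinfun.diff_right scaleC.diff_right del: of_real_diff)
qed

lemma U_complex_derivative:
  assumes x: "x \<in> D" and z: "z \<in> S"
  shows "((\<lambda>w. U w x) has_derivative (\<lambda>h. h *\<^sub>C U z (A x))) (at z)"
  unfolding complex_derivative_iff_quotient[symmetric]
proof (rule tendstoI)
  fix e :: real assume e: "0 < e"
  define R where "R = cmod z + 1"
  obtain N where N: "1 \<le> N" "\<forall>w\<in>insert 0 S. cmod w \<le> R \<longrightarrow> norm (U w) \<le> N" by (rule U_bounded)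
  have "0 < e / (2 * N)" using e N by simp
  then obtain d where d: "0 < d" "\<forall>z\<in>insert 0 S. \<forall>w\<in>insert 0 S. cmod z \<le> R \<longrightarrow> cmod w \<le> R \<longrightarrow>
      cmod (w - z) < d \<longrightarrow> norm (U w (A x) - U z (A x)) < e / (2 * N)"
    by (rule U_uniformly_continuous)
  have "\<forall>\<^sub>F w in at z. w \<in> S" using S_open z by (rule eventually_at_in_open')
  moreover have "\<forall>\<^sub>F w in at z. dist w z < min d 1"
    using d(1) by (intro tendstoD[OF tendsto_ident_at]) auto
  moreover have "\<forall>\<^sub>F w in at z. w \<noteq> z" by (simp add: eventually_at_filter)
  ultimately show "\<forall>\<^sub>F w in at z. dist (inverse (w - z) *\<^sub>C (U w x - U z x)) (U z (A x)) < e"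
  proof eventually_elim
    case (elim w)
    have wd: "cmod (w - z) < d" and w1: "cmod (w - z) < 1" using elim by (auto simp: dist_norm)
    have wR: "cmod w \<le> R" using norm_triangle_ineq2[of w z] w1 by (simp add: R_def)
    have "norm (U w x - U z x - (w - z) *\<^sub>C U z (A x)) \<le> cmod (w - z) * (N * (e / (2 * N)))"
    proof (rule interpolate_linearised[OF x _ _ N(2,1)])
      fix s :: real assume s: "s \<in> {0..1}"
      let ?sw = "complex_of_real s * w" and ?sz = "complex_of_real s * z"
      have S: "?sw \<in> insert 0 S" "?sz \<in> insert 0 S"
        using S_scale0[of w s] S_scale0[of z s] s elim z by auto
      have R: "cmod ?sw \<le> R" "cmod ?sz \<le> R"
        using s wR mult_left_le_one_le[of "cmod w" s] mult_left_le_one_le[of "cmod z" s]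
        by (auto simp: norm_mult R_def)
      have "cmod (?sw - ?sz) = s * cmod (w - z)"
        using s by (simp add: norm_mult flip: right_diff_distrib)
      also have "\<dots> < d" using s wd mult_left_le_one_le[of "cmod (w - z)" s] by auto
      finally show "norm (U ?sw (A x) - U ?sz (A x)) \<le> e / (2 * N)"
        using d(2) S R by (blast intro: less_imp_le)
    qed (use z elim in \<open>auto simp: R_def\<close>)
    also have "N * (e / (2 * N)) = e / 2" using N by simp
    finally have "norm (U w x - U z x - (w - z) *\<^sub>C U z (A x)) \<le> cmod (w - z) * (e / 2)" .
    moreover have "inverse (w - z) *\<^sub>C (U w x - U z x) - U z (A x)
        = inverse (w - z) *\<^sub>C (U w x - U z x - (w - z) *\<^sub>C U z (A x))"
      using elim by (simp add: scaleC.diff_right scaleC_scaleC)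
    ultimately have "norm (inverse (w - z) *\<^sub>C (U w x - U z x) - U z (A x)) \<le> inverse (cmod (w - z)) * (cmod (w - z) * (e / 2))"
      by (simp only: norm_scaleC norm_inverse) (intro mult_left_mono; simp)
    also have "\<dots> < e" using elim e by simp
    finally show ?case by (simp add: dist_norm)
  qed
qed

text \<open>The locale gives the semigroup law along single rays. For two rays,
  \<open>s \<mapsto> U (z + (1 - s) w) (U (s w) x)\<close> runs from \<open>U (z + w) x\<close> to
  \<open>U z (U w x)\<close> with derivative 0.\<close>

lemma U_add:
  assumes z: "z \<in> S" and w: "w \<in> S"
  shows "U (z + w) = U z o\<^sub>L U w"
proof (rule blinfun_eq_on_dense[OF dense])
  fix x assume x: "x \<in> D"
  define p where "p s = z + complex_of_real (1 - s) * w" for s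
  define y where "y s = U (complex_of_real s * w) x" for s
  have pS: "p s \<in> S" if "s \<in> {0..1}" for s
    using S_add[OF z S_scale[OF w, of "1 - s"]] that z by (cases "s = 1") (auto simp: p_def)
  have "((\<lambda>s. U (p s) (y s)) has_vector_derivative 0) (at s within {0..1})" if s: "s \<in> {0..1}" for s
  proof -
    have sw: "complex_of_real s * w \<in> insert 0 S" using S_scale0[of w s] w s by auto
    have ys: "y s \<in> D" "A (y s) = U (complex_of_real s * w) (A x)"
      unfolding y_def using U_generator[OF x sw] by auto
    have y': "(y has_vector_derivative w *\<^sub>C A (y s)) (at s within {0..1})"
      unfolding ys(2) unfolding y_def[abs_def]
      using w s by (intro has_vector_derivative_within_subset[OF ray_derivative[OF x]]) auto
    have p': "(p has_vector_derivative - w) (at s within {0..1})"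
      unfolding p_def by (auto intro!: derivative_eq_intros)
    have "((\<lambda>u. U (p u) (y s)) has_vector_derivative (- w) *\<^sub>C U (p s) (A (y s))) (at s within {0..1})"
      by (rule complex_derivative_chain[OF U_complex_derivative[OF ys(1) pS[OF s]] p'])
    then have "((\<lambda>u. (U (p u) (y s) - U (p s) (y s)) /\<^sub>R (u - s)) \<longlongrightarrow> (- w) *\<^sub>C U (p s) (A (y s))) (at s within {0..1})"
      by (simp add: has_vector_derivative_iff_quotient)
    moreover have "((\<lambda>u. U (p u) ((y u - y s) /\<^sub>R (u - s))) \<longlongrightarrow> U (p s) (w *\<^sub>C A (y s))) (at s within {0..1})"
    proof (rule U_tendsto)
      show "(p \<longlongrightarrow> p s) (at s within {0..1})"
        using has_vector_derivative_continuous[OF p'] by (simp add: continuous_within)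
      show "\<forall>\<^sub>F u in at s within {0..1}. p u \<in> insert 0 S"
        using pS by (auto simp: eventually_at_filter)
    qed (use y' pS[OF s] in \<open>auto simp: has_vector_derivative_iff_quotient\<close>)
    ultimately have "((\<lambda>u. (U (p u) (y s) - U (p s) (y s)) /\<^sub>R (u - s) + U (p u) ((y u - y s) /\<^sub>R (u - s)))
        \<longlongrightarrow> (- w) *\<^sub>C U (p s) (A (y s)) + U (p s) (w *\<^sub>C A (y s))) (at s within {0..1})"
      by (rule tendsto_add)
    then show ?thesis
      using pS[OF s] unfolding has_vector_derivative_iff_quotient
      by (simp add: blinfun.scaleR_right blinfun.diff_right U_scaleC scaleC.minus_left flip: scaleR_add_right)
  qed
  from unit_interval_mean_value[OF this, of 0 0] have "U (p 1) (y 1) = U (p 0) (y 0)" by simp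
  then show "U (z + w) x = (U z o\<^sub>L U w) x"
    by (simp add: p_def y_def U_zero)
qed

end

context sectorial_family
begin

text \<open>\<open>U z (A x)\<close> is the complex derivative of \<open>w \<mapsto> U w x\<close>
  at \<open>z\<close>, so Cauchy's estimate bounds it by \<open>norm x\<close> instead of
  \<open>norm (A x)\<close>.\<close>

lemma generator_U_norm_le:
  assumes x: "x \<in> D" and r: "0 < r" "cball z r \<subseteq> S" and N: "\<And>w. w \<in> cball z r \<Longrightarrow> norm (U w) \<le> N"
  shows "norm (U z (A x)) \<le> N / r * norm x"
proof -
  have "norm (U z (A x)) \<le> (N * norm x) / r"
  proof (rule Cauchy_estimate[where f = "\<lambda>w. U w x", OF r(1) U_complex_derivative[OF x]])
    show "w \<in> S" if "w \<in> cball z r" for w using r that by blast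
    show "continuous_on (cball z r) (\<lambda>w. U w (A x))"
      unfolding continuous_on_def
    proof
      fix w assume w: "w \<in> cball z r"
      show "((\<lambda>w. U w (A x)) \<longlongrightarrow> U w (A x)) (at w within cball z r)"
        using r w by (intro U_tendsto tendsto_const tendsto_ident_at)
          (auto simp: eventually_at_filter intro!: always_eventually)
    qed
    show "norm (U w x) \<le> N * norm x" if "w \<in> cball z r" for w
      using N[OF that] by (auto intro!: order_trans[OF norm_blinfun] mult_right_mono)
  qed
  then show ?thesis by simp
qed

text \<open>The Cauchy bound makes \<open>U z (A (X n))\<close> converge when \<open>X n\<close> in
  the domain approximates an arbitrary \<open>x\<close>; closedness of \<open>A\<close> then puts
  \<open>U z x\<close> into the domain.\<close>

lemma U_smoothing:
  assumes z: "z \<in> S"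
  obtains c where "0 \<le> c" "\<And>x. U z x \<in> D" "\<And>x. norm (A (U z x)) \<le> c * norm x"
proof -
  obtain r where r: "0 < r" "cball z r \<subseteq> S"
    using S_open z by (auto simp: open_contains_cball)
  obtain N where N: "1 \<le> N" "\<forall>w\<in>insert 0 S. cmod w \<le> cmod z + r \<longrightarrow> norm (U w) \<le> N"
    by (rule U_bounded)
  have "norm (U w) \<le> N" if w: "w \<in> cball z r" for w
  proof -
    have "cmod w \<le> cmod z + r"
      using w norm_triangle_ineq2[of w z] by (simp add: dist_norm norm_minus_commute)
    then show ?thesis using N r w by blast
  qed
  note le = generator_U_norm_le[OF _ r this]
  define c where "c = N / r"
  have c: "0 \<le> c" using N r by (simp add: c_def)
  have "U z x \<in> D \<and> norm (A (U z x)) \<le> c * norm x" for x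
  proof -
    have "x \<in> closure D" by (simp add: dense)
    then obtain X where X: "\<And>n. X n \<in> D" "X \<longlonglongrightarrow> x" by (auto simp: closure_sequential)
    have "Cauchy (\<lambda>n. U z (A (X n)))"
    proof (rule metric_CauchyI)
      fix e :: real assume "0 < e"
      then have "0 < e / (c + 1)" using c by simp
      then obtain n0 where n0: "\<And>m n. n0 \<le> m \<Longrightarrow> n0 \<le> n \<Longrightarrow> dist (X m) (X n) < e / (c + 1)"
        using LIMSEQ_imp_Cauchy[OF X(2)] by (meson metric_CauchyD)
      have "dist (U z (A (X m))) (U z (A (X n))) < e" if "n0 \<le> m" "n0 \<le> n" for m n
      proof -
        have "dist (U z (A (X m))) (U z (A (X n))) = norm (U z (A (X m - X n)))"
          by (simp add: dist_norm lin X blinfun.diff_right)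
        also have "\<dots> \<le> c * norm (X m - X n)"
          unfolding c_def by (rule le[OF lin(3)[OF X(1) X(1)]])
        also have "\<dots> \<le> (c + 1) * dist (X m) (X n)"
          by (simp add: dist_norm mult_right_mono)
        also have "\<dots> < e" using n0[OF that] c by (simp add: pos_less_divide_eq mult.commute)
        finally show ?thesis .
      qed
      then show "\<exists>M. \<forall>m\<ge>M. \<forall>n\<ge>M. dist (U z (A (X m))) (U z (A (X n))) < e" by blast
    qed
    then obtain y where y: "(\<lambda>n. U z (A (X n))) \<longlonglongrightarrow> y" by (auto simp: Cauchy_convergent_iff convergent_def)
    have "(\<lambda>n. U z (X n)) \<longlonglongrightarrow> U z x" by (intro tendsto_intros X)
    moreover have "U z (X n) \<in> D" "A (U z (X n)) = U z (A (X n))" for n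
      using U_generator[OF X(1)] z by auto
    ultimately have "U z x \<in> D" "A (U z x) = y"
      using C0_generator.closed_graph_sequentially[OF gen1, of "\<lambda>n. U z (X n)"] y by auto
    moreover have "norm y \<le> c * norm x"
    proof (rule LIMSEQ_le[OF tendsto_norm[OF y] tendsto_mult[OF tendsto_const tendsto_norm[OF X(2)]]])
      show "\<exists>N. \<forall>n\<ge>N. norm (U z (A (X n))) \<le> c * norm (X n)"
        using le[OF X(1)] unfolding c_def by blast
    qed
    ultimately show ?thesis by simp
  qed
  then show thesis using that c by blast
qed

text \<open>Splitting off \<open>U (p / 2)\<close> turns the quadratic estimate for vectors in the domain of \<open>A\<^sup>2\<close>
  into one in the operator norm.\<close>

lemma U_holomorphic: "vector_holomorphic_on U S"
  unfolding vector_holomorphic_on_def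
proof
  fix p assume p: "p \<in> S"
  \<comment> \<open>With \<open>p = 4 h\<close>, each application of \<open>U h\<close> gains one
    power of \<open>A\<close>: \<open>y = U a x = U h (U h x)\<close> lies in the domain of
    \<open>A\<^sup>2\<close>, with \<open>norm (A (A y)) \<le> c * (c * norm x)\<close>.\<close>
  define a h where "a = complex_of_real (1 / 2) * p" and "h = complex_of_real (1 / 2) * a"
  have S: "a \<in> S" "h \<in> S" unfolding a_def h_def by (intro S_scale p; simp)+
  have p_eq: "p = a + a" and a_eq: "a = h + h" by (simp_all add: a_def h_def)
  obtain c where c: "0 \<le> c" "\<And>x. U h x \<in> D" "\<And>x. norm (A (U h x)) \<le> c * norm x"
    using U_smoothing[OF S(2)] by blast
  obtain c' where c': "0 \<le> c'" "\<And>x. U p x \<in> D" "\<And>x. norm (A (U p x)) \<le> c' * norm x"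
    using U_smoothing[OF p] by blast
  define R where "R = cmod a + 1"
  obtain N where N: "1 \<le> N" "\<forall>w\<in>insert 0 S. cmod w \<le> R \<longrightarrow> norm (U w) \<le> N" by (rule U_bounded)
  have E_lin: "bounded_linear (\<lambda>x. A (U p x))"
    by (rule bounded_linear_intro[where K = c'])
      (use c' in \<open>auto simp: blinfun.add_right blinfun.scaleR_right lin mult.commute\<close>)
  define E where "E = Blinfun (\<lambda>x. A (U p x))"
  have E: "E x = A (U p x)" for x by (simp add: E_def bounded_linear_Blinfun_apply[OF E_lin])
  have "((\<lambda>w. inverse (w - p) *\<^sub>C (U w - U p)) \<longlongrightarrow> E) (at p)"
  proof (rule LIM_zero_cancel, rule Lim_null_comparison)
    have "((\<lambda>w. w - a) \<longlongrightarrow> a) (at p)" by (auto intro!: tendsto_eq_intros simp: p_eq)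
    then have "\<forall>\<^sub>F w in at p. w - a \<in> S \<inter> ball a 1"
      by (rule topological_tendstoD) (use S S_open in auto)
    moreover have "\<forall>\<^sub>F w in at p. w \<noteq> p" by (simp add: eventually_at_filter)
    ultimately show "\<forall>\<^sub>F w in at p. norm (inverse (w - p) *\<^sub>C (U w - U p) - E)
        \<le> N * (N * (N * (c * c))) * cmod (w - p)"
    proof eventually_elim
      case (elim w)
      have wa: "w - a \<in> S" "cmod (w - a) \<le> R"
        using elim norm_triangle_ineq2[of "w - a" a] by (auto simp: R_def dist_norm norm_minus_commute)
      let ?K = "N * (N * (N * (c * c)))"
      have "norm (inverse (w - p) *\<^sub>C (U w - U p) - E) \<le> ?K * cmod (w - p)"
      proof (rule norm_blinfun_bound)
        show "0 \<le> ?K * cmod (w - p)" using N c by simp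
        fix x
        define y where "y = U a x"
        have y_eq: "y = U h (U h x)" using U_add[OF S(2) S(2)] by (simp add: y_def a_eq)
        have y: "y \<in> D" "A y = U h (A (U h x))" "A y \<in> D"
          using U_generator[OF c(2)] S c(2) by (auto simp: y_eq)
        have "norm (A (A y)) \<le> c * norm (A (U h x))" unfolding y(2) by (rule c(3))
        also have "\<dots> \<le> c * (c * norm x)" using c by (intro mult_left_mono)
        finally have AAy: "norm (A (A y)) \<le> c * (c * norm x)" .
        \<comment> \<open>\<open>U w x = U (w - a) y\<close> and \<open>U p x = U a y\<close>, so
          the linearised estimate is used at \<open>a\<close>. Since \<open>A y\<close> is in the
          domain, its error is Lipschitz in \<open>w - p\<close> and the total is of second
          order.\<close>
        have "norm (U (w - a) y - U a y - (w - a - a) *\<^sub>C U a (A y))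
            \<le> cmod (w - a - a) * (N * (N * (N * (cmod (w - p) * (c * (c * norm x))))))"
        proof (rule interpolate_linearised[OF y(1) _ _ N(2,1)])
          fix s :: real assume s: "s \<in> {0..1}"
          have "norm (U (complex_of_real s * (w - a)) (A y) - U (complex_of_real s * a) (A y))
              \<le> N * (N * (cmod (complex_of_real s * (w - a) - complex_of_real s * a) * norm (A (A y))))"
          proof (rule U_lipschitz[OF y(3) _ _ N(2,1)])
            show "cmod (complex_of_real s * a) \<le> R" "cmod (complex_of_real s * (w - a)) \<le> R"
              using s wa mult_left_le_one_le[of "cmod a" s] mult_left_le_one_le[of "cmod (w - a)" s]
              by (auto simp: norm_mult R_def)
          qed (rule S_scale0; use s S wa in simp)+
          also have "cmod (complex_of_real s * (w - a) - complex_of_real s * a) = s * cmod (w - p)"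
            using s by (simp add: norm_mult p_eq diff_diff_eq flip: right_diff_distrib)
          also have "s * cmod (w - p) * norm (A (A y)) \<le> cmod (w - p) * (c * (c * norm x))"
            using s AAy by (intro mult_mono mult_left_le_one_le) auto
          finally show "norm (U (complex_of_real s * (w - a)) (A y) - U (complex_of_real s * a) (A y))
              \<le> N * (N * (cmod (w - p) * (c * (c * norm x))))"
            using N by simp
        qed (use S wa in \<open>auto simp: R_def\<close>)
        moreover have "U (w - a) y = U w x" "U a y = U p x"
          using U_add[OF wa(1) S(1)] U_add[OF S(1) S(1)] by (simp_all add: y_def p_eq)
        moreover have "U a (A y) = E x"
          using U_generator[OF y(1), of a] S calculation by (simp add: E)
        moreover have "w - a - a = w - p" by (simp add: p_eq)
        ultimately have le: "norm (U w x - U p x - (w - p) *\<^sub>C E x)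
            \<le> cmod (w - p) * (N * (N * (N * (cmod (w - p) * (c * (c * norm x))))))" by simp
        have "(inverse (w - p) *\<^sub>C (U w - U p) - E) x = inverse (w - p) *\<^sub>C (U w x - U p x - (w - p) *\<^sub>C E x)"
          using elim by (simp add: scaleC_blinfun.rep_eq blinfun.diff_left scaleC.diff_right scaleC_scaleC)
        then have "norm ((inverse (w - p) *\<^sub>C (U w - U p) - E) x)
            = inverse (cmod (w - p)) * norm (U w x - U p x - (w - p) *\<^sub>C E x)"
          by (simp add: norm_scaleC norm_inverse)
        also have "\<dots> \<le> inverse (cmod (w - p)) * (cmod (w - p) * (N * (N * (N * (cmod (w - p) * (c * (c * norm x)))))))"
          using le by (intro mult_left_mono) auto
        also have "\<dots> = ?K * cmod (w - p) * norm x" using elim by (simp add: mult_ac)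
        finally show "norm ((inverse (w - p) *\<^sub>C (U w - U p) - E) x) \<le> ?K * cmod (w - p) * norm x" .
      qed
      then show ?case .
    qed
    show "((\<lambda>w. N * (N * (N * (c * c))) * cmod (w - p)) \<longlongrightarrow> 0) (at p)"
      by (auto intro!: tendsto_eq_intros)
  qed
  then show "\<exists>f'. ((\<lambda>w. inverse (w - p) *\<^sub>C (U w - U p)) \<longlongrightarrow> f') (at p)" by blast
qed

lemma analytic: "analytic_semigroup \<delta> U"
  unfolding analytic_semigroup_def complex_linear_blinfun_def
proof (intro conjI ballI allI impI)
  show "U 0 = id_blinfun" by (rule blinfun_eqI) (simp add: U_zero)
  show "((\<lambda>z. U z x) \<longlongrightarrow> x) (at 0 within sector \<delta>')" if "0 < \<delta>' \<and> \<delta>' < \<delta>" for \<delta>' x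
  proof -
    have "\<forall>\<^sub>F z in at 0 within sector \<delta>'. z \<in> insert 0 S"
      using sector_mono[of \<delta>' \<delta>] that by (auto simp: eventually_at_filter intro!: always_eventually)
    then have "((\<lambda>z. U z x) \<longlongrightarrow> U 0 x) (at 0 within sector \<delta>')"
      by (intro U_tendsto tendsto_ident_at tendsto_const) auto
    then show ?thesis by (simp add: U_zero)
  qed
qed (simp_all add: U_scaleC U_add U_holomorphic)

end

lemma C0_generator_cong:
  assumes "C0_generator T D A" "\<And>t. 0 \<le> t \<Longrightarrow> T t = T' t" "\<And>x. x \<in> D \<Longrightarrow> A x = A' x"
  shows "C0_generator T' D A'"
proof
  interpret C0_generator T D A by fact
  have "continuous_on {0..} (\<lambda>t. T' t x)" for x
    using T_continuous[of x] by (rule continuous_on_eq) (simp add: assms(2))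
  then show "C0_semigroup T'" using C0 by (auto simp: C0_semigroup_def assms(2)[symmetric])
  show "is_generator T' D A'" using gen is_generator_cong[of T T' D A A'] assms by simp
qed

theorem generates_analytic_semigroup_iff:
  fixes A :: "'a::complex_banach \<Rightarrow> 'a"
  shows "generates_analytic_semigroup D A \<longleftrightarrow>
    (\<exists>\<delta> M. 0 < \<delta> \<and> \<delta> \<le> pi / 2 \<and>
      (\<forall>z\<in>sector \<delta>. cmod z = 1 \<longrightarrow> generates_le M D (\<lambda>x. z *\<^sub>C A x)))"
    (is "_ \<longleftrightarrow> ?rays")
proof
  assume "generates_analytic_semigroup D A"
  then obtain \<delta> T where T: "0 < \<delta>" "\<delta> \<le> pi / 2" "analytic_semigroup \<delta> T"
      "is_generator (\<lambda>t. T (complex_of_real t)) D A"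
    by (auto simp: generates_analytic_semigroup_def)
  obtain M where "\<forall>z\<in>sector (\<delta> / 2). cmod z = 1 \<longrightarrow> generates_le M D (\<lambda>x. z *\<^sub>C A x)"
    using analytic_semigroup_rays[OF T] by blast
  then show ?rays
    using T by (intro exI[of _ "\<delta> / 2"] exI[of _ M]) auto
next
  assume ?rays
  then obtain \<delta> M where \<delta>: "0 < \<delta>" "\<delta> \<le> pi / 2"
    and "\<And>z. z \<in> sector \<delta> \<Longrightarrow> cmod z = 1 \<Longrightarrow> generates_le M D (\<lambda>x. z *\<^sub>C A x)" by blast
  then have "\<forall>z\<in>{z \<in> sector \<delta>. cmod z = 1}. \<exists>V. C0_semigroup V \<and> is_generator V D (\<lambda>x. z *\<^sub>C A x) \<and>
      (\<forall>t\<in>{0..1}. norm (V t) \<le> M)"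
    by (simp add: generates_le_def)
  from bchoice[OF this] obtain V where "\<forall>z\<in>{z \<in> sector \<delta>. cmod z = 1}. C0_semigroup (V z) \<and>
      is_generator (V z) D (\<lambda>x. z *\<^sub>C A x) \<and> (\<forall>t\<in>{0..1}. norm (V z t) \<le> M)" by blast
  then have V: "C0_semigroup (V z) \<and> is_generator (V z) D (\<lambda>x. z *\<^sub>C A x) \<and>
      (\<forall>t\<in>{0..1}. norm (V z t) \<le> M)" if "z \<in> sector \<delta>" "cmod z = 1" for z
    using that by simp
  \<comment> \<open>Polar coordinates: direction \<open>sgn w\<close>, time \<open>cmod w\<close>.
    The origin has no direction, so the identity is set there by hand.\<close>
  define U where "U w = (if w = 0 then id_blinfun else V (sgn w) (cmod w))" for w
  have sgn: "sgn w \<in> sector \<delta>" "cmod (sgn w) = 1" "w \<noteq> 0" if "w \<in> sector \<delta>" for w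
    using that sgn_in_sector[OF that] by (auto simp: sector_def norm_sgn)
  interpret sectorial_family U D A \<delta> M
  proof (rule sectorial_family.intro)
    fix w assume w: "w \<in> sector \<delta>"
    have "C0_generator (V (sgn w)) D (\<lambda>x. sgn w *\<^sub>C A x)"
      using V[OF sgn(1,2)[OF w]] by unfold_locales auto
    then have gen: "C0_generator (\<lambda>t. V (sgn w) (cmod w * t)) D (\<lambda>x. cmod w *\<^sub>R sgn w *\<^sub>C A x)"
      using sgn[OF w] by (intro C0_generator_time_scale) auto
    then show "C0_generator (\<lambda>t. U (complex_of_real t * w)) D (\<lambda>x. w *\<^sub>C A x)"
    proof (rule C0_generator_cong)
      have "V (sgn w) 0 = id_blinfun" using V[OF sgn(1,2)[OF w]] by (simp add: C0_semigroup_def)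
      then show "V (sgn w) (cmod w * t) = U (complex_of_real t * w)" if "0 \<le> t" for t
        using that sgn(3)[OF w] by (auto simp: U_def sgn_mult norm_mult mult.commute sgn_of_real sgn_if)
      have "cmod w *\<^sub>R sgn w *\<^sub>C A x = (complex_of_real (cmod w) * sgn w) *\<^sub>C A x" for x
        by (simp only: scaleC_of_real[symmetric] scaleC_scaleC)
      moreover have "complex_of_real (cmod w) * sgn w = w"
        using sgn(3)[OF w] by (simp add: sgn_div_norm scaleR_conv_of_real flip: mult.assoc)
      ultimately show "cmod w *\<^sub>R sgn w *\<^sub>C A x = w *\<^sub>C A x" for x by simp
    qed
    assume "cmod w \<le> 1"
    then show "norm (U w) \<le> M"
      using V[OF sgn(1,2)[OF w]] sgn(3)[OF w] by (simp add: U_def)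
  qed (use \<delta> in auto)
  show "generates_analytic_semigroup D A"
    unfolding generates_analytic_semigroup_def using \<delta> analytic gen1 C0_generator.gen by blast
qed

subsection \<open>Transferring generation\<close>

text \<open>The bound may change by a function \<open>f\<close> that does not depend on the rotation \<open>z\<close>; this
  uniformity makes one proof serve both kinds of semigroups.\<close>

definition generation_transfer ::
    "'a::complex_banach set \<Rightarrow> ('a \<Rightarrow> 'a) \<Rightarrow> 'b::complex_banach set \<Rightarrow> ('b \<Rightarrow> 'b) \<Rightarrow> bool"
  where "generation_transfer D A D' A' \<longleftrightarrow>
    (\<exists>f. \<forall>z M. cmod z = 1 \<longrightarrow> generates_le M D (\<lambda>x. z *\<^sub>C A x) \<longrightarrow>
      generates_le (f M) D' (\<lambda>x. z *\<^sub>C A' x))"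

lemma generation_transferI:
  assumes "\<And>z M T. cmod z = 1 \<Longrightarrow> C0_generator T D (\<lambda>x. z *\<^sub>C A x) \<Longrightarrow> \<forall>t\<in>{0..1}. norm (T t) \<le> M \<Longrightarrow>
    generates_le (f M) D' (\<lambda>x. z *\<^sub>C A' x)"
  shows "generation_transfer D A D' A'"
  unfolding generation_transfer_def generates_le_def[of _ D]
  using assms by (intro exI[of _ f]) (auto intro: C0_generator.intro)

lemma generation_transfer_trans [trans]:
  assumes "generation_transfer D A D' A'" "generation_transfer D' A' D'' A''"
  shows "generation_transfer D A D'' A''"
proof -
  obtain f g where f: "\<And>z M. cmod z = 1 \<Longrightarrow> generates_le M D (\<lambda>x. z *\<^sub>C A x) \<Longrightarrow>
      generates_le (f M) D' (\<lambda>x. z *\<^sub>C A' x)"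
    and g: "\<And>z M. cmod z = 1 \<Longrightarrow> generates_le M D' (\<lambda>x. z *\<^sub>C A' x) \<Longrightarrow>
      generates_le (g M) D'' (\<lambda>x. z *\<^sub>C A'' x)"
    using assms unfolding generation_transfer_def by blast
  then show ?thesis
    unfolding generation_transfer_def by (intro exI[of _ "\<lambda>M. g (f M)"]) blast
qed

lemma generation_transfer_cong:
  assumes "generation_transfer D A D' A'" "D' = D''" "\<And>x. x \<in> D' \<Longrightarrow> A' x = A'' x"
  shows "generation_transfer D A D'' A''"
  using assms generates_le_cong[of D' "\<lambda>x. z *\<^sub>C A' x" "\<lambda>x. z *\<^sub>C A'' x" for z]
  unfolding generation_transfer_def by simp

lemma generation_transfer_C0:
  assumes "generation_transfer D A D' A'" "generates_C0_semigroup D A"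
  shows "generates_C0_semigroup D' A'"
proof -
  obtain f where f: "\<And>z M. cmod z = 1 \<Longrightarrow> generates_le M D (\<lambda>x. z *\<^sub>C A x) \<Longrightarrow>
      generates_le (f M) D' (\<lambda>x. z *\<^sub>C A' x)"
    using assms(1) unfolding generation_transfer_def by blast
  from f[of 1] show ?thesis using assms(2) by (auto simp: generates_C0_semigroup_iff)
qed

text \<open>The angle is kept; the bound changes from \<open>M\<close> to \<open>f M\<close>, the
  same for every direction.\<close>

lemma generation_transfer_analytic:
  assumes "generation_transfer D A D' A'" "generates_analytic_semigroup D A"
  shows "generates_analytic_semigroup D' A'"
  using assms unfolding generation_transfer_def generates_analytic_semigroup_iff by blast

lemma generates_analytic_imp_C0:
  assumes "generates_analytic_semigroup D A"
  shows "generates_C0_semigroup D A"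
proof -
  obtain \<delta> M where \<delta>: "0 < \<delta>"
    and rays: "\<forall>z\<in>sector \<delta>. cmod z = 1 \<longrightarrow> generates_le M D (\<lambda>x. z *\<^sub>C A x)"
    using assms unfolding generates_analytic_semigroup_iff by blast
  have "generates_le M D (\<lambda>x. 1 *\<^sub>C A x)"
    using rays one_in_sector[OF \<delta>] by (metis norm_one)
  then show ?thesis by (auto simp: generates_C0_semigroup_iff)
qed

text \<open>Rotation turns the perturbation into \<open>z C\<close>, whose norm is that of
  \<open>C\<close>; so one function of \<open>M\<close> serves all \<open>z\<close>.\<close>

lemma generation_transfer_perturb:
  assumes C: "complex_linear_blinfun C"
  shows "generation_transfer D A D (\<lambda>x. A x + C x)"
proof (rule generation_transferI[where f = "\<lambda>M. M * exp (M * norm C)"])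
  fix z M T
  assume z: "cmod z = 1" and T: "C0_generator T D (\<lambda>x. z *\<^sub>C A x)" and M: "\<forall>t\<in>{0..1}. norm (T t) \<le> M"
  interpret C0_generator T D "\<lambda>x. z *\<^sub>C A x" by (rule T)
  interpret bounded_perturbation T D "\<lambda>x. z *\<^sub>C A x" "z *\<^sub>C C"
    by unfold_locales
      (use C in \<open>simp add: complex_linear_blinfun_def scaleC_blinfun.rep_eq scaleC_scaleC mult.commute\<close>)
  show "generates_le (M * exp (M * norm C)) D (\<lambda>x. z *\<^sub>C (A x + C x))"
    using perturbed_semigroup[OF M] z
    by (simp add: generates_le_def scaleC_blinfun.rep_eq norm_scaleC scaleC_add_right)
qed

lemma generation_transfer_similar:
  fixes S :: "'a::complex_banach \<Rightarrow>\<^sub>L 'b::complex_banach" and S' :: "'b \<Rightarrow>\<^sub>L 'a"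
  assumes S: "\<And>c x. S (c *\<^sub>C x) = c *\<^sub>C S x" and S': "\<And>c y. S' (c *\<^sub>C y) = c *\<^sub>C S' y"
    and inv: "\<And>x. S' (S x) = x" "\<And>y. S (S' y) = y"
  shows "generation_transfer D A {y. S' y \<in> D} (\<lambda>y. S (A (S' y)))"
proof (rule generation_transferI[where f = "\<lambda>M. norm S * M * norm S'"])
  fix z M T
  assume T: "C0_generator T D (\<lambda>x. z *\<^sub>C A x)" and M: "\<forall>t\<in>{0..1}. norm (T t) \<le> M"
  interpret C0_generator T D "\<lambda>x. z *\<^sub>C A x" by (rule T)
  define U where "U t = S o\<^sub>L T t o\<^sub>L S'" for t
  have U: "U t y = S (T t (S' y))" for t y by (simp add: U_def)
  have "C0_semigroup U"
    unfolding C0_semigroup_def complex_linear_blinfun_def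
  proof (intro conjI allI impI)
    show "U 0 = id_blinfun" by (rule blinfun_eqI) (simp add: U T_zero inv)
    show "U (s + t) = U s o\<^sub>L U t" if "0 \<le> s" "0 \<le> t" for s t
      by (rule blinfun_eqI) (simp add: U T_add inv that)
    show "continuous_on {0..} (\<lambda>t. U t x)" for x
      unfolding U by (intro continuous_intros T_continuous)
  qed (simp add: U S S' T_scaleC)
  moreover have "is_generator U {y. S' y \<in> D} (\<lambda>y. z *\<^sub>C S (A (S' y)))"
  proof -
    have quotient: "(U h y - y) /\<^sub>R h = S ((T h (S' y) - S' y) /\<^sub>R h)"
      "S' ((U h y - y) /\<^sub>R h) = (T h (S' y) - S' y) /\<^sub>R h" for h y
      by (simp_all add: U blinfun.diff_right blinfun.scaleR_right inv)
    have "((\<lambda>h. (U h y - y) /\<^sub>R h) \<longlongrightarrow> z *\<^sub>C S (A (S' y))) (at_right 0)" if "S' y \<in> D" for y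
      unfolding quotient S[symmetric] by (intro blinfun.tendsto tendsto_const generator_lim that)
    moreover have "S' y \<in> D" if "((\<lambda>h. (U h y - y) /\<^sub>R h) \<longlongrightarrow> l) (at_right 0)" for y l
      using blinfun.tendsto[OF tendsto_const[of S'] that] unfolding quotient(2) by (rule generatorI)
    ultimately show ?thesis unfolding is_generator_def by blast
  qed
  moreover have "norm (U t) \<le> norm S * M * norm S'" if "t \<in> {0..1}" for t
  proof -
    have "norm (U t) \<le> norm (S o\<^sub>L T t) * norm S'" unfolding U_def by (rule norm_blinfun_compose)
    also have "\<dots> \<le> norm S * norm (T t) * norm S'"
      by (intro mult_right_mono norm_blinfun_compose) simp
    also have "\<dots> \<le> norm S * M * norm S'"
      using M that by (intro mult_right_mono mult_left_mono) auto
    finally show ?thesis .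
  qed
  ultimately show "generates_le (norm S * M * norm S') {y. S' y \<in> D} (\<lambda>y. z *\<^sub>C S (A (S' y)))"
    unfolding generates_le_def by blast
qed

lemma generation_transfer_diagonal:
  fixes A :: "'a::complex_banach \<Rightarrow> 'a"
  shows "generation_transfer D A (D \<times> UNIV) (\<lambda>p. (A (fst p), 0 :: 'b::complex_banach))"
proof (rule generation_transferI[where f = "\<lambda>M. M + 1"])
  fix z M T
  assume T: "C0_generator T D (\<lambda>x. z *\<^sub>C A x)" and M: "\<forall>t\<in>{0..1}. norm (T t) \<le> M"
  interpret C0_generator T D "\<lambda>x. z *\<^sub>C A x" by (rule T)
  define U :: "real \<Rightarrow> ('a \<times> 'b) \<Rightarrow>\<^sub>L ('a \<times> 'b)" where "U t = Blinfun (\<lambda>p. (T t (fst p), snd p))" for t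
  have "bounded_linear (\<lambda>p :: 'a \<times> 'b. (T t (fst p), snd p))" for t
    by (intro bounded_linear_Pair bounded_linear_snd
        bounded_linear_compose[OF blinfun.bounded_linear_right bounded_linear_fst])
  then have U: "U t p = (T t (fst p), snd p)" for t p by (simp add: U_def bounded_linear_Blinfun_apply)
  have "C0_semigroup U"
    unfolding C0_semigroup_def complex_linear_blinfun_def
  proof (intro conjI allI impI)
    show "U 0 = id_blinfun" by (rule blinfun_eqI) (simp add: U T_zero)
    show "U (s + t) = U s o\<^sub>L U t" if "0 \<le> s" "0 \<le> t" for s t
      by (rule blinfun_eqI) (simp add: U T_add that)
    show "continuous_on {0..} (\<lambda>t. U t x)" for x
      unfolding U by (intro continuous_intros T_continuous)
  qed (simp add: U T_scaleC scaleC_prod_def)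
  moreover have "is_generator U (D \<times> UNIV) (\<lambda>p. z *\<^sub>C (A (fst p), 0))"
  proof -
    have quotient: "(U h p - p) /\<^sub>R h = ((T h (fst p) - fst p) /\<^sub>R h, 0)" for h p
      by (simp add: U prod_eq_iff)
    have "((\<lambda>h. (U h p - p) /\<^sub>R h) \<longlongrightarrow> z *\<^sub>C (A (fst p), 0)) (at_right 0)" if "p \<in> D \<times> UNIV" for p
    proof -
      have "fst p \<in> D" using that by auto
      from tendsto_Pair[OF generator_lim[OF this] tendsto_const] show ?thesis
        unfolding quotient scaleC_prod_def by simp
    qed
    moreover have "p \<in> D \<times> UNIV" if "((\<lambda>h. (U h p - p) /\<^sub>R h) \<longlongrightarrow> l) (at_right 0)" for p l
    proof -
      have "fst p \<in> D" using tendsto_fst[OF that] unfolding quotient fst_conv by (rule generatorI)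
      then show ?thesis by (simp add: mem_Times_iff)
    qed
    ultimately show ?thesis unfolding is_generator_def by blast
  qed
  moreover have "norm (U t) \<le> M + 1" if t: "t \<in> {0..1}" for t
  proof (rule norm_blinfun_bound)
    have M0: "0 \<le> M" using M t norm_ge_zero[of "T t"] by (meson order_trans)
    then show "0 \<le> M + 1" by simp
    fix p :: "'a \<times> 'b"
    have "norm (U t p) \<le> norm (T t (fst p)) + norm (snd p)"
      unfolding U by (rule norm_Pair_le)
    also have "\<dots> \<le> M * norm p + norm p"
      using M t M0 norm_fst_le[of "fst p" "snd p"] norm_snd_le[of "snd p" "fst p"]
      by (intro add_mono order_trans[OF norm_blinfun] mult_mono) auto
    finally show "norm (U t p) \<le> (M + 1) * norm p" by (simp add: distrib_right)
  qed
  ultimately show "generates_le (M + 1) (D \<times> UNIV) (\<lambda>p. z *\<^sub>C (A (fst p), 0 :: 'b))"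
    unfolding generates_le_def by blast
qed

text \<open>The semigroup on the product is not assumed to be diagonal. Its orbits have constant
  second component because the generator maps into the first factor; hence the first factor is
  invariant and the semigroup restricts to it.\<close>

lemma generation_transfer_from_diagonal:
  fixes A :: "'a::complex_banach \<Rightarrow> 'a"
  shows "generation_transfer (D \<times> UNIV) (\<lambda>p. (A (fst p), 0 :: 'b::complex_banach)) D A"
proof (rule generation_transferI[where f = "\<lambda>M. M"])
  fix z M T
  assume T: "C0_generator T (D \<times> UNIV) (\<lambda>p. z *\<^sub>C (A (fst p), 0 :: 'b))"
    and M: "\<forall>t\<in>{0..1}. norm (T t) \<le> M"
  interpret C0_generator T "D \<times> UNIV" "\<lambda>p. z *\<^sub>C (A (fst p), 0 :: 'b)" by (rule T)
  have snd_T: "snd (T t p) = snd p" if t: "0 \<le> t" for t p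
  proof -
    have "snd_blinfun o\<^sub>L T t = snd_blinfun"
    proof (rule blinfun_eq_on_dense[OF dense])
      fix p assume p: "p \<in> D \<times> (UNIV :: 'b set)"
      let ?f = "\<lambda>s. blinfun_apply (T s) (z *\<^sub>C (A (fst p), 0))"
      have "?f integrable_on {0..t}"
        by (intro integrable_continuous_real continuous_on_subset[OF T_continuous]) auto
      then have "snd (integral {0..t} ?f) = integral {0..t} (\<lambda>s. snd (?f s))"
        by (rule integral_linear[OF _ bounded_linear_snd, unfolded o_def, symmetric])
      \<comment> \<open>Moving the generator past \<open>T s\<close> puts the integrand into the
        range of the generator, whose second component is 0.\<close>
      also have "\<dots> = integral {0..t} (\<lambda>s. 0)"
        using p T_generator(2)[OF p, symmetric] by (intro integral_cong) (simp add: scaleC_prod_def)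
      finally show "(snd_blinfun o\<^sub>L T t) p = snd_blinfun p"
        using orbit_integral[OF p t] by simp
    qed
    then show ?thesis by (metis blinfun_apply_blinfun_compose blinfun_apply_snd_blinfun)
  qed
  define U where "U t = Blinfun (\<lambda>u. fst (T t (u, 0)))" for t
  have "bounded_linear (\<lambda>u. fst (T t (u, 0 :: 'b)))" for t
    by (intro bounded_linear_fst_comp bounded_linear_compose[OF blinfun.bounded_linear_right]
        bounded_linear_Pair bounded_linear_ident bounded_linear_zero)
  then have "U t u = fst (T t (u, 0))" for t u by (simp add: U_def bounded_linear_Blinfun_apply)
  moreover have "T t (u, 0) = (fst (T t (u, 0)), 0)" if "0 \<le> t" for t u
    using snd_T[OF that, of "(u, 0)"] by (simp add: prod_eq_iff)
  ultimately have U: "U t u = fst (T t (u, 0))" and T_U: "0 \<le> t \<Longrightarrow> T t (u, 0) = (U t u, 0)" for t u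
    by auto
  have "C0_semigroup U"
    unfolding C0_semigroup_def complex_linear_blinfun_def
  proof (intro conjI allI impI)
    show "U 0 = id_blinfun" by (rule blinfun_eqI) (simp add: U T_zero)
    show "U (s + t) = U s o\<^sub>L U t" if "0 \<le> s" "0 \<le> t" for s t
    proof (rule blinfun_eqI)
      fix u
      have "U (s + t) u = fst (T s (T t (u, 0)))" by (simp only: U T_add that)
      also have "\<dots> = fst (T s (U t u, 0))" by (simp only: T_U[OF that(2)])
      also have "\<dots> = U s (U t u)" by (rule U[symmetric])
      finally show "U (s + t) u = (U s o\<^sub>L U t) u" by simp
    qed
    show "continuous_on {0..} (\<lambda>t. U t x)" for x
      unfolding U by (intro continuous_intros T_continuous)
    show "U t (c *\<^sub>C x) = c *\<^sub>C U t x" if "0 \<le> t" for t c x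
      using T_scaleC[OF that, of c "(x, 0)"] by (simp add: U scaleC_prod_def)
  qed
  moreover have "is_generator U D (\<lambda>u. z *\<^sub>C A u)"
  proof -
    have ev: "\<forall>\<^sub>F h in at_right 0. (T h (u, 0) - (u, 0)) /\<^sub>R h = ((U h u - u) /\<^sub>R h, 0)" for u
      using eventually_at_right_less[of 0] by eventually_elim (simp add: T_U prod_eq_iff)
    have "((\<lambda>h. (U h u - u) /\<^sub>R h) \<longlongrightarrow> z *\<^sub>C A u) (at_right 0)" if "u \<in> D" for u
    proof -
      have "((\<lambda>h. (T h (u, 0) - (u, 0)) /\<^sub>R h) \<longlongrightarrow> z *\<^sub>C (A u, 0)) (at_right 0)"
        using generator_lim[of "(u, 0)"] that by simp
      from tendsto_fst[OF Lim_transform_eventually[OF this ev]] show ?thesis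
        by (simp add: scaleC_prod_def)
    qed
    moreover have "u \<in> D" if "((\<lambda>h. (U h u - u) /\<^sub>R h) \<longlongrightarrow> l) (at_right 0)" for u l
    proof -
      have "((\<lambda>h. ((U h u - u) /\<^sub>R h, 0)) \<longlongrightarrow> (l, 0)) (at_right 0)"
        by (intro tendsto_Pair that tendsto_const)
      moreover have "\<forall>\<^sub>F h in at_right 0. ((U h u - u) /\<^sub>R h, 0) = (T h (u, 0) - (u, 0)) /\<^sub>R h"
        using ev[of u] by (auto elim: eventually_mono)
      ultimately have "((\<lambda>h. (T h (u, 0) - (u, 0)) /\<^sub>R h) \<longlongrightarrow> (l, 0)) (at_right 0)"
        by (rule Lim_transform_eventually)
      then show ?thesis using generatorI(1)[of "(u, 0)" "(l, 0)"] by simp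
    qed
    ultimately show ?thesis unfolding is_generator_def by blast
  qed
  moreover have "norm (U t) \<le> M" if t: "t \<in> {0..1}" for t
  proof (rule norm_blinfun_bound)
    show "0 \<le> M" using M t norm_ge_zero[of "T t"] by (meson order_trans)
    fix u
    have "norm (U t u) = norm (T t (u, 0))" using t by (simp add: T_U)
    also have "\<dots> \<le> norm (T t) * norm (u, 0 :: 'b)" by (rule norm_blinfun)
    also have "\<dots> \<le> M * norm u" using M t by (simp add: mult_right_mono)
    finally show "norm (U t u) \<le> M * norm u" .
  qed
  ultimately show "generates_le M D (\<lambda>u. z *\<^sub>C A u)" unfolding generates_le_def by blast
qed

subsection \<open>The operator matrix\<close>

lemma closed_operatorD:
  assumes "closed_operator D A" "\<And>n. X n \<in> D" "X \<longlonglongrightarrow> x" "(\<lambda>n. A (X n)) \<longlonglongrightarrow> y"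
  shows "x \<in> D" "A x = y"
proof -
  have "(x, y) \<in> (\<lambda>u. (u, A u)) ` D"
  proof (rule closed_sequentially)
    show "closed ((\<lambda>u. (u, A u)) ` D)" using assms(1) by (simp add: closed_operator_def)
    show "(\<lambda>n. (X n, A (X n))) \<longlonglongrightarrow> (x, y)" by (intro tendsto_Pair assms)
  qed (use assms(2) in auto)
  then show "x \<in> D" "A x = y" by auto
qed

locale dirichlet_setting =
  fixes DA DB :: "'x::complex_banach set" and A :: "'x \<Rightarrow> 'x" and L B :: "'x \<Rightarrow> 'y::complex_banach"
    and \<mu> :: complex
  assumes A: "linear_operator DA A" and L: "linear_operator DA L" and B: "linear_operator DB B"
    and DAB: "DA \<subseteq> DB"
    and A0_closed: "closed_operator (op_ker DA L) A"
    and L_surj: "L ` DA = UNIV"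
    and AL_closed: "closed_operator DA (\<lambda>u. (A u, L u))"
    and B_rel: "relatively_bounded (op_ker DA L) A B"
    and \<mu>: "\<mu> \<in> resolvent_set (op_ker DA L) A"
    and B_dir: "bounded_linear (\<lambda>v. B (dirichlet_operator DA A L \<mu> v))"
begin

abbreviation "D0 \<equiv> op_ker DA L"
abbreviation "dir \<equiv> dirichlet_operator DA A L \<mu>"

definition G :: "'x \<Rightarrow> 'x" where "G u = A u - dir (B u)"
definition P :: "'x \<times> 'y \<Rightarrow> 'x \<times> 'y" where "P p = (G (fst p), B (fst p))"

lemmas A_lin = linear_operatorD[OF A]
lemmas L_lin = linear_operatorD[OF L]
lemmas B_lin = linear_operatorD[OF B]

lemma D0_iff: "u \<in> D0 \<longleftrightarrow> u \<in> DA \<and> L u = 0"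
  by (simp add: op_ker_def)

lemma dir_bij: "bij_betw L (op_ker DA (\<lambda>u. \<mu> *\<^sub>C u - A u)) UNIV"
  by (rule bij_betw_dirichlet[OF A L L_surj \<mu>])

lemma dir: "dir v \<in> DA" "A (dir v) = \<mu> *\<^sub>C dir v" "L (dir v) = v"
proof -
  have "dir v \<in> op_ker DA (\<lambda>u. \<mu> *\<^sub>C u - A u)"
    unfolding dirichlet_operator_def
    by (rule the_inv_into_into[OF bij_betw_imp_inj_on[OF dir_bij] _ order_refl])
      (simp add: bij_betw_imp_surj_on[OF dir_bij])
  then show "dir v \<in> DA" "A (dir v) = \<mu> *\<^sub>C dir v" by (simp_all add: op_ker_def)
  show "L (dir v) = v"
    unfolding dirichlet_operator_def by (rule f_the_inv_into_f_bij_betw[OF dir_bij]) simp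
qed

lemma dir_unique:
  assumes "u \<in> DA" "A u = \<mu> *\<^sub>C u" "L u = v"
  shows "dir v = u"
  unfolding dirichlet_operator_def
  by (rule the_inv_into_f_eq[OF bij_betw_imp_inj_on[OF dir_bij] assms(3)])
    (simp add: op_ker_def assms)

lemma dir_add: "dir (v + w) = dir v + dir w"
  by (rule dir_unique) (simp_all add: dir A_lin L_lin scaleC_add_right)

lemma dir_scaleC: "dir (c *\<^sub>C v) = c *\<^sub>C dir v"
  by (rule dir_unique) (simp_all add: dir A_lin L_lin scaleC_scaleC mult.commute)

text \<open>Closedness of \<open>(A, L)\<close> closes the graph: on the range of
  \<open>dir\<close>, \<open>A\<close> acts as multiplication by \<open>\<mu>\<close>, so
  \<open>A (dir (V n))\<close> converges along with \<open>dir (V n)\<close>.\<close>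

lemma dir_bounded_linear: "bounded_linear dir"
proof (rule closed_graph)
  show "linear dir"
    by (rule linearI) (simp_all add: dir_add dir_scaleC flip: scaleC_of_real)
  fix V v u assume V: "V \<longlonglongrightarrow> v" and dV: "(\<lambda>n. dir (V n)) \<longlonglongrightarrow> u"
  have "(\<lambda>n. (A (dir (V n)), L (dir (V n)))) \<longlonglongrightarrow> (\<mu> *\<^sub>C u, v)"
    unfolding dir by (intro tendsto_intros V dV)
  from closed_operatorD[OF AL_closed dir(1) dV this] show "dir v = u"
    by (intro dir_unique) auto
qed

definition Dir :: "'y \<Rightarrow>\<^sub>L 'x" where "Dir = Blinfun dir"
definition BDir :: "'y \<Rightarrow>\<^sub>L 'y" where "BDir = Blinfun (\<lambda>v. B (dir v))"

lemma Dir: "Dir v = dir v"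
  by (simp add: Dir_def bounded_linear_Blinfun_apply[OF dir_bounded_linear])

lemma BDir: "BDir v = B (dir v)"
  by (simp add: BDir_def bounded_linear_Blinfun_apply[OF B_dir])

lemma BDir_scaleC: "BDir (c *\<^sub>C v) = c *\<^sub>C BDir v"
  using B_lin(8)[of "dir v" c] DAB dir(1) by (auto simp: BDir dir_scaleC)

lemma D0_linear: "linear_operator D0 A"
  unfolding linear_operator_def by (auto simp: D0_iff A_lin L_lin)

lemma D0_DB: "u \<in> D0 \<Longrightarrow> u \<in> DB"
  using DAB by (auto simp: D0_iff)

section \<open>Removing the boundary condition by the Dirichlet shear\<close>

definition shear :: "('x \<times> 'y) \<Rightarrow>\<^sub>L ('x \<times> 'y)"
  where "shear = Blinfun (\<lambda>p. (fst p - Dir (snd p), snd p))"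
definition unshear :: "('x \<times> 'y) \<Rightarrow>\<^sub>L ('x \<times> 'y)"
  where "unshear = Blinfun (\<lambda>p. (fst p + Dir (snd p), snd p))"
text \<open>What the shear leaves besides \<open>P\<close>: the contributions of
  \<open>A (dir v) = \<mu> *\<^sub>C dir v\<close> and of \<open>B (dir v)\<close>. They see the
  boundary component alone and are bounded because \<open>dir\<close> and its composition with
  \<open>B\<close> are.\<close>

definition coupling :: "('x \<times> 'y) \<Rightarrow>\<^sub>L ('x \<times> 'y)"
  where "coupling = Blinfun (\<lambda>p. (\<mu> *\<^sub>C Dir (snd p) - Dir (BDir (snd p)), BDir (snd p)))"

lemma shear: "shear p = (fst p - Dir (snd p), snd p)"
  unfolding shear_def
  by (subst bounded_linear_Blinfun_apply) (auto intro!: bounded_linear_intros)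

lemma unshear: "unshear p = (fst p + Dir (snd p), snd p)"
  unfolding unshear_def
  by (subst bounded_linear_Blinfun_apply) (auto intro!: bounded_linear_intros)

lemma coupling: "coupling p = (\<mu> *\<^sub>C Dir (snd p) - Dir (BDir (snd p)), BDir (snd p))"
  unfolding coupling_def
  by (subst bounded_linear_Blinfun_apply)
    (auto intro!: bounded_linear_intros bounded_linear_compose[OF bounded_linear_scaleC])

lemma coupling_linear: "complex_linear_blinfun coupling" "complex_linear_blinfun (- coupling)"
  unfolding complex_linear_blinfun_def blinfun.minus_left coupling
  by (simp_all add: scaleC_prod_def Dir dir_scaleC BDir_scaleC scaleC.diff_right scaleC_scaleC
      mult.commute scaleC.minus_right)

abbreviation "DAt \<equiv> {(u, v). u \<in> DA \<and> L u = v}"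
abbreviation "At \<equiv> \<lambda>(u, v). (A u, B u)"

lemma shear_inverse: "unshear (shear p) = p" "shear (unshear p) = p"
  by (simp_all add: shear unshear)

lemma shear_scaleC: "shear (c *\<^sub>C p) = c *\<^sub>C shear p" "unshear (c *\<^sub>C p) = c *\<^sub>C unshear p"
  by (simp_all add: shear unshear scaleC_prod_def Dir dir_scaleC scaleC.diff_right scaleC_add_right)

text \<open>As \<open>L (dir v) = v\<close>, the condition \<open>L (u + dir v) = v\<close> becomes
  \<open>L u = 0\<close>, and the boundary component is set free.\<close>

lemma unshear_DAt: "unshear p \<in> DAt \<longleftrightarrow> p \<in> D0 \<times> UNIV"
proof -
  have "fst p + dir (snd p) \<in> DA \<longleftrightarrow> fst p \<in> DA"
    using A_lin(2)[OF _ dir(1), of "fst p" "snd p"] A_lin(3)[OF _ dir(1), of "fst p + dir (snd p)" "snd p"]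
    by auto
  then show ?thesis
    using L_lin(6)[OF _ dir(1), of "fst p" "snd p"] by (auto simp: unshear Dir dir D0_iff mem_Times_iff)
qed

lemma shear_At:
  assumes p: "p \<in> D0 \<times> UNIV"
  shows "shear (At (unshear p)) = P p + coupling p"
proof -
  have u: "fst p \<in> DA" "fst p \<in> DB" using p D0_DB by (auto simp: D0_iff)
  have "A (fst p + dir (snd p)) = A (fst p) + \<mu> *\<^sub>C dir (snd p)"
    using A_lin(6)[OF u(1) dir(1)] by (simp add: dir)
  moreover have "B (fst p + dir (snd p)) = B (fst p) + BDir (snd p)"
    using B_lin(6)[OF u(2), of "dir (snd p)"] dir(1) DAB by (auto simp: BDir)
  ultimately show ?thesis
    by (simp add: shear unshear coupling P_def G_def Dir dir_add)
qed

lemma transfer_At_P: "generation_transfer DAt At (D0 \<times> UNIV) P"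
proof -
  have "generation_transfer DAt At {p. unshear p \<in> DAt} (\<lambda>p. shear (At (unshear p)))"
    by (rule generation_transfer_similar[OF shear_scaleC shear_inverse])
  then have "generation_transfer DAt At (D0 \<times> UNIV) (\<lambda>p. P p + coupling p)"
  proof (rule generation_transfer_cong)
    show "{p. unshear p \<in> DAt} = D0 \<times> UNIV" by (simp only: unshear_DAt Collect_mem_eq)
    show "shear (At (unshear p)) = P p + coupling p" if "p \<in> {p. unshear p \<in> DAt}" for p
      by (rule shear_At[OF unshear_DAt[THEN iffD1, OF CollectD[OF that]]])
  qed
  also have "generation_transfer (D0 \<times> UNIV) (\<lambda>p. P p + coupling p)
      (D0 \<times> UNIV) (\<lambda>p. P p + coupling p + (- coupling) p)"
    by (rule generation_transfer_perturb[OF coupling_linear(2)])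
  finally show ?thesis by (simp add: blinfun.minus_left)
qed

lemma transfer_P_At: "generation_transfer (D0 \<times> UNIV) P DAt At"
proof -
  have "generation_transfer (D0 \<times> UNIV) P (D0 \<times> UNIV) (\<lambda>p. P p + coupling p)"
    by (rule generation_transfer_perturb[OF coupling_linear(1)])
  also have "generation_transfer (D0 \<times> UNIV) (\<lambda>p. P p + coupling p)
      {p. shear p \<in> D0 \<times> UNIV} (\<lambda>p. unshear (P (shear p) + coupling (shear p)))"
    by (rule generation_transfer_similar[OF shear_scaleC(2,1) shear_inverse(2,1)])
  finally show ?thesis
  proof (rule generation_transfer_cong)
    have mem: "shear p \<in> D0 \<times> UNIV \<longleftrightarrow> p \<in> DAt" for p
      using unshear_DAt[of "shear p"] by (simp only: shear_inverse)
    then show "{p. shear p \<in> D0 \<times> UNIV} = DAt" by (simp only: mem Collect_mem_eq)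
    fix p assume "p \<in> {p. shear p \<in> D0 \<times> UNIV}"
    then have "P (shear p) + coupling (shear p) = shear (At (unshear (shear p)))"
      by (simp only: shear_At mem_Collect_eq)
    then show "unshear (P (shear p) + coupling (shear p)) = At p"
      by (simp only: shear_inverse)
  qed
qed

text \<open>Subtracting \<open>K\<close> times the first component from the second removes \<open>B\<close> from \<open>P\<close> up to the
  bounded operator \<open>\<omega> K\<close>. Such a \<open>K\<close> is read off the resolvent of whichever operator is known to
  generate: \<open>K = B R(\<omega>, G)\<close>, or \<open>\<omega>\<close> times the lower left entry of \<open>R(\<omega>, P)\<close>.\<close>

definition factors :: "real \<Rightarrow> ('x \<Rightarrow>\<^sub>L 'y) \<Rightarrow> bool"
  where "factors \<omega> K \<longleftrightarrow> (\<forall>c x. K (c *\<^sub>C x) = c *\<^sub>C K x) \<and> (\<forall>u\<in>D0. B u = K (\<omega> *\<^sub>R u - G u))"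

lemma factors_of_generator_G:
  assumes "generates_C0_semigroup D0 G"
  shows "\<exists>\<omega> K. factors \<omega> K"
proof -
  obtain T where "C0_semigroup T" "is_generator T D0 G"
    using assms by (auto simp: generates_C0_semigroup_def)
  then interpret C0_generator T D0 G by unfold_locales
  obtain \<omega> R where R: "complex_linear_blinfun R" "\<And>f. R f \<in> D0" "\<And>u. u \<in> D0 \<Longrightarrow> R (\<omega> *\<^sub>R u - G u) = u"
    using resolvent by metis
  note A0_lin = linear_operatorD[OF D0_linear]
  \<comment> \<open>\<open>G\<close> and \<open>A\<close> share the domain \<open>D0\<close>, so
    \<open>A (R f)\<close> makes sense for every \<open>f\<close>; closedness of \<open>A\<close> on
    \<open>D0\<close> makes it bounded, and the relative bound passes this on to
    \<open>B (R f)\<close>.\<close>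
  have AR: "bounded_linear (\<lambda>f. A (R f))"
  proof (rule closed_graph)
    show "linear (\<lambda>f. A (R f))"
      by (rule linearI) (simp_all add: blinfun.add_right blinfun.scaleR_right A0_lin R)
    fix X x y assume X: "X \<longlonglongrightarrow> x" and AX: "(\<lambda>n. A (R (X n))) \<longlonglongrightarrow> y"
    show "A (R x) = y"
      by (rule closed_operatorD(2)[OF A0_closed R(2) _ AX]) (intro tendsto_intros X)
  qed
  then obtain c where c: "\<And>f. norm (A (R f)) \<le> norm f * c"
    using bounded_linear.bounded by blast
  obtain a b where ab: "0 \<le> a" "0 \<le> b" "\<And>u. u \<in> D0 \<Longrightarrow> norm (B u) \<le> a * norm (A u) + b * norm u"
    using B_rel unfolding relatively_bounded_def by blast
  have BR: "bounded_linear (\<lambda>f. B (R f))"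
  proof (rule bounded_linear_intro)
    show "norm (B (R f)) \<le> norm f * (a * c + b * norm R)" for f
    proof -
      have "norm (B (R f)) \<le> a * norm (A (R f)) + b * norm (R f)" by (rule ab(3)[OF R(2)])
      also have "\<dots> \<le> a * (norm f * c) + b * (norm R * norm f)"
        by (intro add_mono mult_left_mono c norm_blinfun ab)
      finally show ?thesis by (simp add: algebra_simps)
    qed
  qed (simp_all add: blinfun.add_right blinfun.scaleR_right B_lin D0_DB R)
  have "B (R (c *\<^sub>C x)) = c *\<^sub>C B (R x)" for c x
    using R(1) by (simp add: complex_linear_blinfun_def B_lin D0_DB R)
  then have "factors \<omega> (Blinfun (\<lambda>f. B (R f)))"
    using R(3) by (simp add: factors_def bounded_linear_Blinfun_apply[OF BR])
  then show ?thesis by blast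
qed

lemma factors_of_generator_P:
  assumes "generates_C0_semigroup (D0 \<times> UNIV) P"
  shows "\<exists>\<omega> K. factors \<omega> K"
proof -
  obtain T where "C0_semigroup T" "is_generator T (D0 \<times> UNIV) P"
    using assms by (auto simp: generates_C0_semigroup_def)
  then interpret C0_generator T "D0 \<times> UNIV" P by unfold_locales
  obtain \<omega> R where R: "0 < \<omega>" "complex_linear_blinfun R"
    "\<And>p. p \<in> D0 \<times> UNIV \<Longrightarrow> R (\<omega> *\<^sub>R p - P p) = p"
    using resolvent by metis
  have K_lin: "bounded_linear (\<lambda>f. \<omega> *\<^sub>R snd (R (f, 0)))"
    by (intro bounded_linear_scaleR_right[THEN bounded_linear_compose] bounded_linear_snd_comp
        bounded_linear_compose[OF blinfun.bounded_linear_right] bounded_linear_Pair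
        bounded_linear_ident bounded_linear_zero)
  have "\<omega> *\<^sub>R snd (R (c *\<^sub>C x, 0)) = c *\<^sub>C \<omega> *\<^sub>R snd (R (x, 0))" for c x
  proof -
    have "R (c *\<^sub>C (x, 0)) = c *\<^sub>C R (x, 0)" using R(2) by (simp add: complex_linear_blinfun_def)
    then show ?thesis by (simp add: scaleC_prod_def scaleC_scaleR_commute)
  qed
  \<comment> \<open>\<open>\<omega> - P\<close> maps \<open>(u, B u / \<omega>)\<close> to
    \<open>(\<omega> u - G u, 0)\<close>: the second component is chosen to cancel
    \<open>B u\<close>.\<close>
  moreover have "B u = \<omega> *\<^sub>R snd (R (\<omega> *\<^sub>R u - G u, 0))" if "u \<in> D0" for u
    using R(3)[of "(u, inverse \<omega> *\<^sub>R B u)"] that R(1) by (simp add: P_def)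
  ultimately have "factors \<omega> (Blinfun (\<lambda>f. \<omega> *\<^sub>R snd (R (f, 0))))"
    by (simp add: factors_def bounded_linear_Blinfun_apply[OF K_lin])
  then show ?thesis by blast
qed

lemma transfer_factors:
  assumes "factors \<omega> K"
  shows "generation_transfer (D0 \<times> UNIV) P D0 G" "generation_transfer D0 G (D0 \<times> UNIV) P"
proof -
  have K: "K (c *\<^sub>C x) = c *\<^sub>C K x" and BK: "u \<in> D0 \<Longrightarrow> B u = K (\<omega> *\<^sub>R u - G u)" for c x u
    using assms by (auto simp: factors_def)
  define S :: "real \<Rightarrow> ('x \<times> 'y) \<Rightarrow>\<^sub>L ('x \<times> 'y)"
    where "S r = Blinfun (\<lambda>p. (fst p, snd p + r *\<^sub>R K (fst p)))" for r
  have S: "S r p = (fst p, snd p + r *\<^sub>R K (fst p))" for r p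
    unfolding S_def by (subst bounded_linear_Blinfun_apply)
      (auto intro!: bounded_linear_intros bounded_linear_compose[OF bounded_linear_scaleR_right])
  define C :: "real \<Rightarrow> ('x \<times> 'y) \<Rightarrow>\<^sub>L ('x \<times> 'y)"
    where "C r = Blinfun (\<lambda>p. (0, r *\<^sub>R K (fst p)))" for r
  have C: "C r p = (0, r *\<^sub>R K (fst p))" for r p
    unfolding C_def by (subst bounded_linear_Blinfun_apply)
      (auto intro!: bounded_linear_intros bounded_linear_compose[OF bounded_linear_scaleR_right])
  have S_scaleC: "S r (c *\<^sub>C p) = c *\<^sub>C S r p" for r c p
    by (simp add: S scaleC_prod_def K scaleC_add_right scaleC_scaleR_commute)
  have S_inverse: "S 1 (S (- 1) p) = p" "S (- 1) (S 1 p) = p" for p by (simp_all add: S)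
  have C_linear: "complex_linear_blinfun (C r)" for r
    by (simp add: complex_linear_blinfun_def C scaleC_prod_def K scaleC_scaleR_commute)
  have S_mem: "{p. S r p \<in> D0 \<times> UNIV} = D0 \<times> UNIV" for r
    by (auto simp: S mem_Times_iff)
  \<comment> \<open>In the second component, \<open>B u + K (G u) = K (\<omega> u - G u) + K (G u) =
    \<omega> K u\<close>.\<close>
  have SP: "S 1 (P (S (- 1) p)) = (G (fst p), 0) + C \<omega> p" if "p \<in> D0 \<times> UNIV" for p
  proof -
    have "fst p \<in> D0" using that by auto
    from BK[OF this] show ?thesis by (simp add: S C P_def blinfun.diff_right blinfun.scaleR_right)
  qed
  have "generation_transfer (D0 \<times> UNIV) P
      {p. S (- 1) p \<in> D0 \<times> UNIV} (\<lambda>p. S 1 (P (S (- 1) p)))"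
    by (rule generation_transfer_similar[OF S_scaleC S_scaleC S_inverse(2,1)])
  then have "generation_transfer (D0 \<times> UNIV) P (D0 \<times> UNIV) (\<lambda>p. (G (fst p), 0) + C \<omega> p)"
    by (rule generation_transfer_cong) (simp_all only: S_mem SP)
  also have "generation_transfer (D0 \<times> UNIV) (\<lambda>p. (G (fst p), 0) + C \<omega> p)
      (D0 \<times> UNIV) (\<lambda>p. (G (fst p), 0) + C \<omega> p + C (- \<omega>) p)"
    by (rule generation_transfer_perturb[OF C_linear])
  also have "(\<lambda>p. (G (fst p), 0) + C \<omega> p + C (- \<omega>) p) = (\<lambda>p. (G (fst p), 0))"
    by (simp add: C)
  also note generation_transfer_from_diagonal
  finally show "generation_transfer (D0 \<times> UNIV) P D0 G" .
  note generation_transfer_diagonal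
  also have "generation_transfer (D0 \<times> UNIV) (\<lambda>p. (G (fst p), 0 :: 'y))
      (D0 \<times> UNIV) (\<lambda>p. (G (fst p), 0) + C \<omega> p)"
    by (rule generation_transfer_perturb[OF C_linear])
  also have "generation_transfer (D0 \<times> UNIV) (\<lambda>p. (G (fst p), 0) + C \<omega> p)
      {p. S 1 p \<in> D0 \<times> UNIV} (\<lambda>p. S (- 1) ((G (fst (S 1 p)), 0) + C \<omega> (S 1 p)))"
    by (rule generation_transfer_similar[OF S_scaleC S_scaleC S_inverse])
  finally show "generation_transfer D0 G (D0 \<times> UNIV) P"
  proof (rule generation_transfer_cong)
    fix p assume "p \<in> {p. S 1 p \<in> D0 \<times> UNIV}"
    then show "S (- 1) ((G (fst (S 1 p)), 0) + C \<omega> (S 1 p)) = P p"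
      by (simp only: SP[symmetric] mem_Collect_eq S_inverse)
  qed (rule S_mem)
qed

lemma generates_C0_iff:
  "generates_C0_semigroup DAt At \<longleftrightarrow> generates_C0_semigroup D0 G"
proof
  assume "generates_C0_semigroup DAt At"
  then have P: "generates_C0_semigroup (D0 \<times> UNIV) P" by (rule generation_transfer_C0[OF transfer_At_P])
  then obtain \<omega> K where "factors \<omega> K" using factors_of_generator_P by blast
  from generation_transfer_C0[OF transfer_factors(1)[OF this] P] show "generates_C0_semigroup D0 G" .
next
  assume G: "generates_C0_semigroup D0 G"
  then obtain \<omega> K where "factors \<omega> K" using factors_of_generator_G by blast
  from generation_transfer_C0[OF transfer_factors(2)[OF this] G]
  show "generates_C0_semigroup DAt At" by (rule generation_transfer_C0[OF transfer_P_At])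
qed

lemma generates_analytic_iff:
  "generates_analytic_semigroup DAt At \<longleftrightarrow> generates_analytic_semigroup D0 G"
proof
  assume "generates_analytic_semigroup DAt At"
  then have P: "generates_analytic_semigroup (D0 \<times> UNIV) P"
    by (rule generation_transfer_analytic[OF transfer_At_P])
  \<comment> \<open>\<open>K\<close> is taken from the unrotated operator, which generates a
    strongly continuous semigroup; the same \<open>K\<close> then serves every rotation.\<close>
  then obtain \<omega> K where "factors \<omega> K"
    using factors_of_generator_P generates_analytic_imp_C0 by blast
  from generation_transfer_analytic[OF transfer_factors(1)[OF this] P]
  show "generates_analytic_semigroup D0 G" .
next
  assume G: "generates_analytic_semigroup D0 G"
  then obtain \<omega> K where "factors \<omega> K"
    using factors_of_generator_G generates_analytic_imp_C0 by blast
  from generation_transfer_analytic[OF transfer_factors(2)[OF this] G]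
  show "generates_analytic_semigroup DAt At" by (rule generation_transfer_analytic[OF transfer_P_At])
qed

end

theorem proposition4p3:
  fixes DA DB :: "'x::complex_banach set"
    and A :: "'x \<Rightarrow> 'x"
    and L B :: "'x \<Rightarrow> 'y::complex_banach"
    and \<mu> :: complex
  assumes "linear_operator DA A"
    and "linear_operator DA L"
    and "linear_operator DB B"
    and "DA \<subseteq> DB"
    and G1: "closed_operator (op_ker DA L) A"
      "closure (op_ker DA L) = UNIV"
      "resolvent_set (op_ker DA L) A \<noteq> {}"
    and G2: "L ` DA = UNIV"
    and G3: "closed_operator DA (\<lambda>u. (A u, L u))"
    and "relatively_bounded (op_ker DA L) A B"
    and "\<mu> \<in> resolvent_set (op_ker DA L) A"
    and "bounded_linear (\<lambda>v. B (dirichlet_operator DA A L \<mu> v))"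
  shows "(generates_C0_semigroup {(u, v). u \<in> DA \<and> L u = v} (\<lambda>(u, v). (A u, B u)) \<longleftrightarrow>
          generates_C0_semigroup (op_ker DA L) (\<lambda>u. A u - dirichlet_operator DA A L \<mu> (B u))) \<and>
         (generates_analytic_semigroup {(u, v). u \<in> DA \<and> L u = v} (\<lambda>(u, v). (A u, B u)) \<longleftrightarrow>
          generates_analytic_semigroup (op_ker DA L) (\<lambda>u. A u - dirichlet_operator DA A L \<mu> (B u)))"
proof -
  interpret dirichlet_setting DA DB A L B \<mu>
    by (intro dirichlet_setting.intro assms)
  show ?thesis
    using generates_C0_iff generates_analytic_iff by (simp only: G_def[abs_def])
qed

end
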